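(* There exist absolute constants $C_1,C_2>0$ such that the following holds. Let $d_1,d_2$ be positive integers, $\alpha>0$, $r>0$, $0<n\le d_1d_2$, and let $f:\mathbb{R}\to[0,1]$ be a differentiable function for which $L_a$ (defined in the context) is well-defined for every $a>0$; put $L:=\lim_{a\to\infty}L_a$. Let $M\in\mathbb{R}^{d_1\times d_2}$ satisfy $\|M\|_*\le\alpha\sqrt{d_1d_2r}$. Suppose that $\Omega\subset[d_1]\times[d_2]$ is random, each $(i,j)$ being included in $\Omega$ independently with probability $\frac{n}{d_1d_2}$ (so $\mathbb{E}|\Omega|=n$), and that the observations $Y_{i,j}$, $(i,j)\in\Omega$, are generated from $M$ via $f$ according to the 1-bit observation model described in the context. Let $\widehat{M}$ be a solution of $$\widehat{M}=\arg\max_{X}\ \mathcal{L}_{\Omega,Y}(X)\quad\text{subject to}\quad\|X\|_*\le\alpha\sqrt{rd_1d_2}.$$ Then with probability at least $1-C_1/(d_1+d_2)$, $$d_H^2(f(\widehat{M}),f(M))\le C_2\,\alpha L\sqrt{\frac{r(d_1+d_2)}{n}}\sqrt{1+\frac{(d_1+d_2)\log(d_1d_2)}{n}} .$$ Furthermore, as long as $n\ge(d_1+d_2)\log(d_1d_2)$, one has (on the same event) $$d_H^2(f(\widehat{M}),f(M))\le\sqrt{2}\,C_2\,\alpha L\sqrt{\frac{r(d_1+d_2)}{n}} .$$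
   Context: Notation: $[d]=\{1,\dots,d\}$; $\|\cdot\|_*$ is the nuclear norm (sum of singular values); $\log$ is the natural logarithm; $f(M)$ denotes $f$ applied entrywise. 1-bit observation model: given $M$, $\Omega$ and $f$, for $(i,j)\in\Omega$ one observes, independently (and independently of $\Omega$), $Y_{i,j}=+1$ with probability $f(M_{i,j})$ and $Y_{i,j}=-1$ with probability $1-f(M_{i,j})$. Log-likelihood: $\mathcal{L}_{\Omega,Y}(X)=\sum_{(i,j)\in\Omega}\big(\mathbf{1}_{[Y_{i,j}=1]}\log f(X_{i,j})+\mathbf{1}_{[Y_{i,j}=-1]}\log(1-f(X_{i,j}))\big)$. Steepness parameter: $L_a:=\sup_{|x|\le a}\frac{|f'(x)|}{f(x)(1-f(x))}$; it is well-defined in particular only when $0<f(x)<1$ on $[-a,a]$. The limit $L$ may be $+\infty$, in which case the bounds are vacuous. Hellinger distance: for $p,q\in[0,1]$, $d_H^2(p,q)=(\sqrt p-\sqrt q)^2+(\sqrt{1-p}-\sqrt{1-q})^2$; for $P,Q\in[0,1]^{d_1\times d_2}$, $d_H^2(P,Q)=\frac{1}{d_1d_2}\sum_{i,j}d_H^2(P_{i,j},Q_{i,j})$. Probability is over the draw of both $\Omega$ and $Y$. *)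

theory Defs
  imports
    "HOL-Probability.Probability"
    "Jordan_Normal_Form.Char_Poly"
begin

text \<open>
  Singular values are the square roots of the eigenvalues of \<open>A\<^sup>T A\<close>, with multiplicity. The
  multiset has \<open>dim_col A\<close> elements; compared with the convention of listing only
  \<open>min (dim_row A) (dim_col A)\<close> of them, the additional ones are zero. All roots of the
  characteristic polynomial are real and nonnegative since \<open>A\<^sup>T A\<close> is positive semidefinite.
\<close>

definition singular_values :: "real mat \<Rightarrow> real multiset" where
  "singular_values A = image_mset sqrt (proots (char_poly (transpose_mat A * A)))"

definition nuclear_norm :: "real mat \<Rightarrow> real" where
  "nuclear_norm A = (\<Sum>\<sigma>\<in>#singular_values A. \<sigma>)"

text \<open>Entries are indexed from 0, so \<open>[d\<^sub>1] \<times> [d\<^sub>2]\<close> becomes \<open>{..<d1} \<times> {..<d2}\<close>.\<close>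

definition bernoulli_sample_pmf :: "nat \<Rightarrow> nat \<Rightarrow> real \<Rightarrow> (nat \<times> nat) set pmf" where
  "bernoulli_sample_pmf d1 d2 n =
     map_pmf (\<lambda>b. {p. b p})
       (Pi_pmf ({..<d1} \<times> {..<d2}) False (\<lambda>_. bernoulli_pmf (n / (real d1 * real d2))))"

definition sign_pmf :: "real \<Rightarrow> int pmf" where
  "sign_pmf p = map_pmf (\<lambda>b. if b then 1 else -1) (bernoulli_pmf p)"

text \<open>
  Joint law of \<open>(\<Omega>, Y)\<close>. Outside \<open>\<Omega>\<close> nothing is observed, which is encoded by the dummy value 0.
\<close>

definition one_bit_pmf ::
    "(real \<Rightarrow> real) \<Rightarrow> real mat \<Rightarrow> real \<Rightarrow> ((nat \<times> nat) set \<times> (nat \<times> nat \<Rightarrow> int)) pmf" where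
  "one_bit_pmf f M n =
     bind_pmf (bernoulli_sample_pmf (dim_row M) (dim_col M) n)
       (\<lambda>\<Omega>. map_pmf (\<lambda>Y. (\<Omega>, Y)) (Pi_pmf \<Omega> 0 (\<lambda>p. sign_pmf (f (M $$ p)))))"

definition log_likelihood ::
    "(real \<Rightarrow> real) \<Rightarrow> (nat \<times> nat) set \<Rightarrow> (nat \<times> nat \<Rightarrow> int) \<Rightarrow> real mat \<Rightarrow> real" where
  "log_likelihood f \<Omega> Y X =
     (\<Sum>p\<in>\<Omega>. of_bool (Y p = 1) * ln (f (X $$ p)) + of_bool (Y p = -1) * ln (1 - f (X $$ p)))"

definition steepness_defined :: "(real \<Rightarrow> real) \<Rightarrow> real \<Rightarrow> bool" where
  "steepness_defined f a \<longleftrightarrow> (\<forall>x. \<bar>x\<bar> \<le> a \<longrightarrow> 0 < f x \<and> f x < 1)"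

text \<open>The supremum is taken in the extended reals, as it may be infinite.\<close>

definition steepness :: "(real \<Rightarrow> real) \<Rightarrow> real \<Rightarrow> ereal" where
  "steepness f a = (SUP x\<in>{x. \<bar>x\<bar> \<le> a}. ereal (\<bar>deriv f x\<bar> / (f x * (1 - f x))))"

definition hellinger_sq :: "real \<Rightarrow> real \<Rightarrow> real" where
  "hellinger_sq p q = (sqrt p - sqrt q)\<^sup>2 + (sqrt (1 - p) - sqrt (1 - q))\<^sup>2"

definition hellinger_sq_mat :: "real mat \<Rightarrow> real mat \<Rightarrow> real" where
  "hellinger_sq_mat P Q =
     (\<Sum>i<dim_row P. \<Sum>j<dim_col P. hellinger_sq (P $$ (i, j)) (Q $$ (i, j)))
       / (real (dim_row P) * real (dim_col P))"

end

theory Submission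
  imports Defs
begin

text \<open>
  The Kullback-Leibler divergence dominates the squared Hellinger distance, so optimality of the
  estimator bounds \<open>n\<close> times the Hellinger distance by the largest deviation of the log-likelihood
  ratio from its mean over the nuclear norm ball. Symmetrization and the contraction principle,
  carried out one matrix entry at a time, replace the log-likelihood by a linear form given by a
  random matrix with independent entries \<open>0, 1, -1\<close>, and duality reduces everything to the
  operator norm of that sparse sign matrix \<open>A\<close>.

  This norm is bounded through the trace of a power \<open>k\<close>, of order \<open>ln (d1 + d2)\<close>, of
  \<open>A\<^sup>T A\<close>. Its expectation is a sum over closed walks that use every edge an even number of times.
  A walk with \<open>v\<close> vertices has at least \<open>v - 1\<close> edges, and whether it is even depends only
  on which of its vertices coincide; hence the sum is dominated by the corresponding one for a dense
  sign matrix of the much smaller dimension \<open>r\<close>, where \<open>r\<close> is about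
  \<open>k + q max d1 d2\<close> for the sampling rate \<open>q\<close>. As \<open>k \<le> r\<close>, a discretization
  argument suffices for the dense matrix.
\<close>

section \<open>Orthogonal diagonalization of real symmetric matrices\<close>

text \<open>The nuclear norm ball is infinite, and it bounds single entries by nothing better than
  its radius. The first obstacle disappears because the observations have finite support: the
  estimator takes finitely many values, a maximum over these replaces the supremum, and every
  expectation is a finite sum. The second is why a global Lipschitz constant of both log-likelihood
  terms, the limit \<open>L\<close>, enters the bound.

  Discretizing the sparse matrix directly is too weak, since the sub-Gaussian constant of a sparse
  sign does not shrink like \<open>sqrt q\<close>. For a dense \<open>r\<close> by \<open>r\<close>
  matrix the cost of a grid, exponential in \<open>r\<close>, is harmless in a moment of order
  \<open>r\<close>, and the comparison of walks carries this over to the sparse matrix. In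
  \<open>r\<close> the part \<open>k\<close> leaves room for distinct labels and the part
  \<open>q max d1 d2\<close> is an expected degree; they lead to the two summands under the square
  root of the rate.

  The trace overestimates the power of the norm by a factor of order \<open>d2\<close>. Markov's
  inequality for a moment of order \<open>2 k\<close> with \<open>k \<ge> ln (d1 + d2)\<close> makes
  up for it.\<close>

no_notation vec_nth (infixl "$" 90)

text \<open>The complex matrix has an eigenvector \<open>w\<close>. Its quadratic form
  \<open>s\<close> is real by symmetry and equals \<open>z\<close> times the positive number
  \<open>t\<close>, so \<open>z\<close> is real. Then the real and the imaginary part of
  \<open>w\<close> satisfy the same equation, and one of them is nonzero at
  \<open>i0\<close>.\<close>

lemma symmetric_unit_eigenvector:
  fixes G :: "real mat"
  assumes G: "G \<in> carrier_mat n n" and sym: "transpose_mat G = G" and n: "n > 0"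
  shows "\<exists>e v. (\<Sum>i<n. (v i)\<^sup>2) = (1::real) \<and> (\<forall>i<n. (\<Sum>j<n. G $$ (i,j) * v j) = e * v i)"
proof -
  define Gc where "Gc = map_mat complex_of_real G"
  have Gc: "Gc \<in> carrier_mat n n" using G by (auto simp: Gc_def)
  have "degree (char_poly Gc) = n" using degree_monic_char_poly[OF Gc] by simp
  then have "\<not> constant (poly (char_poly Gc))" using n by (simp add: constant_degree)
  then obtain z where "poly (char_poly Gc) z = 0"
    using fundamental_theorem_of_algebra by blast
  then have "eigenvalue Gc z" using eigenvalue_root_char_poly[OF Gc] by simp
  then obtain w where w: "w \<in> carrier_vec n" "w \<noteq> 0\<^sub>v n" "Gc *\<^sub>v w = z \<cdot>\<^sub>v w"
    using Gc by (auto simp: eigenvalue_def eigenvector_def)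
  have eq: "(\<Sum>j<n. complex_of_real (G $$ (i,j)) * w $ j) = z * w $ i" if "i < n" for i
  proof -
    have "(Gc *\<^sub>v w) $ i = z * w $ i" unfolding w(3) using w(1) that by simp
    moreover have "(Gc *\<^sub>v w) $ i = (\<Sum>j<n. complex_of_real (G $$ (i,j)) * w $ j)"
      using that G w(1) by (simp add: Gc_def scalar_prod_def atLeast0LessThan)
    ultimately show ?thesis by simp
  qed
  have symG: "G $$ (i,j) = G $$ (j,i)" if "i < n" "j < n" for i j
    using arg_cong[OF sym, of "\<lambda>M. M $$ (i,j)"] that G by simp
  define s where "s = (\<Sum>i<n. \<Sum>j<n. cnj (w $ i) * (complex_of_real (G $$ (i,j)) * w $ j))"
  define t where "t = (\<Sum>i<n. (cmod (w $ i))\<^sup>2)"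
  have s1: "s = z * of_real t"
  proof -
    have "s = (\<Sum>i<n. cnj (w $ i) * (z * w $ i))"
      unfolding s_def by (intro sum.cong refl) (simp add: eq flip: sum_distrib_left)
    also have "\<dots> = z * (\<Sum>i<n. w $ i * cnj (w $ i))"
      by (simp add: sum_distrib_left mult_ac)
    also have "\<dots> = z * of_real t"
      by (simp only: t_def of_real_sum complex_norm_square)
    finally show ?thesis .
  qed
  have s2: "cnj s = s"
  proof -
    have "cnj s = (\<Sum>i<n. \<Sum>j<n. w $ i * (complex_of_real (G $$ (i,j)) * cnj (w $ j)))"
      by (simp add: s_def)
    also have "\<dots> = (\<Sum>j<n. \<Sum>i<n. w $ i * (complex_of_real (G $$ (i,j)) * cnj (w $ j)))"
      by (rule sum.swap)
    also have "\<dots> = s"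
      unfolding s_def by (intro sum.cong refl) (auto simp: symG)
    finally show ?thesis .
  qed
  have "\<exists>i<n. w $ i \<noteq> 0" using w by (metis carrier_vecD eq_vecI index_zero_vec)
  then obtain i0 where i0: "i0 < n" "w $ i0 \<noteq> 0" by blast
  have "t > 0" unfolding t_def
    by (rule sum_pos2[of _ i0]) (use i0 in auto)
  then have "cnj z = z" using s1 s2 by (auto simp: complex_cnj_mult)
  then have z: "z = of_real (Re z)" by (metis Reals_cnj_iff of_real_Re)
  then have z0: "Im z = 0" by (metis Im_complex_of_real)
  have *: ?thesis if u: "\<And>i. i < n \<Longrightarrow> (\<Sum>j<n. G $$ (i,j) * u j) = Re z * u i" "u i0 \<noteq> 0" for u
  proof -
    define c where "c = sqrt (\<Sum>i<n. (u i)\<^sup>2)"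
    have pos: "(\<Sum>i<n. (u i)\<^sup>2) > 0" by (rule sum_pos2[of _ i0]) (use i0 u in auto)
    then have c: "c > 0" "c\<^sup>2 = (\<Sum>i<n. (u i)\<^sup>2)" by (auto simp: c_def)
    have "(\<Sum>i<n. (u i / c)\<^sup>2) = 1"
      unfolding power_divide sum_divide_distrib[symmetric] c(2)[symmetric] using c(1) by simp
    moreover have "(\<Sum>j<n. G $$ (i,j) * (u j / c)) = Re z * (u i / c)" if "i < n" for i
      using u(1)[OF that] by (simp flip: sum_divide_distrib)
    ultimately show ?thesis by (intro exI[of _ "Re z"] exI[of _ "\<lambda>i. u i / c"]) auto
  qed
  have re: "(\<Sum>j<n. G $$ (i,j) * Re (w $ j)) = Re z * Re (w $ i)" if "i < n" for i
    using arg_cong[OF eq[OF that], of Re] z0 by simp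
  have im: "(\<Sum>j<n. G $$ (i,j) * Im (w $ j)) = Re z * Im (w $ i)" if "i < n" for i
    using arg_cong[OF eq[OF that], of Im] z0 by simp
  show ?thesis
  proof (cases "Re (w $ i0) = 0")
    case True
    then have "Im (w $ i0) \<noteq> 0" using i0 complex_eqI[of "w $ i0" 0] by auto
    then show ?thesis using *[of "\<lambda>j. Im (w $ j)"] im by blast
  next
    case False
    then show ?thesis using *[of "\<lambda>j. Re (w $ j)"] re by blast
  qed
qed

text \<open>The reflection along \<open>w = v - e_0\<close> exchanges the first unit vector
  \<open>e_0\<close> and \<open>v\<close>; the first case is the degenerate one where they
  coincide.\<close>

lemma householder:
  fixes v :: "nat \<Rightarrow> real"
  assumes v: "(\<Sum>i<n. (v i)\<^sup>2) = 1" and n: "n > 0"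
  shows "\<exists>H \<in> carrier_mat n n. transpose_mat H = H \<and> H * H = 1\<^sub>m n \<and> (\<forall>i<n. H $$ (i,0) = v i)"
proof (cases "\<forall>i<n. v i = (if i = 0 then 1 else 0)")
  case True
  then show ?thesis using n by (intro bexI[of _ "1\<^sub>m n"]) auto
next
  case False
  define w where "w i = v i - (if i = 0 then 1 else 0)" for i :: nat
  define s where "s = (\<Sum>i<n. (w i)\<^sup>2)"
  obtain i0 where "i0 < n" "w i0 \<noteq> 0" using False by (auto simp: w_def)
  then have s: "s > 0" unfolding s_def by (intro sum_pos2[of _ i0]) auto
  define H where "H = mat n n (\<lambda>(i,j). (if i = j then 1 else 0) - 2 / s * w i * w j)"
  have H: "H \<in> carrier_mat n n" by (simp add: H_def)
  \<comment> \<open>As \<open>v\<close> has norm 1, the coefficient \<open>2 / s * w 0\<close>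
    becomes -1, which makes \<open>v\<close> the first column of \<open>H\<close>.\<close>
  have s': "s = 2 - 2 * v 0"
  proof -
    have "s = (\<Sum>i<n. (v i)\<^sup>2 + ((if i = 0 then 1 else 0) - 2 * (if i = 0 then v i else 0)))"
      unfolding s_def w_def by (intro sum.cong refl) (auto simp: power2_eq_square algebra_simps)
    also have "\<dots> = 2 - 2 * v 0"
      using n v by (simp add: sum.distrib sum_subtractf flip: sum_distrib_left)
    finally show ?thesis .
  qed
  have "transpose_mat H = H" by (rule eq_matI) (auto simp: H_def)
  moreover have "H * H = 1\<^sub>m n"
  proof (rule eq_matI)
    fix i j assume ij: "i < dim_row (1\<^sub>m n :: real mat)" "j < dim_col (1\<^sub>m n :: real mat)"
    then have ij: "i < n" "j < n" by auto
    have "(H * H) $$ (i,j) = (\<Sum>l<n. ((if i = l then 1 else 0) - 2 / s * w i * w l) *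
           ((if l = j then 1 else 0) - 2 / s * w l * w j))"
      using ij by (simp add: H_def scalar_prod_def atLeast0LessThan)
    also have "\<dots> = (\<Sum>l<n. (if i = l then (if l = j then 1 else 0) else 0)
        - (if i = l then 2 / s * w l * w j else 0) - (if l = j then 2 / s * w i * w l else 0)
        + (2 / s)\<^sup>2 * w i * w j * (w l)\<^sup>2)"
      by (intro sum.cong refl) (auto simp: power2_eq_square algebra_simps)
    also have "\<dots> = (if i = j then 1 else 0) - 4 / s * w i * w j + (2 / s)\<^sup>2 * w i * w j * s"
      using ij by (simp add: sum.distrib sum_subtractf s_def flip: sum_distrib_left)
    also have "\<dots> = 1\<^sub>m n $$ (i,j)"
      using s ij by (simp add: power2_eq_square)
    finally show "(H * H) $$ (i,j) = 1\<^sub>m n $$ (i,j)" .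
  qed (auto simp: H_def)
  moreover have "H $$ (i,0) = v i" if "i < n" for i
  proof -
    have "2 / s * w 0 = -1" using s unfolding s' by (simp add: w_def field_simps)
    then have "2 / s * w i * w 0 = - w i" by (metis mult.commute mult.left_commute mult_minus1)
    then show ?thesis using that n by (auto simp: H_def w_def)
  qed
  ultimately show ?thesis using H by blast
qed

text \<open>Deflation: in the orthonormal basis of the columns of \<open>H\<close>, the first of
  which is an eigenvector, the first row and column vanish off the diagonal, and the induction
  hypothesis treats the remaining block.\<close>

lemma symmetric_diagonalize:
  fixes G :: "real mat"
  assumes "G \<in> carrier_mat n n" "transpose_mat G = G"
  shows "\<exists>U \<in> carrier_mat n n. transpose_mat U * U = 1\<^sub>m n \<and>
           diagonal_mat (transpose_mat U * G * U)"
  using assms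
proof (induction n arbitrary: G)
  case 0
  then show ?case by (intro bexI[of _ "1\<^sub>m 0"]) (auto simp: diagonal_mat_def)
next
  case (Suc m G)
  note G = Suc.prems
  obtain e v where v: "(\<Sum>i<Suc m. (v i)\<^sup>2) = (1::real)"
      "\<And>i. i < Suc m \<Longrightarrow> (\<Sum>j<Suc m. G $$ (i,j) * v j) = e * v i"
    using symmetric_unit_eigenvector[OF G] by blast
  obtain H where H: "H \<in> carrier_mat (Suc m) (Suc m)" "transpose_mat H = H" "H * H = 1\<^sub>m (Suc m)"
      "\<And>i. i < Suc m \<Longrightarrow> H $$ (i,0) = v i"
    using householder[OF v(1)] by blast
  define K where "K = H * (G * H)"
  have K: "K \<in> carrier_mat (Suc m) (Suc m)" using H G by (auto simp: K_def)
  have GH: "(G * H) $$ (i,0) = e * H $$ (i,0)" if "i < Suc m" for i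
  proof -
    have "(G * H) $$ (i,0) = (\<Sum>j<Suc m. G $$ (i,j) * H $$ (j,0))"
      using that H G by (simp add: scalar_prod_def atLeast0LessThan)
    also have "\<dots> = (\<Sum>j<Suc m. G $$ (i,j) * v j)" using H by (intro sum.cong) auto
    finally show ?thesis using v(2)[OF that] H that by simp
  qed
  have K0: "K $$ (i,0) = (if i = 0 then e else 0)" if "i < Suc m" for i
  proof -
    have "K $$ (i,0) = (\<Sum>j<Suc m. H $$ (i,j) * (G * H) $$ (j,0))"
      using that H G by (simp add: K_def scalar_prod_def atLeast0LessThan)
    also have "\<dots> = (\<Sum>j<Suc m. H $$ (i,j) * (e * H $$ (j,0)))" by (intro sum.cong) (auto simp: GH)
    also have "\<dots> = e * (\<Sum>j<Suc m. H $$ (i,j) * H $$ (j,0))" by (simp add: sum_distrib_left mult_ac del: sum.lessThan_Suc)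
    also have "(\<Sum>j<Suc m. H $$ (i,j) * H $$ (j,0)) = (H * H) $$ (i,0)"
      using that H(1) by (simp add: scalar_prod_def atLeast0LessThan)
    also have "\<dots> = (if i = 0 then 1 else 0)" using that by (simp add: H(3))
    finally show ?thesis by simp
  qed
  have Ksym: "transpose_mat K = K"
    using H G by (simp add: K_def transpose_mult[of _ "Suc m" "Suc m" _ "Suc m"] assoc_mult_mat[of _ "Suc m" "Suc m" _ "Suc m" _ "Suc m"])
  have K0': "K $$ (0,j) = (if j = 0 then e else 0)" if "j < Suc m" for j
    using arg_cong[OF Ksym, of "\<lambda>M. M $$ (j,0)"] K0[OF that] that K by auto
  define G' where "G' = mat m m (\<lambda>(i,j). K $$ (Suc i, Suc j))"
  have G': "G' \<in> carrier_mat m m" by (simp add: G'_def)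
  have "transpose_mat G' = G'"
  proof (rule eq_matI)
    fix i j assume "i < dim_row G'" "j < dim_col G'"
    then show "transpose_mat G' $$ (i,j) = G' $$ (i,j)"
      using arg_cong[OF Ksym, of "\<lambda>M. M $$ (Suc i,Suc j)"] K by (auto simp: G'_def)
  qed (auto simp: G'_def)
  then obtain U' where U': "U' \<in> carrier_mat m m" "transpose_mat U' * U' = 1\<^sub>m m"
      "diagonal_mat (transpose_mat U' * G' * U')"
    using Suc.IH[OF G'] by blast
  define E where "E = mat 1 1 (\<lambda>_. e)"
  have E: "E \<in> carrier_mat 1 1" by (simp add: E_def)
  have Kb: "K = four_block_mat E (0\<^sub>m 1 m) (0\<^sub>m m 1) G'"
    by (rule eq_matI) (use K K0 K0' in \<open>auto simp: E_def G'_def\<close>)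
  define U1 where "U1 = four_block_mat (1\<^sub>m 1) (0\<^sub>m 1 m) (0\<^sub>m m 1) U'"
  have U1: "U1 \<in> carrier_mat (Suc m) (Suc m)" using U' by (auto simp: U1_def)
  have U1T: "transpose_mat U1 = four_block_mat (1\<^sub>m 1) (0\<^sub>m 1 m) (0\<^sub>m m 1) (transpose_mat U')"
    using U' unfolding U1_def by (subst transpose_four_block_mat[of _ 1 1 _ m _ m]) auto
  have U1o: "transpose_mat U1 * U1 = 1\<^sub>m (Suc m)"
    unfolding U1T using U' unfolding U1_def
    by (subst mult_four_block_mat[of _ 1 1 _ m _ m _ _ 1 _ m]) auto
  have TK: "transpose_mat U1 * K * U1 =
      four_block_mat E (0\<^sub>m 1 m) (0\<^sub>m m 1) (transpose_mat U' * G' * U')"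
    unfolding U1T Kb using U' E G' unfolding U1_def
    by (subst mult_four_block_mat[of _ 1 1 _ m _ m _ _ 1 _ m]; (subst mult_four_block_mat[of _ 1 1 _ m _ m _ _ 1 _ m])?) auto
  define U where "U = H * U1"
  have U: "U \<in> carrier_mat (Suc m) (Suc m)" using H U1 by (auto simp: U_def)
  have UT: "transpose_mat U = transpose_mat U1 * H"
    using H U1 by (simp add: U_def transpose_mult[of _ "Suc m" "Suc m" _ "Suc m"])
  note assoc = assoc_mult_mat[of _ "Suc m" "Suc m" _ "Suc m" _ "Suc m"]
  have U1T': "transpose_mat U1 \<in> carrier_mat (Suc m) (Suc m)" using U1 by auto
  have "transpose_mat U * U = transpose_mat U1 * (H * (H * U1))"
    unfolding UT unfolding U_def using H U1 U1T' by (simp add: assoc)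
  also have "H * (H * U1) = U1" using H U1 by (simp flip: assoc)
  finally have 1: "transpose_mat U * U = 1\<^sub>m (Suc m)" by (simp add: U1o)
  have "transpose_mat U * G * U = transpose_mat U1 * K * U1"
    unfolding UT unfolding U_def K_def using H U1 G U1T' by (simp add: assoc)
  moreover have "diagonal_mat (transpose_mat U1 * K * U1)"
    unfolding TK using U' E by (auto simp: diagonal_mat_def)
  ultimately show ?case using U 1 by auto
qed

section \<open>Duality between nuclear norm and operator norm\<close>

lemma proots_prod_list_linear: "proots (\<Prod>a\<leftarrow>as. [:- a, 1:]) = mset (as :: real list)"
proof (induction as)
  case (Cons a as)
  have "(\<Prod>a\<leftarrow>as. [:- a, 1:]) \<noteq> 0" by (auto simp: prod_list_zero_iff)
  then show ?case using Cons proots_mult[of "[:- a, 1:]" "\<Prod>a\<leftarrow>as. [:- a, 1:]"]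
    by (simp del: mult_pCons_left)
qed simp

text \<open>\<open>V j\<close> is the \<open>j\<close>-th right singular vector of \<open>A\<close>.\<close>

definition singular_frame :: "nat \<Rightarrow> nat \<Rightarrow> (nat \<Rightarrow> nat \<Rightarrow> real) \<Rightarrow> (nat \<Rightarrow> nat \<Rightarrow> real) \<Rightarrow> bool" where
  "singular_frame d1 d2 A V \<longleftrightarrow>
     (\<forall>j<d2. \<forall>j'<d2. (\<Sum>l<d2. V j l * V j' l) = of_bool (j = j')) \<and>
     (\<forall>l<d2. \<forall>l'<d2. (\<Sum>j<d2. V j l * V j l') = of_bool (l = l')) \<and>
     (\<forall>j<d2. \<forall>j'<d2. j \<noteq> j' \<longrightarrow>
       (\<Sum>i<d1. (\<Sum>l<d2. A i l * V j l) * (\<Sum>l<d2. A i l * V j' l)) = 0)"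

text \<open>The columns of the diagonalizing matrix \<open>U\<close> serve as \<open>V\<close>.
  Being similar to the Gram matrix, \<open>D\<close> has the same characteristic polynomial, and its
  diagonal holds the squared lengths of the images of the \<open>V j\<close> under
  \<open>X\<close>.\<close>

lemma singular_frame_nuclear_norm:
  fixes X :: "real mat"
  assumes X: "X \<in> carrier_mat d1 d2"
  shows "\<exists>V. singular_frame d1 d2 (\<lambda>i l. X $$ (i,l)) V \<and>
    nuclear_norm X = (\<Sum>j<d2. sqrt (\<Sum>i<d1. (\<Sum>l<d2. X $$ (i,l) * V j l)\<^sup>2))"
proof -
  define G where "G = transpose_mat X * X"
  have G: "G \<in> carrier_mat d2 d2" using X by (auto simp: G_def)
  have "transpose_mat G = G" using X by (simp add: G_def transpose_mult[of _ d2 d1 _ d2])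
  then obtain U where U: "U \<in> carrier_mat d2 d2" "transpose_mat U * U = 1\<^sub>m d2"
      "diagonal_mat (transpose_mat U * G * U)"
    using symmetric_diagonalize[OF G] by blast
  have UT: "transpose_mat U \<in> carrier_mat d2 d2" using U by auto
  have U': "U * transpose_mat U = 1\<^sub>m d2" using mat_mult_left_right_inverse[OF UT U(1,2)] .
  define D where "D = transpose_mat U * G * U"
  have D: "D \<in> carrier_mat d2 d2" using U G by (auto simp: D_def)
  define V where "V j l = U $$ (l,j)" for j l
  have XU: "(X * U) $$ (i,j) = (\<Sum>l<d2. X $$ (i,l) * V j l)" if "i < d1" "j < d2" for i j
    using that X U by (simp add: V_def scalar_prod_def atLeast0LessThan)
  have "D = transpose_mat (X * U) * (X * U)"
    unfolding D_def G_def using X U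
    by (simp add: transpose_mult[of _ d1 d2 _ d2] assoc_mult_mat[of _ d2 d1 _ d2 _ d2]
        assoc_mult_mat[of _ d2 d2 _ d1 _ d2] assoc_mult_mat[of _ d2 d2 _ d2 _ d2])
  then have Dij: "D $$ (j,j') = (\<Sum>i<d1. (\<Sum>l<d2. X $$ (i,l) * V j l) * (\<Sum>l<d2. X $$ (i,l) * V j' l))"
    if "j < d2" "j' < d2" for j j'
    using that X U by (simp add: scalar_prod_def atLeast0LessThan V_def)
  have diag: "D $$ (j,j') = 0" if "j < d2" "j' < d2" "j \<noteq> j'" for j j'
    using U(3) D that by (auto simp: D_def[symmetric] diagonal_mat_def)
  have "G = U * D * transpose_mat U"
  proof -
    note assoc = assoc_mult_mat[of _ d2 d2 _ d2 _ d2]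
    have "U * D * transpose_mat U = (U * transpose_mat U) * G * (U * transpose_mat U)"
      unfolding D_def using U UT G by (simp add: assoc)
    then show ?thesis using G by (simp add: U')
  qed
  then have "similar_mat_wit G D U (transpose_mat U)"
    using U U' UT G D by (intro similar_mat_witI[of _ _ d2]) auto
  then have "char_poly G = char_poly D" by (intro char_poly_similar) (auto simp: similar_mat_def)
  also have "\<dots> = (\<Prod>a\<leftarrow>diag_mat D. [:- a, 1:])"
    using diag D by (intro char_poly_upper_triangular[of _ d2]) (auto simp: upper_triangular_def)
  finally have "proots (char_poly G) = mset (diag_mat D)"
    by (simp add: proots_prod_list_linear)
  then have "nuclear_norm X = sum_list (map sqrt (diag_mat D))"
    by (simp add: nuclear_norm_def singular_values_def G_def sum_mset_sum_list flip: mset_map)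
  also have "\<dots> = (\<Sum>j<d2. sqrt (D $$ (j,j)))"
    using D by (simp add: diag_mat_def interv_sum_list_conv_sum_set_nat atLeast0LessThan o_def)
  also have "\<dots> = (\<Sum>j<d2. sqrt (\<Sum>i<d1. (\<Sum>l<d2. X $$ (i,l) * V j l)\<^sup>2))"
    by (intro sum.cong refl) (simp add: Dij power2_eq_square)
  finally have nn: "nuclear_norm X = (\<Sum>j<d2. sqrt (\<Sum>i<d1. (\<Sum>l<d2. X $$ (i,l) * V j l)\<^sup>2))" .
  have "(\<Sum>l<d2. V j l * V j' l) = of_bool (j = j')" if "j < d2" "j' < d2" for j j'
    using arg_cong[OF U(2), of "\<lambda>M. M $$ (j,j')"] that U(1)
    by (simp add: scalar_prod_def atLeast0LessThan V_def)
  moreover have "(\<Sum>j<d2. V j l * V j l') = of_bool (l = l')" if "l < d2" "l' < d2" for l l'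
    using arg_cong[OF U', of "\<lambda>M. M $$ (l,l')"] that U(1)
    by (simp add: scalar_prod_def atLeast0LessThan V_def)
  moreover have "(\<Sum>i<d1. (\<Sum>l<d2. X $$ (i,l) * V j l) * (\<Sum>l<d2. X $$ (i,l) * V j' l)) = 0"
    if "j < d2" "j' < d2" "j \<noteq> j'" for j j'
    using diag[OF that] Dij that by simp
  ultimately show ?thesis using nn unfolding singular_frame_def by blast
qed

text \<open>Evaluated in the basis \<open>V\<close> of right singular vectors of \<open>X\<close>,
  the trace inner product is the sum over \<open>j\<close> of the inner products of
  \<open>A V_j\<close> and \<open>X V_j\<close>. Cauchy-Schwarz bounds each by \<open>s\<close>
  times the length of \<open>X V_j\<close>, a singular value.\<close>

lemma inner_le_opnorm_nuclear_norm:
  fixes A :: "nat \<Rightarrow> nat \<Rightarrow> real" and X :: "real mat"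
  assumes X: "X \<in> carrier_mat d1 d2" and s: "s \<ge> 0"
    and A: "\<And>v. (\<Sum>l<d2. (v l)\<^sup>2) = 1 \<Longrightarrow> (\<Sum>i<d1. (\<Sum>l<d2. A i l * v l)\<^sup>2) \<le> s\<^sup>2"
  shows "\<bar>\<Sum>i<d1. \<Sum>l<d2. A i l * X $$ (i,l)\<bar> \<le> s * nuclear_norm X"
proof -
  obtain V where V: "singular_frame d1 d2 (\<lambda>i l. X $$ (i,l)) V"
    "nuclear_norm X = (\<Sum>j<d2. sqrt (\<Sum>i<d1. (\<Sum>l<d2. X $$ (i,l) * V j l)\<^sup>2))"
    using singular_frame_nuclear_norm[OF X] by blast
  have V1: "(\<Sum>l<d2. V j l * V j' l) = of_bool (j = j')" if "j < d2" "j' < d2" for j j'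
    using V(1) that by (simp add: singular_frame_def)
  have V2: "(\<Sum>j<d2. V j l * V j l') = of_bool (l = l')" if "l < d2" "l' < d2" for l l'
    using V(1) that by (simp add: singular_frame_def)
  \<comment> \<open>Completeness of \<open>V\<close> is inserted between the column indices
    \<open>l\<close> and \<open>l'\<close>.\<close>
  have "(\<Sum>i<d1. \<Sum>l<d2. A i l * X $$ (i,l))
      = (\<Sum>i<d1. \<Sum>l<d2. \<Sum>l'<d2. A i l * X $$ (i,l') * (\<Sum>j<d2. V j l * V j l'))"
    by (intro sum.cong refl) (simp add: V2 of_bool_def if_distrib cong: if_cong)
  also have "\<dots> = (\<Sum>i<d1. \<Sum>l<d2. \<Sum>l'<d2. \<Sum>j<d2. (A i l * V j l) * (X $$ (i,l') * V j l'))"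
    by (simp add: sum_distrib_left mult_ac)
  also have "\<dots> = (\<Sum>i<d1. \<Sum>j<d2. (\<Sum>l<d2. A i l * V j l) * (\<Sum>l'<d2. X $$ (i,l') * V j l'))"
  proof (rule sum.cong[OF refl])
    fix i
    have "(\<Sum>l<d2. \<Sum>l'<d2. \<Sum>j<d2. (A i l * V j l) * (X $$ (i,l') * V j l')) =
       (\<Sum>l<d2. \<Sum>j<d2. \<Sum>l'<d2. (A i l * V j l) * (X $$ (i,l') * V j l'))"
      by (rule sum.cong[OF refl], rule sum.swap)
    also have "\<dots> = (\<Sum>j<d2. \<Sum>l<d2. \<Sum>l'<d2. (A i l * V j l) * (X $$ (i,l') * V j l'))"
      by (rule sum.swap)
    finally show "(\<Sum>l<d2. \<Sum>l'<d2. \<Sum>j<d2. (A i l * V j l) * (X $$ (i,l') * V j l')) =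
      (\<Sum>j<d2. (\<Sum>l<d2. A i l * V j l) * (\<Sum>l'<d2. X $$ (i,l') * V j l'))"
      by (simp add: sum_product)
  qed
  also have "\<dots> = (\<Sum>j<d2. \<Sum>i<d1. (\<Sum>l<d2. A i l * V j l) * (\<Sum>l'<d2. X $$ (i,l') * V j l'))"
    by (rule sum.swap)
  finally have eq: "(\<Sum>i<d1. \<Sum>l<d2. A i l * X $$ (i,l)) = \<dots>" .
  have "\<bar>\<Sum>i<d1. \<Sum>l<d2. A i l * X $$ (i,l)\<bar> \<le>
      (\<Sum>j<d2. \<bar>\<Sum>i<d1. (\<Sum>l<d2. A i l * V j l) * (\<Sum>l'<d2. X $$ (i,l') * V j l')\<bar>)"
    unfolding eq by (rule sum_abs)
  also have "\<dots> \<le> (\<Sum>j<d2. s * sqrt (\<Sum>i<d1. (\<Sum>l<d2. X $$ (i,l) * V j l)\<^sup>2))"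
  proof (rule sum_mono)
    fix j assume j: "j \<in> {..<d2}"
    have "(\<Sum>l<d2. (V j l)\<^sup>2) = 1" using V1[of j j] j by (simp add: power2_eq_square)
    then have *: "(\<Sum>i<d1. (\<Sum>l<d2. A i l * V j l)\<^sup>2) \<le> s\<^sup>2" by (rule A)
    have "\<bar>\<Sum>i<d1. (\<Sum>l<d2. A i l * V j l) * (\<Sum>l'<d2. X $$ (i,l') * V j l')\<bar> \<le>
       (\<Sum>i<d1. \<bar>\<Sum>l<d2. A i l * V j l\<bar> * \<bar>\<Sum>l'<d2. X $$ (i,l') * V j l'\<bar>)"
      by (rule order_trans[OF sum_abs]) (simp add: abs_mult)
    also have "\<dots> \<le> L2_set (\<lambda>i. \<Sum>l<d2. A i l * V j l) {..<d1} * L2_set (\<lambda>i. \<Sum>l'<d2. X $$ (i,l') * V j l') {..<d1}"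
      by (rule L2_set_mult_ineq)
    also have "\<dots> \<le> s * L2_set (\<lambda>i. \<Sum>l'<d2. X $$ (i,l') * V j l') {..<d1}"
      using * s by (intro mult_right_mono L2_set_nonneg) (auto simp: L2_set_def real_le_lsqrt intro: sum_nonneg)
    finally show "\<bar>\<Sum>i<d1. (\<Sum>l<d2. A i l * V j l) * (\<Sum>l'<d2. X $$ (i,l') * V j l')\<bar> \<le>
        s * sqrt (\<Sum>i<d1. (\<Sum>l<d2. X $$ (i,l) * V j l)\<^sup>2)"
      by (simp add: L2_set_def)
  qed
  also have "\<dots> = s * nuclear_norm X" by (simp add: V(2) sum_distrib_left)
  finally show ?thesis .
qed

section \<open>Traces of powers of the Gram matrix\<close>

lemma sum_PiE_insert:
  assumes "x \<notin> A"
  shows "(\<Sum>f\<in>PiE (insert x A) B. g f) = (\<Sum>y\<in>B x. \<Sum>f\<in>PiE A B. g (f(x := y)))"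
proof -
  have "(\<Sum>f\<in>PiE (insert x A) B. g f) = (\<Sum>(y, f)\<in>B x \<times> PiE A B. g (f(x := y)))"
    unfolding PiE_insert_eq using inj_combinator[OF assms]
    by (subst sum.reindex) (auto simp: case_prod_unfold o_def)
  then show ?thesis by (simp add: sum.cartesian_product)
qed

definition gram :: "nat \<Rightarrow> (nat \<Rightarrow> nat \<Rightarrow> real) \<Rightarrow> nat \<Rightarrow> nat \<Rightarrow> real" where
  "gram d1 A l l' = (\<Sum>i<d1. A i l * A i l')"

text \<open>The trace of \<open>(A\<^sup>T A) ^ k\<close>, written out over closed walks.\<close>

definition gram_trace :: "nat \<Rightarrow> nat \<Rightarrow> (nat \<Rightarrow> nat \<Rightarrow> real) \<Rightarrow> nat \<Rightarrow> real" where
  "gram_trace d1 d2 A k =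
     (\<Sum>a\<in>{..k} \<rightarrow>\<^sub>E {..<d2}. \<Sum>b\<in>{..<k} \<rightarrow>\<^sub>E {..<d1}.
        of_bool (a k = a 0) * (\<Prod>t<k. A (b t) (a t) * A (b t) (a (Suc t))))"

text \<open>Spectral decomposition of \<open>A^T A\<close>; the eigenvalues \<open>e j\<close> are
  the squared singular values of \<open>A\<close>.\<close>

lemma gram_eigen:
  assumes V: "singular_frame d1 d2 A V" and l: "l < d2" "l' < d2"
  defines "e \<equiv> \<lambda>j. \<Sum>i<d1. (\<Sum>l<d2. A i l * V j l)\<^sup>2"
  shows "gram d1 A l l' = (\<Sum>j<d2. e j * V j l * V j l')"
proof -
  define w where "w j i = (\<Sum>l<d2. A i l * V j l)" for j i
  have A: "A i l = (\<Sum>j<d2. w j i * V j l)" if "l < d2" for i l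
  proof -
    have "(\<Sum>j<d2. w j i * V j l) = (\<Sum>j<d2. \<Sum>m<d2. A i m * (V j m * V j l))"
      by (simp add: w_def sum_distrib_left sum_distrib_right mult_ac)
    also have "\<dots> = (\<Sum>m<d2. A i m * (\<Sum>j<d2. V j m * V j l))"
      by (subst sum.swap) (simp add: sum_distrib_left)
    also have "\<dots> = (\<Sum>m<d2. if m = l then A i m else 0)"
      using V that by (intro sum.cong) (auto simp: singular_frame_def)
    finally show ?thesis using that by simp
  qed
  have ww: "(\<Sum>i<d1. w j i * w j' i) = (if j = j' then e j else 0)" if "j < d2" "j' < d2" for j j'
    using V that by (auto simp: singular_frame_def w_def e_def power2_eq_square)
  have "gram d1 A l l' = (\<Sum>i<d1. \<Sum>j<d2. \<Sum>j'<d2. (w j i * w j' i) * (V j l * V j' l'))"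
    using l by (simp add: gram_def A sum_product mult_ac)
  also have "\<dots> = (\<Sum>j<d2. \<Sum>j'<d2. (\<Sum>i<d1. w j i * w j' i) * (V j l * V j' l'))"
    by (subst sum.swap, rule sum.cong[OF refl], subst sum.swap) (simp add: sum_distrib_right)
  also have "\<dots> = (\<Sum>j<d2. \<Sum>j'<d2. if j = j' then e j * (V j l * V j' l') else 0)"
    by (intro sum.cong refl) (simp add: ww)
  also have "\<dots> = (\<Sum>j<d2. e j * V j l * V j l')"
    by (intro sum.cong refl) (simp add: mult_ac)
  finally show ?thesis .
qed

text \<open>Both sides are the entry \<open>(x, y)\<close> of the \<open>k\<close>-th power of the
  Gram matrix. The endpoints stay free so that the induction can append a vertex; walks are closed
  afterwards.\<close>

lemma gram_path_eigen:
  assumes V: "singular_frame d1 d2 A V" and xy: "x < d2" "y < d2"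
  defines "e \<equiv> \<lambda>j. \<Sum>i<d1. (\<Sum>l<d2. A i l * V j l)\<^sup>2"
  shows "(\<Sum>a\<in>{..k} \<rightarrow>\<^sub>E {..<d2}. of_bool (a 0 = x \<and> a k = y) * (\<Prod>t<k. gram d1 A (a t) (a (Suc t))))
       = (\<Sum>j<d2. e j ^ k * V j x * V j y)"
  using xy(2)
proof (induction k arbitrary: y)
  case 0
  have "(\<Sum>a\<in>{..0} \<rightarrow>\<^sub>E {..<d2}. of_bool (a 0 = x \<and> a 0 = y) * (\<Prod>t<0. gram d1 A (a t) (a (Suc t)))) =
     (\<Sum>a\<in>insert (0::nat) {} \<rightarrow>\<^sub>E {..<d2}. of_bool (a 0 = x \<and> a 0 = y) :: real)"
    by simp
  also have "\<dots> = (\<Sum>z<d2. if z = x then of_bool (x = y) else 0)"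
    by (subst sum_PiE_insert) (auto intro!: sum.cong)
  finally show ?case using V xy 0 by (simp add: singular_frame_def)
next
  case (Suc k)
  have S: "{..Suc k} = insert (Suc k) {..k}" by auto
  have "(\<Sum>a\<in>{..Suc k} \<rightarrow>\<^sub>E {..<d2}. of_bool (a 0 = x \<and> a (Suc k) = y) * (\<Prod>t<Suc k. gram d1 A (a t) (a (Suc t))))
     = (\<Sum>u<d2. \<Sum>a\<in>{..k} \<rightarrow>\<^sub>E {..<d2}. of_bool (a 0 = x \<and> u = y) * ((\<Prod>t<k. gram d1 A (a t) (a (Suc t))) * gram d1 A (a k) u))"
    unfolding S by (subst sum_PiE_insert) (auto intro!: sum.cong prod.cong)
  also have "\<dots> = (\<Sum>u<d2. if u = y then \<Sum>a\<in>{..k} \<rightarrow>\<^sub>E {..<d2}. of_bool (a 0 = x) * ((\<Prod>t<k. gram d1 A (a t) (a (Suc t))) * gram d1 A (a k) u) else 0)"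
    by (intro sum.cong) auto
  also have "\<dots> = (\<Sum>a\<in>{..k} \<rightarrow>\<^sub>E {..<d2}. of_bool (a 0 = x) * ((\<Prod>t<k. gram d1 A (a t) (a (Suc t))) * gram d1 A (a k) y))"
    using Suc.prems by simp
  also have "\<dots> = (\<Sum>a\<in>{..k} \<rightarrow>\<^sub>E {..<d2}. \<Sum>z<d2. of_bool (a 0 = x \<and> a k = z) * (\<Prod>t<k. gram d1 A (a t) (a (Suc t))) * gram d1 A z y)"
  proof (rule sum.cong[OF refl])
    fix a assume a: "a \<in> {..k} \<rightarrow>\<^sub>E {..<d2}"
    let ?P = "\<Prod>t<k. gram d1 A (a t) (a (Suc t))"
    have "(\<Sum>z<d2. of_bool (a 0 = x \<and> a k = z) * ?P * gram d1 A z y) =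
       (\<Sum>z<d2. if a k = z then of_bool (a 0 = x) * (?P * gram d1 A z y) else 0)"
      by (intro sum.cong) auto
    also have "\<dots> = of_bool (a 0 = x) * (?P * gram d1 A (a k) y)"
      using PiE_mem[OF a, of k] by simp
    finally show "of_bool (a 0 = x) * (?P * gram d1 A (a k) y) = (\<Sum>z<d2. of_bool (a 0 = x \<and> a k = z) * ?P * gram d1 A z y)"
      by simp
  qed
  also have "\<dots> = (\<Sum>z<d2. (\<Sum>a\<in>{..k} \<rightarrow>\<^sub>E {..<d2}. of_bool (a 0 = x \<and> a k = z) * (\<Prod>t<k. gram d1 A (a t) (a (Suc t)))) * gram d1 A z y)"
    by (subst sum.swap) (simp add: sum_distrib_right)
  also have "\<dots> = (\<Sum>z<d2. (\<Sum>j<d2. e j ^ k * V j x * V j z) * (\<Sum>j<d2. e j * V j z * V j y))"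
    using Suc.IH gram_eigen[OF V] Suc.prems by (intro sum.cong) (auto simp: e_def)
  also have "\<dots> = (\<Sum>z<d2. \<Sum>j<d2. \<Sum>j'<d2. (e j ^ k * V j x * e j' * V j' y) * (V j z * V j' z))"
    unfolding sum_product by (simp add: mult_ac)
  also have "\<dots> = (\<Sum>j<d2. \<Sum>j'<d2. (e j ^ k * V j x * e j' * V j' y) * (\<Sum>z<d2. V j z * V j' z))"
    by (subst sum.swap, rule sum.cong[OF refl], subst sum.swap) (simp add: sum_distrib_left)
  also have "\<dots> = (\<Sum>j<d2. \<Sum>j'<d2. if j = j' then e j ^ k * V j x * e j' * V j' y else 0)"
    using V by (intro sum.cong refl) (auto simp: singular_frame_def)
  also have "\<dots> = (\<Sum>j<d2. e j ^ Suc k * V j x * V j y)"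
    by (intro sum.cong refl) (simp add: mult_ac)
  finally show ?case .
qed

lemma gram_trace_eigen:
  assumes V: "singular_frame d1 d2 A V"
  shows "gram_trace d1 d2 A k = (\<Sum>j<d2. (\<Sum>i<d1. (\<Sum>l<d2. A i l * V j l)\<^sup>2) ^ k)"
proof -
  \<comment> \<open>Summing out the row vertices \<open>b\<close> joins consecutive column vertices
    by Gram entries.\<close>
  have "gram_trace d1 d2 A k = (\<Sum>a\<in>{..k} \<rightarrow>\<^sub>E {..<d2}. of_bool (a k = a 0) * (\<Prod>t<k. gram d1 A (a t) (a (Suc t))))"
    unfolding gram_trace_def gram_def
    by (subst prod_sum_PiE) (simp_all add: sum_distrib_left)
  also have "\<dots> = (\<Sum>a\<in>{..k} \<rightarrow>\<^sub>E {..<d2}. \<Sum>x<d2. of_bool (a 0 = x \<and> a k = x) * (\<Prod>t<k. gram d1 A (a t) (a (Suc t))))"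
  proof (rule sum.cong[OF refl])
    fix a assume a: "a \<in> {..k} \<rightarrow>\<^sub>E {..<d2}"
    let ?P = "\<Prod>t<k. gram d1 A (a t) (a (Suc t))"
    have "(\<Sum>x<d2. of_bool (a 0 = x \<and> a k = x) * ?P) =
       (\<Sum>x<d2. if a 0 = x then of_bool (a k = a 0) * ?P else 0)"
      by (intro sum.cong) auto
    also have "\<dots> = of_bool (a k = a 0) * ?P"
      using PiE_mem[OF a, of 0] by simp
    finally show "of_bool (a k = a 0) * ?P = (\<Sum>x<d2. of_bool (a 0 = x \<and> a k = x) * ?P)"
      by (rule sym)
  qed
  also have "\<dots> = (\<Sum>x<d2. \<Sum>j<d2. (\<Sum>i<d1. (\<Sum>l<d2. A i l * V j l)\<^sup>2) ^ k * V j x * V j x)"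
    using gram_path_eigen[OF V] by (subst sum.swap) (intro sum.cong; simp)
  also have "\<dots> = (\<Sum>j<d2. (\<Sum>i<d1. (\<Sum>l<d2. A i l * V j l)\<^sup>2) ^ k * (\<Sum>x<d2. V j x * V j x))"
    by (subst sum.swap) (simp add: sum_distrib_left sum_distrib_right mult_ac)
  also have "\<dots> = (\<Sum>j<d2. (\<Sum>i<d1. (\<Sum>l<d2. A i l * V j l)\<^sup>2) ^ k)"
    using V by (intro sum.cong) (auto simp: singular_frame_def)
  finally show ?thesis .
qed

lemma singular_frame_exists: "\<exists>V. singular_frame d1 d2 A V"
proof -
  obtain V where "singular_frame d1 d2 (\<lambda>i l. mat d1 d2 (\<lambda>(i,l). A i l) $$ (i,l)) V"
    using singular_frame_nuclear_norm[of "mat d1 d2 (\<lambda>(i,l). A i l)" d1 d2] by auto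
  then have "singular_frame d1 d2 A V" by (simp add: singular_frame_def)
  then show ?thesis by blast
qed

lemma gram_trace_nonneg: "gram_trace d1 d2 A k \<ge> 0"
proof -
  obtain V where "singular_frame d1 d2 A V" using singular_frame_exists by blast
  then show ?thesis
    by (simp add: gram_trace_eigen sum_nonneg)
qed

lemma gram_trace_le:
  assumes "\<And>v. (\<Sum>l<d2. (v l)\<^sup>2) = 1 \<Longrightarrow> (\<Sum>i<d1. (\<Sum>l<d2. A i l * v l)\<^sup>2) \<le> s"
  shows "gram_trace d1 d2 A k \<le> real d2 * s ^ k"
proof -
  obtain V where V: "singular_frame d1 d2 A V" using singular_frame_exists by blast
  have "(\<Sum>i<d1. (\<Sum>l<d2. A i l * V j l)\<^sup>2) ^ k \<le> s ^ k" if "j < d2" for j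
    using V that by (intro power_mono assms) (auto simp: singular_frame_def power2_eq_square intro: sum_nonneg)
  then have "(\<Sum>j<d2. (\<Sum>i<d1. (\<Sum>l<d2. A i l * V j l)\<^sup>2) ^ k) \<le> (\<Sum>j<d2. s ^ k)"
    by (intro sum_mono) auto
  then show ?thesis by (simp add: gram_trace_eigen[OF V])
qed

text \<open>With the coordinates \<open>c j\<close> of \<open>v\<close> in the basis
  \<open>V\<close>, the squared length of the image is the average of the eigenvalues
  \<open>e j\<close> with weights \<open>(c j)^2\<close>. It is at most the largest eigenvalue,
  whose \<open>k\<close>-th power is a summand of the trace.\<close>

lemma opnorm_power_le_gram_trace:
  assumes v: "(\<Sum>l<d2. (v l)\<^sup>2) = 1"
  shows "(\<Sum>i<d1. (\<Sum>l<d2. A i l * v l)\<^sup>2) ^ k \<le> gram_trace d1 d2 A k"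
proof -
  obtain V where V: "singular_frame d1 d2 A V" using singular_frame_exists by blast
  define e where "e j = (\<Sum>i<d1. (\<Sum>l<d2. A i l * V j l)\<^sup>2)" for j
  define c where "c j = (\<Sum>l<d2. V j l * v l)" for j
  have e0: "e j \<ge> 0" for j by (simp add: e_def sum_nonneg)
  have d2: "d2 > 0" using v by (cases d2) auto
  have "(\<Sum>i<d1. (\<Sum>l<d2. A i l * v l)\<^sup>2) = (\<Sum>i<d1. \<Sum>l<d2. \<Sum>l'<d2. A i l * A i l' * (v l * v l'))"
    by (simp add: power2_eq_square sum_product mult_ac)
  also have "\<dots> = (\<Sum>l<d2. \<Sum>l'<d2. gram d1 A l l' * (v l * v l'))"
    unfolding gram_def
    by (subst sum.swap, rule sum.cong[OF refl], subst sum.swap) (simp add: sum_distrib_right)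
  also have "\<dots> = (\<Sum>l<d2. \<Sum>l'<d2. (\<Sum>j<d2. e j * V j l * V j l') * (v l * v l'))"
    by (intro sum.cong refl) (simp add: gram_eigen[OF V] e_def)
  also have "\<dots> = (\<Sum>l<d2. \<Sum>l'<d2. \<Sum>j<d2. e j * ((V j l * v l) * (V j l' * v l')))"
    by (simp add: sum_distrib_left sum_distrib_right mult_ac)
  also have "\<dots> = (\<Sum>l<d2. \<Sum>j<d2. \<Sum>l'<d2. e j * ((V j l * v l) * (V j l' * v l')))"
    by (rule sum.cong[OF refl], rule sum.swap)
  also have "\<dots> = (\<Sum>j<d2. \<Sum>l<d2. \<Sum>l'<d2. e j * ((V j l * v l) * (V j l' * v l')))"
    by (rule sum.swap)
  also have "\<dots> = (\<Sum>j<d2. e j * (c j)\<^sup>2)"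
    unfolding c_def power2_eq_square sum_product unfolding sum_distrib_left by simp
  finally have eq: "(\<Sum>i<d1. (\<Sum>l<d2. A i l * v l)\<^sup>2) = (\<Sum>j<d2. e j * (c j)\<^sup>2)" .
  have "(\<Sum>j<d2. (c j)\<^sup>2) = (\<Sum>j<d2. \<Sum>l<d2. \<Sum>l'<d2. (V j l * V j l') * (v l * v l'))"
    by (simp add: c_def power2_eq_square sum_product mult_ac)
  also have "\<dots> = (\<Sum>l<d2. \<Sum>l'<d2. (\<Sum>j<d2. V j l * V j l') * (v l * v l'))"
    by (subst sum.swap, rule sum.cong[OF refl], subst sum.swap) (simp add: sum_distrib_right)
  also have "\<dots> = (\<Sum>l<d2. \<Sum>l'<d2. if l = l' then v l * v l' else 0)"
    using V by (intro sum.cong refl) (auto simp: singular_frame_def)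
  also have "\<dots> = 1" using v by (simp add: power2_eq_square)
  finally have c1: "(\<Sum>j<d2. (c j)\<^sup>2) = 1" .
  define m where "m = Max (e ` {..<d2})"
  have m: "e j \<le> m" if "j < d2" for j using that by (simp add: m_def)
  have "m \<in> e ` {..<d2}" unfolding m_def using d2 by (intro Max_in) auto
  then obtain j0 where j0: "j0 < d2" "m = e j0" by auto
  have "(\<Sum>j<d2. e j * (c j)\<^sup>2) \<le> (\<Sum>j<d2. m * (c j)\<^sup>2)"
    by (intro sum_mono mult_right_mono) (auto simp: m)
  also have "\<dots> = m" by (simp add: c1 flip: sum_distrib_left)
  finally have "(\<Sum>i<d1. (\<Sum>l<d2. A i l * v l)\<^sup>2) ^ k \<le> m ^ k"
    unfolding eq by (intro power_mono) (auto intro!: sum_nonneg simp: e0)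
  also have "\<dots> \<le> (\<Sum>j<d2. e j ^ k)"
    unfolding j0(2) using j0(1) by (intro member_le_sum) (auto simp: e0)
  also have "\<dots> = gram_trace d1 d2 A k" by (simp add: gram_trace_eigen[OF V] e_def)
  finally show ?thesis .
qed

lemma inner_le_root_gram_trace:
  fixes A :: "nat \<Rightarrow> nat \<Rightarrow> real" and X :: "real mat"
  assumes X: "X \<in> carrier_mat d1 d2" and k: "k > 0" and nn: "nuclear_norm X \<le> \<tau>"
  shows "\<bar>\<Sum>i<d1. \<Sum>l<d2. A i l * X $$ (i,l)\<bar> \<le> root (2 * k) (gram_trace d1 d2 A k) * \<tau>"
proof -
  define s where "s = root (2 * k) (gram_trace d1 d2 A k)"
  have s: "s \<ge> 0" "s ^ (2 * k) = gram_trace d1 d2 A k"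
    using k gram_trace_nonneg by (auto simp: s_def)
  have "(\<Sum>i<d1. (\<Sum>l<d2. A i l * v l)\<^sup>2) \<le> s\<^sup>2" if "(\<Sum>l<d2. (v l)\<^sup>2) = 1" for v
  proof (rule power_le_imp_le_base[of _ "k - 1"])
    show "(\<Sum>i<d1. (\<Sum>l<d2. A i l * v l)\<^sup>2) ^ Suc (k - 1) \<le> (s\<^sup>2) ^ Suc (k - 1)"
      using opnorm_power_le_gram_trace[OF that, of A d1 k] k s by (simp flip: power_mult)
  qed auto
  then have "\<bar>\<Sum>i<d1. \<Sum>l<d2. A i l * X $$ (i,l)\<bar> \<le> s * nuclear_norm X"
    by (rule inner_le_opnorm_nuclear_norm[OF X s(1)])
  also have "\<dots> \<le> s * \<tau>" using nn s by (intro mult_left_mono)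
  finally show ?thesis by (simp add: s_def)
qed

section \<open>Counting label functions by their equality pattern\<close>

text \<open>The image of \<open>x\<close> is chosen first and removed from \<open>B\<close>. If
  \<open>C\<close> is larger than \<open>B\<close>, subtraction of naturals makes one factor zero,
  as it should be.\<close>

lemma card_inj_PiE:
  assumes "finite C" "finite B"
  shows "card {\<phi> \<in> C \<rightarrow>\<^sub>E B. inj_on \<phi> C} = (\<Prod>i<card C. card B - i)"
  using assms
proof (induction C arbitrary: B rule: finite_induct)
  case empty
  have "{\<phi> \<in> {} \<rightarrow>\<^sub>E B. inj_on \<phi> {}} = {\<lambda>_. undefined}" by auto
  then show ?case by simp
next
  case (insert x C)
  have fin: "finite {g \<in> C \<rightarrow>\<^sub>E (B - {y}). inj_on g C}" for y
    by (rule finite_subset[OF _ finite_PiE[of C "\<lambda>_. B - {y}"]]) (use insert in auto)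
  let ?S = "SIGMA y:B. {g \<in> C \<rightarrow>\<^sub>E (B - {y}). inj_on g C}"
  have eq: "{\<phi> \<in> insert x C \<rightarrow>\<^sub>E B. inj_on \<phi> (insert x C)} = (\<lambda>(y, g). g(x := y)) ` ?S"
    using extensional_funcset_extend_domain_inj_on_eq[OF insert.hyps(2), of B]
    by (simp add: Sigma_def) blast
  have "inj_on (\<lambda>(y, g). g(x := y)) ?S"
    using inj_combinator[OF insert.hyps(2), of "\<lambda>_. B"]
    by (rule inj_on_subset) (auto simp: PiE_iff extensional_def)
  then have "card {\<phi> \<in> insert x C \<rightarrow>\<^sub>E B. inj_on \<phi> (insert x C)} = card ?S"
    unfolding eq by (rule card_image)
  also have "\<dots> = (\<Sum>y\<in>B. card {g \<in> C \<rightarrow>\<^sub>E (B - {y}). inj_on g C})"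
    by (rule card_SigmaI[OF insert.prems]) (use fin in blast)
  also have "\<dots> = (\<Sum>y\<in>B. \<Prod>i<card C. card B - 1 - i)"
    using insert by (intro sum.cong) auto
  also have "\<dots> = (\<Prod>i<Suc (card C). card B - i)"
    by (subst prod.lessThan_Suc_shift) simp
  finally show ?case using insert by simp
qed

text \<open>Each label is replaced by the first index carrying it.\<close>

definition relabel_canonical :: "nat set \<Rightarrow> (nat \<Rightarrow> 'a) \<Rightarrow> nat \<Rightarrow> nat" where
  "relabel_canonical I a = (\<lambda>t\<in>I. LEAST s. s \<in> I \<and> a s = a t)"

text \<open>The fixed points of relabelling: one representative for each partition of
  \<open>I\<close> into classes of equal label. The image of such a \<open>c\<close> has one element
  per class.\<close>

definition canonical_labels :: "nat set \<Rightarrow> (nat \<Rightarrow> nat) set" where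
  "canonical_labels I = {c \<in> I \<rightarrow>\<^sub>E I. relabel_canonical I c = c}"

lemma relabel_canonical:
  assumes t: "t \<in> I"
  shows "relabel_canonical I a t \<in> I" "a (relabel_canonical I a t) = a t"
    and "s \<in> I \<Longrightarrow> relabel_canonical I a s = relabel_canonical I a t \<longleftrightarrow> a s = a t"
proof -
  have *: "(LEAST s. s \<in> I \<and> a s = a t) \<in> I \<and> a (LEAST s. s \<in> I \<and> a s = a t) = a t" if "t \<in> I" for t
    using LeastI[of "\<lambda>s. s \<in> I \<and> a s = a t" t] that by blast
  show "relabel_canonical I a t \<in> I" "a (relabel_canonical I a t) = a t"
    using *[OF t] t by (auto simp: relabel_canonical_def)
  show "relabel_canonical I a s = relabel_canonical I a t \<longleftrightarrow> a s = a t" if "s \<in> I"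
    using *[OF t] *[OF that] t that by (auto simp: relabel_canonical_def)
qed

lemma relabel_canonical_cong:
  assumes "\<And>s t. s \<in> I \<Longrightarrow> t \<in> I \<Longrightarrow> a s = a t \<longleftrightarrow> a' s = a' t"
  shows "relabel_canonical I a = relabel_canonical I a'"
  unfolding relabel_canonical_def
  by (intro restrict_ext arg_cong[of _ _ Least] ext) (use assms in auto)

text \<open>A label function with pattern \<open>c\<close> is determined by its values on the class
  representatives, which form the image of \<open>c\<close>, and there it can be any
  injection.\<close>

lemma card_relabellings:
  assumes "finite I" and c: "c \<in> canonical_labels I"
  shows "card {a \<in> I \<rightarrow>\<^sub>E {..<N}. relabel_canonical I a = c} = (\<Prod>i<card (c ` I). N - i)"
proof -
  have cI: "c t \<in> I" "c (c t) = c t" if "t \<in> I" for t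
    using c relabel_canonical(1,2)[OF that, of c] that by (auto simp: canonical_labels_def)
  have "bij_betw (\<lambda>a. restrict a (c ` I)) {a \<in> I \<rightarrow>\<^sub>E {..<N}. relabel_canonical I a = c}
      {\<phi> \<in> c ` I \<rightarrow>\<^sub>E {..<N}. inj_on \<phi> (c ` I)}"
  proof (rule bij_betw_byWitness[where f' = "\<lambda>\<phi>. \<lambda>t\<in>I. \<phi> (c t)"])
    show "\<forall>a\<in>{a \<in> I \<rightarrow>\<^sub>E {..<N}. relabel_canonical I a = c}.
        (\<lambda>t\<in>I. restrict a (c ` I) (c t)) = a"
    proof safe
      fix a :: "nat \<Rightarrow> nat" assume a: "a \<in> I \<rightarrow>\<^sub>E {..<N}" "c = relabel_canonical I a"
      show "(\<lambda>t\<in>I. restrict a (relabel_canonical I a ` I) (relabel_canonical I a t)) = a"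
        using a by (intro extensionalityI[of _ I]) (auto simp: relabel_canonical PiE_iff)
    qed
    show "\<forall>\<phi>\<in>{\<phi> \<in> c ` I \<rightarrow>\<^sub>E {..<N}. inj_on \<phi> (c ` I)}.
        restrict (\<lambda>t\<in>I. \<phi> (c t)) (c ` I) = \<phi>"
    proof safe
      fix \<phi> assume "\<phi> \<in> c ` I \<rightarrow>\<^sub>E {..<N}"
      then show "restrict (\<lambda>t\<in>I. \<phi> (c t)) (c ` I) = \<phi>"
        by (intro extensionalityI[of _ "c ` I"]) (auto simp: cI PiE_iff)
    qed
    show "(\<lambda>a. restrict a (c ` I)) ` {a \<in> I \<rightarrow>\<^sub>E {..<N}. relabel_canonical I a = c}
        \<subseteq> {\<phi> \<in> c ` I \<rightarrow>\<^sub>E {..<N}. inj_on \<phi> (c ` I)}"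
    proof (rule image_subsetI)
      fix a :: "nat \<Rightarrow> nat" assume "a \<in> {a \<in> I \<rightarrow>\<^sub>E {..<N}. relabel_canonical I a = c}"
      then have a: "a \<in> I \<rightarrow>\<^sub>E {..<N}" "c = relabel_canonical I a" by auto
      have "restrict a (c ` I) \<in> c ` I \<rightarrow>\<^sub>E {..<N}"
        using a by (auto simp: relabel_canonical PiE_iff)
      moreover have "inj_on (restrict a (c ` I)) (c ` I)"
        by (auto simp: inj_on_def relabel_canonical a(2))
      ultimately show "restrict a (c ` I) \<in> {\<phi> \<in> c ` I \<rightarrow>\<^sub>E {..<N}. inj_on \<phi> (c ` I)}"
        by simp
    qed
    show "(\<lambda>\<phi>. \<lambda>t\<in>I. \<phi> (c t)) ` {\<phi> \<in> c ` I \<rightarrow>\<^sub>E {..<N}. inj_on \<phi> (c ` I)}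
        \<subseteq> {a \<in> I \<rightarrow>\<^sub>E {..<N}. relabel_canonical I a = c}"
    proof (rule image_subsetI)
      fix \<phi> assume \<phi>: "\<phi> \<in> {\<phi> \<in> c ` I \<rightarrow>\<^sub>E {..<N}. inj_on \<phi> (c ` I)}"
      have "relabel_canonical I (\<lambda>t\<in>I. \<phi> (c t)) = relabel_canonical I c"
        by (rule relabel_canonical_cong) (use \<phi> in \<open>auto simp: inj_on_def\<close>)
      also have "\<dots> = c" using c by (simp add: canonical_labels_def)
      finally show "(\<lambda>t\<in>I. \<phi> (c t)) \<in> {a \<in> I \<rightarrow>\<^sub>E {..<N}. relabel_canonical I a = c}"
        using \<phi> by auto
    qed
  qed
  then show ?thesis
    using card_inj_PiE[of "c ` I" "{..<N}"] assms(1) by (simp add: bij_betw_same_card)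
qed

text \<open>The dependence on \<open>N\<close> is isolated in a falling factorial. The outer sum
  runs over partitions and does not involve \<open>N\<close>, so sums for two label ranges can be
  compared term by term.\<close>

lemma sum_relabel:
  fixes G :: "(nat \<Rightarrow> nat) \<Rightarrow> real"
  assumes I: "finite I"
    and G: "\<And>a a'. (\<And>s t. s \<in> I \<Longrightarrow> t \<in> I \<Longrightarrow> a s = a t \<longleftrightarrow> a' s = a' t) \<Longrightarrow> G a = G a'"
  shows "(\<Sum>a\<in>I \<rightarrow>\<^sub>E {..<N}. G a * h (card (a ` I))) =
     (\<Sum>c\<in>canonical_labels I. G c * h (card (c ` I)) * real (\<Prod>i<card (c ` I). N - i))"
proof -
  have fin: "finite (canonical_labels I)" "finite (I \<rightarrow>\<^sub>E {..<N})"
    using I by (auto simp: canonical_labels_def intro!: finite_PiE)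
  have sub: "relabel_canonical I ` (I \<rightarrow>\<^sub>E {..<N}) \<subseteq> canonical_labels I"
  proof (rule image_subsetI)
    fix a :: "nat \<Rightarrow> nat"
    have "relabel_canonical I (relabel_canonical I a) = relabel_canonical I a"
      by (rule relabel_canonical_cong) (simp add: relabel_canonical)
    moreover have "relabel_canonical I a \<in> I \<rightarrow>\<^sub>E I"
      by (auto simp: relabel_canonical) (simp add: relabel_canonical_def)
    ultimately show "relabel_canonical I a \<in> canonical_labels I" by (simp add: canonical_labels_def)
  qed
  have "(\<Sum>a\<in>I \<rightarrow>\<^sub>E {..<N}. G a * h (card (a ` I))) =
     (\<Sum>c\<in>canonical_labels I. \<Sum>a | a \<in> I \<rightarrow>\<^sub>E {..<N} \<and> relabel_canonical I a = c. G a * h (card (a ` I)))"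
    by (rule sum.group[OF fin(2,1) sub, symmetric])
  also have "\<dots> = (\<Sum>c\<in>canonical_labels I. \<Sum>a | a \<in> I \<rightarrow>\<^sub>E {..<N} \<and> relabel_canonical I a = c. G c * h (card (c ` I)))"
  proof (intro sum.cong refl, safe)
    fix a :: "nat \<Rightarrow> nat"
    let ?c = "relabel_canonical I a"
    have "G a = G ?c" by (rule G) (simp add: relabel_canonical)
    moreover have "a ` I = a ` (?c ` I)" by (auto simp: image_image relabel_canonical)
    then have "card (a ` I) = card (?c ` I)"
      using card_image[of a "?c ` I"] by (simp add: inj_on_def relabel_canonical)
    ultimately show "G a * h (card (a ` I)) = G ?c * h (card (?c ` I))" by simp
  qed
  also have "\<dots> = (\<Sum>c\<in>canonical_labels I. G c * h (card (c ` I)) * real (\<Prod>i<card (c ` I). N - i))"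
    by (intro sum.cong refl) (simp add: card_relabellings[OF I])
  finally show ?thesis .
qed

text \<open>Apart from the first label, each factor on the left together with its \<open>q\<close>
  is at most \<open>q N\<close>, and each factor on the right is at least
  \<open>r - K \<ge> q N\<close>. The first label has no \<open>q\<close>, which leaves the ratio of
  \<open>N\<close> to \<open>r\<close>.\<close>

lemma falling_factorial_compare:
  assumes q: "q \<ge> 0" and r: "real K + q * real N \<le> real r" and v: "v \<ge> 1" "v \<le> K + 1"
  shows "real r * (q ^ (v - 1) * real (\<Prod>i<v. N - i)) \<le> real N * real (\<Prod>i<v. r - i)"
proof -
  obtain w where w: "v = Suc w" "w \<le> K" using v by (cases v) auto
  have "(\<Prod>i<w. real (N - Suc i)) \<le> (\<Prod>i<w. real N)" by (rule prod_mono) auto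
  then have P: "real (\<Prod>i<v. N - i) \<le> real N * real N ^ w"
    unfolding w prod.lessThan_Suc_shift by (simp add: mult_left_mono)
  have "v - 1 = w" using w by simp
  then have "real r * (q ^ (v - 1) * real (\<Prod>i<v. N - i)) \<le> real r * (q ^ w * (real N * real N ^ w))"
    using P q by (simp only: mult_left_mono zero_le_power of_nat_0_le_iff)
  also have "\<dots> = real N * (real r * (q * real N) ^ w)" by (simp add: power_mult_distrib mult_ac)
  also have "\<dots> \<le> real N * (real r * (\<Prod>i<w. real (r - Suc i)))"
  proof (intro mult_left_mono)
    have "(\<Prod>i<w. q * real N) \<le> (\<Prod>i<w. real (r - Suc i))"
    proof (rule prod_mono)
      fix i assume "i \<in> {..<w}"
      then have "real (Suc i) \<le> real K" using w by simp
      then have "q * real N + real (Suc i) \<le> real r" using r by linarith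
      moreover have "0 \<le> q * real N" using q by simp
      ultimately show "0 \<le> q * real N \<and> q * real N \<le> real (r - Suc i)"
        by (subst of_nat_diff) auto
    qed
    then show "(q * real N) ^ w \<le> (\<Prod>i<w. real (r - Suc i))" by simp
  qed auto
  also have "\<dots> = real N * real (\<Prod>i<v. r - i)"
    unfolding w prod.lessThan_Suc_shift by simp
  finally show ?thesis .
qed

lemma sum_labels_compare:
  fixes G :: "(nat \<Rightarrow> nat) \<Rightarrow> real"
  assumes I: "finite I" "I \<noteq> {}" "card I \<le> K + 1"
    and G: "\<And>a a'. (\<And>s t. s \<in> I \<Longrightarrow> t \<in> I \<Longrightarrow> a s = a t \<longleftrightarrow> a' s = a' t) \<Longrightarrow> G a = G a'"
    and G0: "\<And>a. G a \<ge> 0" and q: "q \<ge> 0" and r: "real K + q * real N \<le> real r"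
  shows "real r * (\<Sum>a\<in>I \<rightarrow>\<^sub>E {..<N}. G a * q ^ (card (a ` I) - 1)) \<le>
     real N * (\<Sum>a\<in>I \<rightarrow>\<^sub>E {..<r}. G a)"
proof -
  have "real r * (\<Sum>a\<in>I \<rightarrow>\<^sub>E {..<N}. G a * q ^ (card (a ` I) - 1)) =
      (\<Sum>c\<in>canonical_labels I. G c * (real r * (q ^ (card (c ` I) - 1) * real (\<Prod>i<card (c ` I). N - i))))"
    using sum_relabel[OF I(1) G, where N = N and h = "\<lambda>v. q ^ (v - 1)"]
    by (simp add: sum_distrib_left mult_ac)
  also have "\<dots> \<le> (\<Sum>c\<in>canonical_labels I. G c * (real N * real (\<Prod>i<card (c ` I). r - i)))"
  proof (rule sum_mono, rule mult_left_mono[OF _ G0], rule falling_factorial_compare[OF q r])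
    fix c
    show "card (c ` I) \<ge> 1" using I by (simp add: Suc_le_eq card_gt_0_iff)
    show "card (c ` I) \<le> K + 1" using card_image_le[OF I(1), of c] I(3) by simp
  qed
  also have "\<dots> = real N * (\<Sum>a\<in>I \<rightarrow>\<^sub>E {..<r}. G a)"
    using sum_relabel[OF I(1) G, where N = r and h = "\<lambda>v. 1"]
    by (simp add: sum_distrib_left mult_ac)
  finally show ?thesis .
qed

text \<open>The additional power of \<open>q\<close> pays for the ratio of \<open>N\<close> to
  \<open>r\<close>, since \<open>q N \<le> r\<close>.\<close>

lemma sum_labels_compare':
  fixes G :: "(nat \<Rightarrow> nat) \<Rightarrow> real"
  assumes I: "finite I" "card I \<le> K + 1"
    and G: "\<And>a a'. (\<And>s t. s \<in> I \<Longrightarrow> t \<in> I \<Longrightarrow> a s = a t \<longleftrightarrow> a' s = a' t) \<Longrightarrow> G a = G a'"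
    and G0: "\<And>a. G a \<ge> 0" and q: "q \<ge> 0" and r: "real K + q * real N \<le> real r" "r > 0"
  shows "(\<Sum>a\<in>I \<rightarrow>\<^sub>E {..<N}. G a * q ^ card (a ` I)) \<le> (\<Sum>a\<in>I \<rightarrow>\<^sub>E {..<r}. G a)"
proof (cases "I = {}")
  case False
  have "real r * (\<Sum>a\<in>I \<rightarrow>\<^sub>E {..<N}. G a * q ^ card (a ` I)) =
     q * (real r * (\<Sum>a\<in>I \<rightarrow>\<^sub>E {..<N}. G a * q ^ (card (a ` I) - 1)))"
  proof -
    have "q ^ card (a ` I) = q * q ^ (card (a ` I) - 1)" for a :: "nat \<Rightarrow> nat"
      using I False by (simp add: card_gt_0_iff flip: power_Suc)
    then show ?thesis by (simp add: sum_distrib_left mult_ac)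
  qed
  also have "\<dots> \<le> q * (real N * (\<Sum>a\<in>I \<rightarrow>\<^sub>E {..<r}. G a))"
    by (intro mult_left_mono q sum_labels_compare[OF I(1) False I(2) G G0 q r(1)])
  also have "\<dots> = (q * real N) * (\<Sum>a\<in>I \<rightarrow>\<^sub>E {..<r}. G a)" by simp
  also have "\<dots> \<le> real r * (\<Sum>a\<in>I \<rightarrow>\<^sub>E {..<r}. G a)"
    using r by (intro mult_right_mono sum_nonneg G0) linarith
  finally show ?thesis using r(2) by simp
qed simp

section \<open>Even closed walks\<close>

text \<open>
  The walk \<open>a 0, b 0, a 1, b 1, \<dots>, b (k - 1), a k\<close> lives on the complete bipartite graph with column
  vertices \<open>a t\<close> and row vertices \<open>b t\<close>.
\<close>

definition walk_mult :: "nat \<Rightarrow> (nat \<Rightarrow> nat) \<Rightarrow> (nat \<Rightarrow> nat) \<Rightarrow> nat \<times> nat \<Rightarrow> nat" where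
  "walk_mult k a b e = card {t. t < k \<and> (b t, a t) = e} + card {t. t < k \<and> (b t, a (Suc t)) = e}"

definition walk_edges :: "nat \<Rightarrow> (nat \<Rightarrow> nat) \<Rightarrow> (nat \<Rightarrow> nat) \<Rightarrow> (nat \<times> nat) set" where
  "walk_edges k a b = (\<lambda>t. (b t, a t)) ` {..<k} \<union> (\<lambda>t. (b t, a (Suc t))) ` {..<k}"

definition walk_even :: "nat \<Rightarrow> (nat \<Rightarrow> nat) \<Rightarrow> (nat \<Rightarrow> nat) \<Rightarrow> bool" where
  "walk_even k a b \<longleftrightarrow> (\<forall>e. even (walk_mult k a b e))"

text \<open>For a closed walk, the mean of the product of matrix entries along it when the entries
  are independent sparse signs of rate \<open>q\<close>.\<close>

definition walk_weight :: "real \<Rightarrow> nat \<Rightarrow> (nat \<Rightarrow> nat) \<Rightarrow> (nat \<Rightarrow> nat) \<Rightarrow> real" where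
  "walk_weight q k a b = of_bool (a k = a 0 \<and> walk_even k a b) * q ^ card (walk_edges k a b)"

definition walk_total :: "real \<Rightarrow> nat \<Rightarrow> nat \<Rightarrow> nat \<Rightarrow> real" where
  "walk_total q d1 d2 k =
     (\<Sum>a\<in>{..k} \<rightarrow>\<^sub>E {..<d2}. \<Sum>b\<in>{..<k} \<rightarrow>\<^sub>E {..<d1}. walk_weight q k a b)"

lemma walk_mult_pos_iff: "walk_mult k a b e > 0 \<longleftrightarrow> e \<in> walk_edges k a b"
  by (auto simp: walk_mult_def walk_edges_def card_gt_0_iff)

text \<open>Every vertex but the first is reached by a new edge.\<close>

lemma card_walk_vertices:
  "card (a ` {..k}) + card (b ` {..<k}) \<le> card (walk_edges k a b) + 1"
proof (induction k)
  case (Suc k)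
  have A: "a ` {..Suc k} = insert (a (Suc k)) (a ` {..k})" by (simp add: atMost_Suc)
  have B: "b ` {..<Suc k} = insert (b k) (b ` {..<k})" by (simp add: lessThan_Suc)
  have E: "walk_edges (Suc k) a b = insert (b k, a k) (insert (b k, a (Suc k)) (walk_edges k a b))"
    by (auto simp: walk_edges_def lessThan_Suc)
  have fin: "finite (walk_edges k a b)" by (simp add: walk_edges_def)
  have 1: "(b k, x) \<notin> walk_edges k a b" if "b k \<notin> b ` {..<k}" for x
    using that by (auto simp: walk_edges_def)
  have 2: "(x, a (Suc k)) \<notin> walk_edges k a b" if "a (Suc k) \<notin> a ` {..k}" for x
    using that by (fastforce simp: walk_edges_def)
  have 3: "a k \<noteq> a (Suc k)" if "a (Suc k) \<notin> a ` {..k}"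
    using that by (metis atMost_iff image_eqI order_refl)
  show ?case
    unfolding A B E using Suc.IH 1 2 3 fin
    by (cases "b k \<in> b ` {..<k}"; cases "a (Suc k) \<in> a ` {..k}") (auto simp: card_insert_if)
qed (simp add: walk_edges_def)

text \<open>Edges off the walk have multiplicity 0. Tested at the positions of the walk, evenness is
  expressed through coincidences among the \<open>a\<close> and among the \<open>b\<close>, and
  these survive a change of labels.\<close>

lemma walk_even_iff:
  "walk_even k a b \<longleftrightarrow>
     (\<forall>s<k. even (walk_mult k a b (b s, a s)) \<and> even (walk_mult k a b (b s, a (Suc s))))"
proof
  assume *: "\<forall>s<k. even (walk_mult k a b (b s, a s)) \<and> even (walk_mult k a b (b s, a (Suc s)))"
  show "walk_even k a b"
    unfolding walk_even_def
  proof
    fix e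
    show "even (walk_mult k a b e)"
    proof (cases "e \<in> walk_edges k a b")
      case True
      then show ?thesis using * by (auto simp: walk_edges_def)
    next
      case False
      then show ?thesis using walk_mult_pos_iff[of k a b e] by simp
    qed
  qed
qed (simp add: walk_even_def)

lemma walk_mult_cong:
  assumes "\<And>s t. s \<le> k \<Longrightarrow> t \<le> k \<Longrightarrow> a s = a t \<longleftrightarrow> a' s = a' t"
    and "\<And>s t. s < k \<Longrightarrow> t < k \<Longrightarrow> b s = b t \<longleftrightarrow> b' s = b' t"
    and "s < k" "u \<le> k"
  shows "walk_mult k a b (b s, a u) = walk_mult k a' b' (b' s, a' u)"
proof -
  have "{t. t < k \<and> (b t, a t) = (b s, a u)} = {t. t < k \<and> (b' t, a' t) = (b' s, a' u)}"
    using assms by auto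
  moreover have "{t. t < k \<and> (b t, a (Suc t)) = (b s, a u)} = {t. t < k \<and> (b' t, a' (Suc t)) = (b' s, a' u)}"
    using assms by auto
  ultimately show ?thesis unfolding walk_mult_def by simp
qed

lemma walk_weight_one_cong:
  assumes "\<And>s t. s \<le> k \<Longrightarrow> t \<le> k \<Longrightarrow> a s = a t \<longleftrightarrow> a' s = a' t"
    and "\<And>s t. s < k \<Longrightarrow> t < k \<Longrightarrow> b s = b t \<longleftrightarrow> b' s = b' t"
  shows "walk_weight 1 k a b = walk_weight 1 k a' b'"
proof -
  have "walk_even k a b = walk_even k a' b'"
  proof -
    have "walk_mult k a b (b s, a u) = walk_mult k a' b' (b' s, a' u)" if "s < k" "u \<le> k" for s u
      using assms that by (rule walk_mult_cong)
    then show ?thesis unfolding walk_even_iff by auto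
  qed
  then show ?thesis using assms(1)[of k 0] by (simp add: walk_weight_def)
qed

text \<open>Since \<open>q \<le> 1\<close>, the number of edges in the exponent may be replaced by
  its lower bound from the vertex count. The bound splits into a power for the rows and one for the
  columns; the missing unit is charged to the columns.\<close>

lemma walk_weight_le:
  assumes q: "0 \<le> q" "q \<le> 1"
  shows "walk_weight q k a b \<le> walk_weight 1 k a b * q ^ card (b ` {..<k}) * q ^ (card (a ` {..k}) - 1)"
proof -
  have "card (a ` {..k}) > 0" by (simp add: card_gt_0_iff)
  then have "card (b ` {..<k}) + (card (a ` {..k}) - 1) \<le> card (walk_edges k a b)"
    using card_walk_vertices[of a k b] by linarith
  then have "q ^ card (walk_edges k a b) \<le> q ^ (card (b ` {..<k}) + (card (a ` {..k}) - 1))"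
    using q by (intro power_decreasing) auto
  then show ?thesis by (simp add: walk_weight_def power_add)
qed

text \<open>Row labels are exchanged first, at no cost because each carries a factor
  \<open>q\<close>. The column labels carry one factor fewer, which costs
  \<open>d2 / r\<close>.\<close>

lemma walk_total_compare:
  assumes q: "0 \<le> q" "q \<le> 1" and r: "r > 0" "real k + q * real d1 \<le> real r" "real k + q * real d2 \<le> real r"
  shows "real r * walk_total q d1 d2 k \<le> real d2 * walk_total 1 r r k"
proof -
  have W0: "walk_weight 1 k a b \<ge> 0" for a b by (simp add: walk_weight_def)
  have "walk_total q d1 d2 k \<le>
     (\<Sum>a\<in>{..k} \<rightarrow>\<^sub>E {..<d2}. \<Sum>b\<in>{..<k} \<rightarrow>\<^sub>E {..<d1}.
        walk_weight 1 k a b * q ^ card (b ` {..<k}) * q ^ (card (a ` {..k}) - 1))"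
    unfolding walk_total_def by (intro sum_mono walk_weight_le q)
  also have "\<dots> = (\<Sum>a\<in>{..k} \<rightarrow>\<^sub>E {..<d2}. (\<Sum>b\<in>{..<k} \<rightarrow>\<^sub>E {..<d1}.
        walk_weight 1 k a b * q ^ card (b ` {..<k})) * q ^ (card (a ` {..k}) - 1))"
    by (simp add: sum_distrib_right)
  also have "\<dots> \<le> (\<Sum>a\<in>{..k} \<rightarrow>\<^sub>E {..<d2}. (\<Sum>b\<in>{..<k} \<rightarrow>\<^sub>E {..<r}. walk_weight 1 k a b) * q ^ (card (a ` {..k}) - 1))"
    using q r by (intro sum_mono mult_right_mono sum_labels_compare'[where K = k])
      (auto intro: walk_weight_one_cong W0)
  finally have "real r * walk_total q d1 d2 k \<le>
     real r * (\<Sum>a\<in>{..k} \<rightarrow>\<^sub>E {..<d2}. (\<Sum>b\<in>{..<k} \<rightarrow>\<^sub>E {..<r}. walk_weight 1 k a b) * q ^ (card (a ` {..k}) - 1))"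
    by (intro mult_left_mono) auto
  also have "\<dots> \<le> real d2 * (\<Sum>a\<in>{..k} \<rightarrow>\<^sub>E {..<r}. \<Sum>b\<in>{..<k} \<rightarrow>\<^sub>E {..<r}. walk_weight 1 k a b)"
    using q r by (intro sum_labels_compare[where K = k])
      (auto intro!: sum.cong sum_nonneg walk_weight_one_cong W0)
  finally show ?thesis by (simp add: walk_total_def)
qed

section \<open>Sparse random sign matrices\<close>

lemma finite_set_Pi_pmf:
  assumes "finite A" "\<And>x. x \<in> A \<Longrightarrow> finite (set_pmf (p x))"
  shows "finite (set_pmf (Pi_pmf A d p))"
  using assms by (subst set_Pi_pmf) auto

lemma expectation_Pi_pmf_insert:
  fixes g :: "_ \<Rightarrow> real"
  assumes "finite A" "x \<notin> A" "\<And>y. y \<in> insert x A \<Longrightarrow> finite (set_pmf (p y))"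
  shows "measure_pmf.expectation (Pi_pmf (insert x A) d p) g =
    measure_pmf.expectation (p x) (\<lambda>y. measure_pmf.expectation (Pi_pmf A d p) (\<lambda>f. g (f(x := y))))"
proof -
  have fin: "finite (set_pmf (p x))" "finite (set_pmf (Pi_pmf A d p))"
    using assms by (auto intro: finite_set_Pi_pmf)
  have "measure_pmf.expectation (Pi_pmf (insert x A) d p) g =
     measure_pmf.expectation (p x \<bind> (\<lambda>y. map_pmf (\<lambda>f. f(x := y)) (Pi_pmf A d p))) g"
    using assms by (simp add: Pi_pmf_insert' map_pmf_def)
  also have "\<dots> = (\<Sum>y\<in>set_pmf (p x). pmf (p x) y *\<^sub>R
       measure_pmf.expectation (map_pmf (\<lambda>f. f(x := y)) (Pi_pmf A d p)) g)"
    using fin by (intro pmf_expectation_bind) auto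
  also have "\<dots> = measure_pmf.expectation (p x) (\<lambda>y. measure_pmf.expectation (Pi_pmf A d p) (\<lambda>f. g (f(x := y))))"
    using fin by (subst integral_measure_pmf[of "set_pmf (p x)"]) auto
  finally show ?thesis .
qed

lemma expectation_prod_Pi_pmf_finite:
  fixes g :: "_ \<Rightarrow> _ \<Rightarrow> real"
  assumes "finite A" "\<And>x. x \<in> A \<Longrightarrow> finite (set_pmf (p x))"
  shows "measure_pmf.expectation (Pi_pmf A d p) (\<lambda>f. \<Prod>x\<in>A. g x (f x)) =
    (\<Prod>x\<in>A. measure_pmf.expectation (p x) (g x))"
  using assms
proof (induction A rule: finite_induct)
  case (insert x A)
  have "measure_pmf.expectation (Pi_pmf (insert x A) d p) (\<lambda>f. \<Prod>y\<in>insert x A. g y (f y)) =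
    measure_pmf.expectation (p x) (\<lambda>z. measure_pmf.expectation (Pi_pmf A d p) (\<lambda>f. g x z * (\<Prod>y\<in>A. g y (f y))))"
  proof (subst expectation_Pi_pmf_insert)
    have "(\<Prod>y\<in>insert x A. g y ((f(x := z)) y)) = g x z * (\<Prod>y\<in>A. g y (f y))" for f z
      using insert.hyps by (subst prod.insert) (auto intro!: arg_cong2[of _ _ _ _ "(*)"] prod.cong)
    then show "measure_pmf.expectation (p x) (\<lambda>z. measure_pmf.expectation (Pi_pmf A d p) (\<lambda>f. \<Prod>y\<in>insert x A. g y ((f(x := z)) y))) =
      measure_pmf.expectation (p x) (\<lambda>z. measure_pmf.expectation (Pi_pmf A d p) (\<lambda>f. g x z * (\<Prod>y\<in>A. g y (f y))))"
      by simp
  qed (use insert in auto)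
  also have "\<dots> = measure_pmf.expectation (p x) (g x) * (\<Prod>y\<in>A. measure_pmf.expectation (p y) (g y))"
    using insert by simp
  finally show ?case using insert.hyps by simp
qed simp

definition sparse_sign_pmf :: "real \<Rightarrow> real pmf" where
  "sparse_sign_pmf q = bind_pmf (bernoulli_pmf q)
     (\<lambda>b. if b then map_pmf (\<lambda>c. if c then 1 else -1) (bernoulli_pmf (1/2)) else return_pmf 0)"

lemma set_sparse_sign_pmf: "set_pmf (sparse_sign_pmf q) \<subseteq> {0, 1, -1}"
  by (auto simp: sparse_sign_pmf_def split: if_splits)

lemma finite_sparse_sign_pmf [simp]: "finite (set_pmf (sparse_sign_pmf q))"
  using set_sparse_sign_pmf by (rule finite_subset) simp

lemma expectation_sparse_sign_pmf:
  fixes g :: "real \<Rightarrow> real"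
  assumes "0 \<le> q" "q \<le> 1"
  shows "measure_pmf.expectation (sparse_sign_pmf q) g = (1 - q) * g 0 + q / 2 * (g 1 + g (-1))"
proof -
  have "measure_pmf.expectation (sparse_sign_pmf q) g = (\<Sum>b\<in>UNIV. pmf (bernoulli_pmf q) b *\<^sub>R
      measure_pmf.expectation (if b then map_pmf (\<lambda>c. if c then 1 else -1) (bernoulli_pmf (1/2)) else return_pmf 0) g)"
    unfolding sparse_sign_pmf_def by (intro pmf_expectation_bind) auto
  then show ?thesis using assms by (simp add: UNIV_bool algebra_simps)
qed

definition sparse_sign_matrix :: "real \<Rightarrow> nat \<Rightarrow> nat \<Rightarrow> (nat \<times> nat \<Rightarrow> real) pmf" where
  "sparse_sign_matrix q d1 d2 = Pi_pmf ({..<d1} \<times> {..<d2}) 0 (\<lambda>_. sparse_sign_pmf q)"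

lemma finite_sparse_sign_matrix [simp]: "finite (set_pmf (sparse_sign_matrix q d1 d2))"
  by (simp add: sparse_sign_matrix_def finite_set_Pi_pmf)

lemma prod_walk_mult:
  fixes x :: "nat \<times> nat \<Rightarrow> real"
  assumes "finite S" "walk_edges k a b \<subseteq> S"
  shows "(\<Prod>t<k. x (b t, a t) * x (b t, a (Suc t))) = (\<Prod>e\<in>S. x e ^ walk_mult k a b e)"
proof -
  have "(\<Prod>t<k. x (f t)) = (\<Prod>e\<in>S. x e ^ card {t. t < k \<and> f t = e})" if "f ` {..<k} \<subseteq> S" for f
  proof -
    have "(\<Prod>t<k. x (f t)) = (\<Prod>e\<in>S. \<Prod>t\<in>{t\<in>{..<k}. f t = e}. x (f t))"
      using assms(1) that by (intro prod.group[symmetric]) auto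
    also have "\<dots> = (\<Prod>e\<in>S. x e ^ card {t. t < k \<and> f t = e})"
      by (intro prod.cong refl) simp
    finally show ?thesis .
  qed
  from this[of "\<lambda>t. (b t, a t)"] this[of "\<lambda>t. (b t, a (Suc t))"] assms(2)
  show ?thesis by (simp add: walk_edges_def walk_mult_def prod.distrib power_add)
qed

text \<open>Independence factors each expectation over the distinct edges. By symmetry an odd power
  of an entry has mean 0; a positive even power is the indicator that the entry is nonzero and has
  mean \<open>q\<close>.\<close>

lemma expectation_gram_trace:
  assumes q: "0 \<le> q" "q \<le> 1"
  shows "measure_pmf.expectation (sparse_sign_matrix q d1 d2) (\<lambda>x. gram_trace d1 d2 (\<lambda>i j. x (i, j)) k)
    = walk_total q d1 d2 k"
proof -
  let ?E = "measure_pmf.expectation (sparse_sign_matrix q d1 d2)"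
  let ?S = "{..<d1} \<times> {..<d2}"
  have int: "integrable (measure_pmf (sparse_sign_matrix q d1 d2)) f" for f :: "_ \<Rightarrow> real"
    by (intro integrable_measure_pmf_finite) simp
  have "?E (\<lambda>x. gram_trace d1 d2 (\<lambda>i j. x (i, j)) k) =
    (\<Sum>a\<in>{..k} \<rightarrow>\<^sub>E {..<d2}. \<Sum>b\<in>{..<k} \<rightarrow>\<^sub>E {..<d1}. of_bool (a k = a 0) *
       ?E (\<lambda>x. \<Prod>t<k. x (b t, a t) * x (b t, a (Suc t))))"
    unfolding gram_trace_def by (simp add: Bochner_Integration.integral_sum int)
  also have "\<dots> = walk_total q d1 d2 k"
    unfolding walk_total_def
  proof (intro sum.cong refl)
    fix a b :: "nat \<Rightarrow> nat" assume ab: "a \<in> {..k} \<rightarrow>\<^sub>E {..<d2}" "b \<in> {..<k} \<rightarrow>\<^sub>E {..<d1}"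
    have sub: "walk_edges k a b \<subseteq> ?S"
      using PiE_mem[OF ab(1)] PiE_mem[OF ab(2)] by (auto simp: walk_edges_def)
    let ?m = "walk_mult k a b"
    have "?E (\<lambda>x. \<Prod>t<k. x (b t, a t) * x (b t, a (Suc t))) = ?E (\<lambda>x. \<Prod>e\<in>?S. x e ^ ?m e)"
      by (simp add: prod_walk_mult[OF _ sub])
    also have "\<dots> = (\<Prod>e\<in>?S. measure_pmf.expectation (sparse_sign_pmf q) (\<lambda>z. z ^ ?m e))"
      unfolding sparse_sign_matrix_def by (rule expectation_prod_Pi_pmf_finite) auto
    also have "\<dots> = (\<Prod>e\<in>?S. if e \<in> walk_edges k a b then of_bool (even (?m e)) * q else 1)"
    proof (rule prod.cong[OF refl])
      fix e
      show "measure_pmf.expectation (sparse_sign_pmf q) (\<lambda>z. z ^ ?m e) =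
         (if e \<in> walk_edges k a b then of_bool (even (?m e)) * q else 1)"
      proof (cases "e \<in> walk_edges k a b")
        case True
        then have "?m e > 0" by (simp add: walk_mult_pos_iff)
        then show ?thesis using True q
          by (simp add: expectation_sparse_sign_pmf minus_one_power_iff)
      next
        case False
        then have "?m e = 0" using walk_mult_pos_iff[of k a b e] by simp
        then show ?thesis using False q by (simp add: expectation_sparse_sign_pmf)
      qed
    qed
    also have "\<dots> = (\<Prod>e\<in>walk_edges k a b. of_bool (even (?m e)) * q)"
      using sub by (simp add: prod.If_cases Int_absorb1)
    also have "\<dots> = of_bool (walk_even k a b) * q ^ card (walk_edges k a b)"
    proof (cases "walk_even k a b")
      case True
      then have "even (?m e)" for e unfolding walk_even_def by blast
      then show ?thesis using True by simp
    next
      case False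
      then obtain e where e: "odd (?m e)" by (auto simp: walk_even_def)
      then have "e \<in> walk_edges k a b" using walk_mult_pos_iff[of k a b e] by (metis even_zero gr0I)
      moreover have "finite (walk_edges k a b)" by (simp add: walk_edges_def)
      ultimately have "(\<Prod>e\<in>walk_edges k a b. of_bool (even (?m e)) * q) = 0"
        using e by (intro prod_zero) auto
      then show ?thesis using False by simp
    qed
    finally show "of_bool (a k = a 0) * ?E (\<lambda>x. \<Prod>t<k. x (b t, a t) * x (b t, a (Suc t))) = walk_weight q k a b"
      by (simp add: walk_weight_def)
  qed
  finally show ?thesis .
qed

section \<open>Moments of dense sign matrices\<close>

lemma cosh_even_sums: "(\<lambda>n. x ^ (2 * n) / fact (2 * n)) sums cosh (x :: real)"
proof -
  have "(\<lambda>n. if even (2 * n) then x ^ (2 * n) /\<^sub>R fact (2 * n) else 0) sums cosh x"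
    by (subst sums_mono_reindex[where f = "\<lambda>n. if even n then x ^ n /\<^sub>R fact n else 0"])
      (auto simp: strict_mono_def cosh_converges elim!: evenE)
  then show ?thesis by (simp add: field_simps)
qed

lemma even_power_le_cosh: "x ^ (2 * m) \<le> fact (2 * m) * cosh (x :: real)"
proof -
  have "(\<Sum>n\<in>{m}. x ^ (2 * n) / fact (2 * n)) \<le> (\<Sum>n. x ^ (2 * n) / fact (2 * n))"
    using cosh_even_sums[of x] by (intro sum_le_suminf) (auto simp: sums_iff)
  then show ?thesis using sums_unique[OF cosh_even_sums[of x]] by (simp add: field_simps)
qed

text \<open>Termwise comparison of the two series, by \<open>2^n n! \<le> (2 n)!\<close>.\<close>

lemma cosh_le_exp_square: "cosh (x :: real) \<le> exp (x\<^sup>2 / 2)"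
proof (rule sums_le[OF _ cosh_even_sums[of x] exp_converges[of "x\<^sup>2 / 2"]])
  fix n :: nat
  have "(2 :: real) ^ n * fact n \<le> fact (2 * n)"
  proof (induction n)
    case (Suc n)
    have "(2 :: real) ^ Suc n * fact (Suc n) = (2 * real n + 2) * (2 ^ n * fact n)"
      by (simp add: algebra_simps)
    also have "\<dots> \<le> (2 * real n + 2) * ((2 * real n + 1) * fact (2 * n))"
    proof (rule mult_left_mono)
      have "2 ^ n * fact n \<le> 1 * (fact (2 * n) :: real)" using Suc by simp
      also have "\<dots> \<le> (2 * real n + 1) * fact (2 * n)" by (intro mult_right_mono) auto
      finally show "2 ^ n * fact n \<le> (2 * real n + 1) * (fact (2 * n) :: real)" .
    qed simp
    also have "\<dots> = fact (2 * Suc n)" by (simp add: algebra_simps)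
    finally show ?case .
  qed simp
  then have "x ^ (2 * n) / fact (2 * n) \<le> x ^ (2 * n) / (2 ^ n * fact n)"
    by (intro divide_left_mono) auto
  also have "x ^ (2 * n) / (2 ^ n * fact n) = (x\<^sup>2 / 2) ^ n /\<^sub>R fact n"
    unfolding power_divide power_mult[symmetric] by (simp add: divide_inverse)
  finally show "x ^ (2 * n) / fact (2 * n) \<le> (x\<^sup>2 / 2) ^ n /\<^sub>R fact n" .
qed

lemma sign_matrix_exp_moment:
  "measure_pmf.expectation (sparse_sign_matrix 1 d1 d2)
     (\<lambda>x. exp (\<Sum>e\<in>{..<d1} \<times> {..<d2}. c e * x e)) \<le> exp ((\<Sum>e\<in>{..<d1} \<times> {..<d2}. (c e)\<^sup>2) / 2)"
proof -
  have "measure_pmf.expectation (sparse_sign_matrix 1 d1 d2)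
     (\<lambda>x. exp (\<Sum>e\<in>{..<d1} \<times> {..<d2}. c e * x e)) =
     (\<Prod>e\<in>{..<d1} \<times> {..<d2}. measure_pmf.expectation (sparse_sign_pmf 1) (\<lambda>z. exp (c e * z)))"
    unfolding sparse_sign_matrix_def
    by (subst expectation_prod_Pi_pmf_finite[symmetric]) (auto simp: exp_sum)
  also have "\<dots> = (\<Prod>e\<in>{..<d1} \<times> {..<d2}. cosh (c e))"
    by (simp add: expectation_sparse_sign_pmf cosh_def)
  also have "\<dots> \<le> (\<Prod>e\<in>{..<d1} \<times> {..<d2}. exp ((c e)\<^sup>2 / 2))"
    by (intro prod_mono conjI cosh_le_exp_square cosh_real_nonneg)
  also have "\<dots> = exp ((\<Sum>e\<in>{..<d1} \<times> {..<d2}. (c e)\<^sup>2) / 2)"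
    by (simp add: exp_sum sum_divide_distrib)
  finally show ?thesis .
qed

text \<open>Exponential moments control polynomial ones through cosh. The scale \<open>t\<close>
  stays free until the order of the moment and the size of the coefficients are known.\<close>

lemma sign_matrix_even_moment:
  assumes t: "t > 0" and B: "(\<Sum>e\<in>{..<d1} \<times> {..<d2}. (c e)\<^sup>2) \<le> B"
  shows "measure_pmf.expectation (sparse_sign_matrix 1 d1 d2)
     (\<lambda>x. (\<Sum>e\<in>{..<d1} \<times> {..<d2}. c e * x e) ^ (2 * m)) \<le> fact (2 * m) / t ^ (2 * m) * exp (t\<^sup>2 * B / 2)"
proof -
  let ?E = "measure_pmf.expectation (sparse_sign_matrix 1 d1 d2)"
  let ?S = "{..<d1} \<times> {..<d2}"
  have int: "integrable (measure_pmf (sparse_sign_matrix 1 d1 d2)) f" for f :: "_ \<Rightarrow> real"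
    by (intro integrable_measure_pmf_finite) simp
  have e: "?E (\<lambda>x. exp (\<Sum>e\<in>?S. (u * c e) * x e)) \<le> exp (t\<^sup>2 * B / 2)" if "u\<^sup>2 = t\<^sup>2" for u
  proof -
    have "(\<Sum>e\<in>?S. (u * c e)\<^sup>2) = t\<^sup>2 * (\<Sum>e\<in>?S. (c e)\<^sup>2)"
      by (simp add: power_mult_distrib that sum_distrib_left)
    also have "\<dots> \<le> t\<^sup>2 * B" using B by (intro mult_left_mono) auto
    finally show ?thesis
      using sign_matrix_exp_moment[of d1 d2 "\<lambda>e. u * c e"] by (auto intro: order_trans)
  qed
  have "?E (\<lambda>x. (\<Sum>e\<in>?S. c e * x e) ^ (2 * m)) \<le>
     ?E (\<lambda>x. fact (2 * m) / t ^ (2 * m) * ((exp (\<Sum>e\<in>?S. (t * c e) * x e) + exp (\<Sum>e\<in>?S. (-t * c e) * x e)) / 2))"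
  proof (intro integral_mono int)
    fix x :: "nat \<times> nat \<Rightarrow> real"
    let ?y = "\<Sum>e\<in>?S. c e * x e"
    have "(t * ?y) ^ (2 * m) \<le> fact (2 * m) * cosh (t * ?y)" by (rule even_power_le_cosh)
    then have "?y ^ (2 * m) \<le> fact (2 * m) / t ^ (2 * m) * cosh (t * ?y)"
      using t by (simp add: power_mult_distrib field_simps)
    also have "cosh (t * ?y) = (exp (\<Sum>e\<in>?S. (t * c e) * x e) + exp (\<Sum>e\<in>?S. (-t * c e) * x e)) / 2"
      by (simp add: cosh_def sum_distrib_left sum_negf mult.assoc)
    finally show "?y ^ (2 * m) \<le> fact (2 * m) / t ^ (2 * m) *
      ((exp (\<Sum>e\<in>?S. (t * c e) * x e) + exp (\<Sum>e\<in>?S. (-t * c e) * x e)) / 2)" .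
  qed
  also have "\<dots> = fact (2 * m) / t ^ (2 * m) *
      ((?E (\<lambda>x. exp (\<Sum>e\<in>?S. (t * c e) * x e)) + ?E (\<lambda>x. exp (\<Sum>e\<in>?S. (-t * c e) * x e))) / 2)"
    by (simp add: Bochner_Integration.integral_add int)
  also have "\<dots> \<le> fact (2 * m) / t ^ (2 * m) * ((exp (t\<^sup>2 * B / 2) + exp (t\<^sup>2 * B / 2)) / 2)"
    using t by (intro mult_left_mono divide_right_mono add_mono e) auto
  finally show ?thesis by simp
qed

section \<open>An integer grid that norms Euclidean space\<close>

text \<open>Divided by \<open>sqrt r\<close>, these are the points of a grid of mesh
  \<open>1 / sqrt r\<close> in the Euclidean ball of radius 2. The box makes finiteness
  immediate.\<close>

definition int_ball :: "nat \<Rightarrow> (nat \<Rightarrow> int) set" where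
  "int_ball r = {z \<in> {..<r} \<rightarrow>\<^sub>E {- int (4 * r)..int (4 * r)}. (\<Sum>i<r. (z i)\<^sup>2) \<le> 4 * int r}"

lemma finite_int_ball [simp]: "finite (int_ball r)"
proof (rule finite_subset)
  show "int_ball r \<subseteq> {..<r} \<rightarrow>\<^sub>E {- int (4 * r)..int (4 * r)}"
    unfolding int_ball_def by (rule Collect_subset)
  show "finite ({..<r} \<rightarrow>\<^sub>E {- int (4 * r)..int (4 * r)})" by (rule finite_PiE) simp_all
qed

lemma sum_half_power_abs: "(\<Sum>z\<in>{- int b..int b}. (1 / 2 :: real) ^ nat \<bar>z\<bar>) \<le> 3 - 2 * (1 / 2) ^ b"
proof (induction b)
  case (Suc b)
  have "{- int (Suc b)..int (Suc b)} = insert (- int (Suc b)) (insert (int (Suc b)) {- int b..int b})"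
    by auto
  then show ?case using Suc by (simp add: nat_add_distrib)
qed simp

lemma abs_le_power2_int: "\<bar>z\<bar> \<le> z\<^sup>2" for z :: int
proof (cases "z = 0")
  case False
  then have "\<bar>z\<bar> ^ 1 \<le> \<bar>z\<bar> ^ 2" by (intro power_increasing) auto
  then show ?thesis by simp
qed simp

text \<open>Counting by weights: as \<open>|z| \<le> z^2\<close> for integers, every point has l1
  norm at most \<open>4 r\<close> and hence weight at least \<open>2^(-4 r)\<close>, while the
  product weight of the whole box is at most \<open>3^r\<close>. This gives
  \<open>48 = 3 * 16\<close>.\<close>

lemma card_int_ball: "real (card (int_ball r)) \<le> 48 ^ r"
proof -
  have "real (card (int_ball r)) * (1 / 2) ^ (4 * r) = (\<Sum>z\<in>int_ball r. (1 / 2) ^ (4 * r))"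
    by simp
  also have "\<dots> \<le> (\<Sum>z\<in>int_ball r. \<Prod>i<r. (1 / 2) ^ nat \<bar>z i\<bar>)"
  proof (rule sum_mono)
    fix z assume z: "z \<in> int_ball r"
    have "(\<Sum>i<r. \<bar>z i\<bar>) \<le> (\<Sum>i<r. (z i)\<^sup>2)"
      by (intro sum_mono abs_le_power2_int)
    also have "\<dots> \<le> 4 * int r" using z by (simp add: int_ball_def)
    finally have "(\<Sum>i<r. int (nat \<bar>z i\<bar>)) \<le> int (4 * r)" by simp
    then have "(\<Sum>i<r. nat \<bar>z i\<bar>) \<le> 4 * r" by (simp only: of_nat_sum[symmetric] of_nat_le_iff)
    then have "(1 / 2 :: real) ^ (4 * r) \<le> (1 / 2) ^ (\<Sum>i<r. nat \<bar>z i\<bar>)"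
      by (intro power_decreasing) auto
    then show "(1 / 2 :: real) ^ (4 * r) \<le> (\<Prod>i<r. (1 / 2) ^ nat \<bar>z i\<bar>)"
      by (simp add: power_sum)
  qed
  also have "\<dots> \<le> (\<Sum>z\<in>{..<r} \<rightarrow>\<^sub>E {- int (4 * r)..int (4 * r)}. \<Prod>i<r. (1 / 2) ^ nat \<bar>z i\<bar>)"
  proof (rule sum_mono2)
    show "finite ({..<r} \<rightarrow>\<^sub>E {- int (4 * r)..int (4 * r)})" by (rule finite_PiE) simp_all
    show "int_ball r \<subseteq> {..<r} \<rightarrow>\<^sub>E {- int (4 * r)..int (4 * r)}" unfolding int_ball_def by (rule Collect_subset)
  qed (simp add: prod_nonneg)
  also have "\<dots> = (\<Sum>z\<in>{- int (4 * r)..int (4 * r)}. (1 / 2) ^ nat \<bar>z\<bar>) ^ r"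
    by (subst prod_sum_PiE[symmetric]) auto
  also have "\<dots> \<le> 3 ^ r"
    using sum_half_power_abs[of "4 * r"]
    by (intro power_mono sum_nonneg) (auto intro: order_trans)
  finally have "real (card (int_ball r)) \<le> 3 ^ r * 2 ^ (4 * r)"
    by (simp add: field_simps power_divide)
  also have "\<dots> = 48 ^ r" by (simp add: power_mult flip: power_mult_distrib)
  finally show ?thesis .
qed

text \<open>
  Rounding \<open>2 sqrt r w / \<parallel>w\<parallel>\<close> towards zero gives an integer vector of norm at most
  \<open>2 sqrt r\<close> whose inner product with \<open>w\<close> is at least \<open>sqrt r \<parallel>w\<parallel>\<close>.
\<close>

lemma int_ball_norming:
  fixes w :: "nat \<Rightarrow> real"
  shows "(\<Sum>i<r. (w i)\<^sup>2) ^ m * real r ^ m \<le> (\<Sum>z\<in>int_ball r. (\<Sum>i<r. w i * of_int (z i)) ^ (2 * m))"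
proof (cases "(\<Sum>i<r. (w i)\<^sup>2) = 0")
  case True
  then have "w i = 0" if "i < r" for i using that by (simp add: sum_nonneg_eq_0_iff)
  then have eq: "(\<Sum>i<r. w i * of_int (z i)) = 0" for z :: "nat \<Rightarrow> int" by simp
  \<comment> \<open>For \<open>m = 0\<close> the left side is 1, so the ball has to be
    nonempty.\<close>
  have "(\<lambda>i\<in>{..<r}. 0) \<in> int_ball r" by (auto simp: int_ball_def)
  then have "card (int_ball r) > 0" by (auto simp: card_gt_0_iff)
  then show ?thesis unfolding True eq by (cases m) auto
next
  case False
  define s where "s = sqrt (\<Sum>i<r. (w i)\<^sup>2)"
  have "(\<Sum>i<r. (w i)\<^sup>2) > 0" using False by (simp add: order_less_le sum_nonneg)
  then have s: "s > 0" "s\<^sup>2 = (\<Sum>i<r. (w i)\<^sup>2)" by (auto simp: s_def)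
  define u where "u i = 2 * sqrt (real r) * w i / s" for i
  define z where "z = (\<lambda>i\<in>{..<r}. (if w i \<ge> 0 then 1 else -1) * \<lfloor>\<bar>u i\<bar>\<rfloor>)"
  have absz: "\<bar>z i\<bar> = \<lfloor>\<bar>u i\<bar>\<rfloor>" if "i < r" for i using that by (auto simp: z_def abs_mult)
  have "(\<Sum>i<r. (u i)\<^sup>2) = 4 * real r / s\<^sup>2 * (\<Sum>i<r. (w i)\<^sup>2)"
    by (simp add: u_def power_mult_distrib power_divide sum_distrib_left)
  also have "\<dots> = 4 * real r" unfolding s(2)[symmetric] using s(1) by simp
  finally have usum: "(\<Sum>i<r. (u i)\<^sup>2) = 4 * real r" .
  have zu: "(real_of_int (z i))\<^sup>2 \<le> (u i)\<^sup>2" if "i < r" for i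
  proof -
    have "\<bar>real_of_int (z i)\<bar> \<le> \<bar>u i\<bar>"
      using absz[OF that] by (metis of_int_abs of_int_floor_le)
    then show ?thesis by (simp add: abs_le_square_iff)
  qed
  have "real_of_int (\<Sum>i<r. (z i)\<^sup>2) \<le> (\<Sum>i<r. (u i)\<^sup>2)"
    using zu by (auto intro!: sum_mono)
  also have "\<dots> = of_int (4 * int r)" by (simp add: usum)
  finally have zsum: "(\<Sum>i<r. (z i)\<^sup>2) \<le> 4 * int r" by (simp only: of_int_le_iff)
  have "z i \<in> {- int (4 * r)..int (4 * r)}" if "i < r" for i
  proof -
    have "\<bar>z i\<bar> \<le> (z i)\<^sup>2" by (rule abs_le_power2_int)
    also have "\<dots> \<le> (\<Sum>i<r. (z i)\<^sup>2)" using that by (intro member_le_sum) auto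
    finally have "\<bar>z i\<bar> \<le> int (4 * r)" using zsum by simp
    then show ?thesis by (simp add: abs_le_iff)
  qed
  then have "z \<in> {..<r} \<rightarrow>\<^sub>E {- int (4 * r)..int (4 * r)}"
    by (intro PiE_I) (auto simp: z_def)
  then have z: "z \<in> int_ball r" using zsum unfolding int_ball_def by simp
  \<comment> \<open>Rounding loses at most the l1 norm of \<open>w\<close>, which is half of the
    inner product \<open>2 sqrt r s\<close> before rounding; hence the length
    \<open>2 sqrt r\<close>.\<close>
  have "(\<Sum>i<r. \<bar>w i\<bar>)\<^sup>2 \<le> (\<Sum>i<r. 1\<^sup>2) * (\<Sum>i<r. \<bar>w i\<bar>\<^sup>2)"
    using Cauchy_Schwarz_ineq_sum[of "\<lambda>_. 1" "\<lambda>i. \<bar>w i\<bar>" "{..<r}"] by simp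
  also have "\<dots> = (sqrt (real r) * s)\<^sup>2" by (simp add: power_mult_distrib s)
  finally have l1: "(\<Sum>i<r. \<bar>w i\<bar>) \<le> sqrt (real r) * s"
    by (rule power2_le_imp_le) (simp add: s(1) less_imp_le)
  have "sqrt (real r) * s \<le> 2 * sqrt (real r) * s - (\<Sum>i<r. \<bar>w i\<bar>)" using l1 by linarith
  also have "\<dots> = 2 * sqrt (real r) / s * (\<Sum>i<r. (w i)\<^sup>2) - (\<Sum>i<r. \<bar>w i\<bar>)"
  proof -
    have "2 * sqrt (real r) / s * s\<^sup>2 = 2 * sqrt (real r) * s" using s(1) by (simp add: power2_eq_square)
    then show ?thesis unfolding s(2) by (rule arg_cong[OF sym])
  qed
  also have "\<dots> = (\<Sum>i<r. \<bar>w i\<bar> * (\<bar>u i\<bar> - 1))"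
  proof -
    have "\<bar>w i\<bar> * \<bar>u i\<bar> = 2 * sqrt (real r) / s * (w i)\<^sup>2" for i
    proof -
      have "\<bar>w i\<bar> * \<bar>u i\<bar> = 2 * sqrt (real r) / s * (\<bar>w i\<bar> * \<bar>w i\<bar>)"
        using s(1) by (simp add: u_def abs_mult)
      then show ?thesis by (simp add: power2_eq_square)
    qed
    then show ?thesis unfolding right_diff_distrib by (simp only: sum_subtractf sum_distrib_left mult_1_right)
  qed
  also have "\<dots> \<le> (\<Sum>i<r. w i * of_int (z i))"
  proof (rule sum_mono)
    fix i assume "i \<in> {..<r}"
    then have "w i * of_int (z i) = \<bar>w i\<bar> * of_int \<lfloor>\<bar>u i\<bar>\<rfloor>" by (auto simp: z_def)
    moreover have "\<bar>u i\<bar> - 1 \<le> of_int \<lfloor>\<bar>u i\<bar>\<rfloor>" by linarith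
    ultimately show "\<bar>w i\<bar> * (\<bar>u i\<bar> - 1) \<le> w i * of_int (z i)"
      by (simp add: mult_left_mono)
  qed
  finally have "(sqrt (real r) * s) ^ (2 * m) \<le> (\<Sum>i<r. w i * of_int (z i)) ^ (2 * m)"
    using s(1) by (intro power_mono) auto
  also have "\<dots> \<le> (\<Sum>z\<in>int_ball r. (\<Sum>i<r. w i * of_int (z i)) ^ (2 * m))"
    using z by (intro member_le_sum) (auto simp: power_mult)
  finally have "(sqrt (real r) * s) ^ (2 * m) \<le> (\<Sum>z\<in>int_ball r. (\<Sum>i<r. w i * of_int (z i)) ^ (2 * m))" .
  moreover have "(sqrt (real r) * s) ^ (2 * m) = (\<Sum>i<r. (w i)\<^sup>2) ^ m * real r ^ m"
    unfolding power_mult power_mult_distrib s(2) by simp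
  ultimately show ?thesis by simp
qed

text \<open>Norming is applied twice, to the image of \<open>v\<close> and then to the image
  \<open>y\<close> of a grid point under the transpose; Cauchy-Schwarz with the unit vector
  \<open>v\<close> links the two. Sums of powers stand for maxima over the grid because their
  expectations can be taken termwise.\<close>

lemma sign_matrix_opnorm_le:
  fixes x :: "nat \<times> nat \<Rightarrow> real"
  assumes v: "(\<Sum>j<r. (v j)\<^sup>2) = 1"
  shows "(\<Sum>i<r. (\<Sum>j<r. x (i,j) * v j)\<^sup>2) ^ m * (real r ^ m)\<^sup>2 \<le>
    (\<Sum>z\<in>int_ball r. \<Sum>z'\<in>int_ball r. (\<Sum>e\<in>{..<r} \<times> {..<r}. (of_int (z (fst e)) * of_int (z' (snd e))) * x e) ^ (2 * m))"
proof -
  have inner: "(\<Sum>i<r. (\<Sum>j<r. x (i,j) * v j) * of_int (z i)) ^ (2 * m) * real r ^ m \<le>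
    (\<Sum>z'\<in>int_ball r. (\<Sum>e\<in>{..<r} \<times> {..<r}. (of_int (z (fst e)) * of_int (z' (snd e))) * x e) ^ (2 * m))" for z :: "nat \<Rightarrow> int"
  proof -
    define y where "y j = (\<Sum>i<r. x (i,j) * of_int (z i))" for j
    have "(\<Sum>i<r. (\<Sum>j<r. x (i,j) * v j) * of_int (z i)) = (\<Sum>j<r. v j * y j)"
      unfolding y_def sum_distrib_left sum_distrib_right
      by (subst sum.swap) (simp add: mult_ac)
    then have "(\<Sum>i<r. (\<Sum>j<r. x (i,j) * v j) * of_int (z i)) ^ (2 * m) = ((\<Sum>j<r. v j * y j)\<^sup>2) ^ m"
      by (simp add: power_mult)
    also have "\<dots> \<le> (\<Sum>j<r. (y j)\<^sup>2) ^ m"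
      using Cauchy_Schwarz_ineq_sum[of v y "{..<r}"] by (intro power_mono) (simp_all add: v)
    finally have "(\<Sum>i<r. (\<Sum>j<r. x (i,j) * v j) * of_int (z i)) ^ (2 * m) * real r ^ m \<le>
       (\<Sum>j<r. (y j)\<^sup>2) ^ m * real r ^ m" by (intro mult_right_mono) auto
    also have "\<dots> \<le> (\<Sum>z'\<in>int_ball r. (\<Sum>j<r. y j * of_int (z' j)) ^ (2 * m))"
      by (rule int_ball_norming)
    also have "\<dots> = (\<Sum>z'\<in>int_ball r. (\<Sum>e\<in>{..<r} \<times> {..<r}. (of_int (z (fst e)) * of_int (z' (snd e))) * x e) ^ (2 * m))"
    proof (intro sum.cong refl arg_cong[where f = "\<lambda>a. a ^ (2 * m)"])
      fix z' :: "nat \<Rightarrow> int"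
      have "(\<Sum>j<r. y j * of_int (z' j)) = (\<Sum>i<r. \<Sum>j<r. (of_int (z i) * of_int (z' j)) * x (i,j))"
        unfolding y_def sum_distrib_left sum_distrib_right
        by (subst sum.swap) (simp add: mult_ac)
      then show "(\<Sum>j<r. y j * of_int (z' j)) = (\<Sum>e\<in>{..<r} \<times> {..<r}. (of_int (z (fst e)) * of_int (z' (snd e))) * x e)"
        by (simp add: sum.cartesian_product case_prod_unfold)
    qed
    finally show ?thesis .
  qed
  have "(\<Sum>i<r. (\<Sum>j<r. x (i,j) * v j)\<^sup>2) ^ m * (real r ^ m)\<^sup>2 =
     ((\<Sum>i<r. (\<Sum>j<r. x (i,j) * v j)\<^sup>2) ^ m * real r ^ m) * real r ^ m"
    by (simp only: power2_eq_square mult.assoc)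
  also have "\<dots> \<le> (\<Sum>z\<in>int_ball r. (\<Sum>i<r. (\<Sum>j<r. x (i,j) * v j) * of_int (z i)) ^ (2 * m)) * real r ^ m"
    by (intro mult_right_mono int_ball_norming) simp
  also have "\<dots> \<le> (\<Sum>z\<in>int_ball r. \<Sum>z'\<in>int_ball r. (\<Sum>e\<in>{..<r} \<times> {..<r}. (of_int (z (fst e)) * of_int (z' (snd e))) * x e) ^ (2 * m))"
    by (subst sum_distrib_right) (intro sum_mono inner)
  finally show ?thesis .
qed

lemma sign_matrix_bilinear_moment:
  assumes r: "r > 0" and z: "z \<in> int_ball r" "z' \<in> int_ball r"
  shows "measure_pmf.expectation (sparse_sign_matrix 1 r r)
     (\<lambda>x. (\<Sum>e\<in>{..<r} \<times> {..<r}. (of_int (z (fst e)) * of_int (z' (snd e))) * x e) ^ (2 * r))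
     \<le> (4 * exp 8) ^ r * real r ^ (3 * r)"
proof -
  have zs: "(\<Sum>i<r. (real_of_int (z i))\<^sup>2) \<le> 4 * real r" if "z \<in> int_ball r" for z
  proof -
    have "real_of_int (\<Sum>i<r. (z i)\<^sup>2) \<le> real_of_int (4 * int r)"
      using that unfolding int_ball_def by (simp only: of_int_le_iff) simp
    then show ?thesis by simp
  qed
  have "(\<Sum>e\<in>{..<r} \<times> {..<r}. (real_of_int (z (fst e)) * of_int (z' (snd e)))\<^sup>2) =
     (\<Sum>i<r. (real_of_int (z i))\<^sup>2) * (\<Sum>j<r. (real_of_int (z' j))\<^sup>2)"
    by (simp add: sum_product sum.cartesian_product case_prod_unfold power_mult_distrib)
  also have "\<dots> \<le> (4 * real r) * (4 * real r)"
    using zs[OF z(1)] zs[OF z(2)] by (intro mult_mono) (auto intro: sum_nonneg)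
  finally have "(\<Sum>e\<in>{..<r} \<times> {..<r}. (real_of_int (z (fst e)) * of_int (z' (snd e)))\<^sup>2) \<le> 16 * (real r)\<^sup>2"
    by (simp add: power2_eq_square)
  \<comment> \<open>For \<open>t = 1 / sqrt r\<close> and \<open>B = 16 r^2\<close> the exponent is
    \<open>8 r\<close>, of the same order as the moment \<open>2 r\<close>.\<close>
  moreover have "1 / sqrt (real r) > 0" using r by simp
  ultimately have "measure_pmf.expectation (sparse_sign_matrix 1 r r)
     (\<lambda>x. (\<Sum>e\<in>{..<r} \<times> {..<r}. (of_int (z (fst e)) * of_int (z' (snd e))) * x e) ^ (2 * r))
     \<le> fact (2 * r) / (1 / sqrt (real r)) ^ (2 * r) * exp ((1 / sqrt (real r))\<^sup>2 * (16 * (real r)\<^sup>2) / 2)"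
    by (rule sign_matrix_even_moment[rotated])
  also have "(1 / sqrt (real r)) ^ (2 * r) = 1 / real r ^ r"
    by (simp add: power_mult power_divide)
  also have "(1 / sqrt (real r))\<^sup>2 * (16 * (real r)\<^sup>2) / 2 = real r * 8"
    using r by (simp add: power_divide power2_eq_square)
  also have "exp (real r * 8) = exp 8 ^ r" by (rule exp_of_nat_mult)
  also have "fact (2 * r) / (1 / real r ^ r) * exp 8 ^ r \<le> (2 * real r) ^ (2 * r) * real r ^ r * exp 8 ^ r"
  proof -
    have "(fact (2 * r) :: real) \<le> of_nat ((2 * r) ^ (2 * r))" by (rule fact_le_power)
    then have "(fact (2 * r) :: real) \<le> (2 * real r) ^ (2 * r)" by simp
    then show ?thesis using r by (simp add: mult_right_mono)
  qed
  also have "\<dots> = (4 * exp 8) ^ r * real r ^ (3 * r)"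
  proof -
    have "real r ^ (3 * r) = real r ^ (2 * r) * real r ^ r" by (simp flip: power_add)
    moreover have "(2 * real r) ^ (2 * r) = 4 ^ r * real r ^ (2 * r)"
      by (simp add: power_mult_distrib power_mult)
    ultimately show ?thesis by (simp add: power_mult_distrib mult_ac)
  qed
  finally show ?thesis .
qed

text \<open>Two grids cost \<open>48^(2 r)\<close> and the bilinear moment contributes
  \<open>(4 exp 8)^r\<close>, so the constant is \<open>9216 exp 8\<close> with
  \<open>9216 = 48^2 * 4\<close>. Both are \<open>r\<close>-th powers, hence constants at the level
  of the squared operator norm.\<close>

lemma sign_walk_total_le:
  assumes r: "r > 0" and k: "k \<le> r"
  shows "walk_total 1 r r k \<le> 2 * real r * (9216 * exp 8 * real r) ^ k"
proof -
  let ?E = "measure_pmf.expectation (sparse_sign_matrix 1 r r)"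
  have int: "integrable (measure_pmf (sparse_sign_matrix 1 r r)) f" for f :: "_ \<Rightarrow> real"
    by (intro integrable_measure_pmf_finite) simp
  define T where "T x = (\<Sum>z\<in>int_ball r. \<Sum>z'\<in>int_ball r.
      (\<Sum>e\<in>{..<r} \<times> {..<r}. (of_int (z (fst e)) * of_int (z' (snd e))) * x e) ^ (2 * r))" for x :: "nat \<times> nat \<Rightarrow> real"
  \<comment> \<open>\<open>Q x\<close> bounds the \<open>r\<close>-th power of the squared operator
    norm of the matrix \<open>x\<close>.\<close>
  define Q where "Q x = T x / (real r ^ r)\<^sup>2" for x
  define \<Lambda> where "\<Lambda> = 9216 * exp 8 * real r"
  have \<Lambda>: "\<Lambda> > 0" using r by (simp add: \<Lambda>_def)
  have T0: "T x \<ge> 0" for x unfolding T_def by (intro sum_nonneg) (simp add: power_mult)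
  have Q0: "Q x \<ge> 0" for x by (simp add: Q_def T0)
  have "?E T = (\<Sum>z\<in>int_ball r. \<Sum>z'\<in>int_ball r. ?E (\<lambda>x.
      (\<Sum>e\<in>{..<r} \<times> {..<r}. (of_int (z (fst e)) * of_int (z' (snd e))) * x e) ^ (2 * r)))"
    unfolding T_def by (simp add: Bochner_Integration.integral_sum int)
  also have "\<dots> \<le> (\<Sum>z\<in>int_ball r. \<Sum>z'\<in>int_ball r. (4 * exp 8) ^ r * real r ^ (3 * r))"
    by (intro sum_mono sign_matrix_bilinear_moment r)
  also have "\<dots> = (real (card (int_ball r)))\<^sup>2 * ((4 * exp 8) ^ r * real r ^ (3 * r))"
    by (simp add: power2_eq_square)
  also have "\<dots> \<le> (48 ^ r)\<^sup>2 * ((4 * exp 8) ^ r * real r ^ (3 * r))"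
    by (intro mult_right_mono power_mono card_int_ball) auto
  also have "\<dots> = \<Lambda> ^ r * (real r ^ r)\<^sup>2"
  proof -
    have "real r ^ (3 * r) = real r ^ r * (real r ^ r)\<^sup>2"
      by (simp add: power_mult[symmetric] power_add[symmetric])
    moreover have "((48::real) ^ r)\<^sup>2 * 4 ^ r = 9216 ^ r"
      by (simp add: power_mult[symmetric] mult.commute[of r] power_mult flip: power_mult_distrib)
    ultimately show ?thesis by (simp add: \<Lambda>_def power_mult_distrib mult_ac)
  qed
  finally have "?E Q \<le> \<Lambda> ^ r" using r unfolding Q_def by (simp add: field_simps)
  then have EQ: "?E Q / \<Lambda> ^ r \<le> 1" using \<Lambda> by simp
  have gt: "gram_trace r r (\<lambda>i j. x (i,j)) k \<le> real r * (\<Lambda> ^ k * (1 + Q x / \<Lambda> ^ r))" for x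
  proof -
    define R where "R = root r (Q x)"
    have R: "R \<ge> 0" "R ^ r = Q x" using r Q0 by (auto simp: R_def)
    have "gram_trace r r (\<lambda>i j. x (i,j)) k \<le> real r * R ^ k"
    proof (rule gram_trace_le)
      fix v :: "nat \<Rightarrow> real" assume v: "(\<Sum>l<r. (v l)\<^sup>2) = 1"
      have "(\<Sum>i<r. (\<Sum>l<r. x (i,l) * v l)\<^sup>2) ^ r \<le> R ^ r"
        using sign_matrix_opnorm_le[OF v, of x r] r unfolding R(2) Q_def T_def by (simp add: field_simps)
      then have "(\<Sum>i<r. (\<Sum>l<r. x (i,l) * v l)\<^sup>2) ^ Suc (r - 1) \<le> R ^ Suc (r - 1)" using r by simp
      then show "(\<Sum>i<r. (\<Sum>l<r. x (i,l) * v l)\<^sup>2) \<le> R" using R(1) by (rule power_le_imp_le_base)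
    qed
    also have "\<dots> \<le> real r * (\<Lambda> ^ k * (1 + Q x / \<Lambda> ^ r))"
    proof (rule mult_left_mono)
      \<comment> \<open>With \<open>u = R / \<Lambda>\<close> this is
        \<open>u^k \<le> 1 + u^r\<close>, and \<open>k \<le> r\<close> enters here.\<close>
      show "R ^ k \<le> \<Lambda> ^ k * (1 + Q x / \<Lambda> ^ r)"
      proof (cases "R \<le> \<Lambda>")
        case True
        then have "R ^ k \<le> \<Lambda> ^ k * 1" using R by (simp add: power_mono)
        also have "\<dots> \<le> \<Lambda> ^ k * (1 + Q x / \<Lambda> ^ r)" using \<Lambda> Q0 by (intro mult_left_mono) auto
        finally show ?thesis .
      next
        case False
        then have "(R / \<Lambda>) ^ k \<le> (R / \<Lambda>) ^ r" using \<Lambda> k by (intro power_increasing) auto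
        then have "R ^ k \<le> \<Lambda> ^ k * (Q x / \<Lambda> ^ r)" using \<Lambda> by (simp add: power_divide R(2) field_simps)
        also have "\<dots> \<le> \<Lambda> ^ k * (1 + Q x / \<Lambda> ^ r)" using \<Lambda> by (intro mult_left_mono) auto
        finally show ?thesis .
      qed
    qed simp
    finally show ?thesis .
  qed
  have "walk_total 1 r r k = ?E (\<lambda>x. gram_trace r r (\<lambda>i j. x (i, j)) k)"
    by (simp add: expectation_gram_trace)
  also have "\<dots> \<le> ?E (\<lambda>x. real r * (\<Lambda> ^ k * (1 + Q x / \<Lambda> ^ r)))"
    by (intro integral_mono int gt)
  also have "\<dots> = real r * (\<Lambda> ^ k * (1 + ?E Q / \<Lambda> ^ r))"
    by (simp add: Bochner_Integration.integral_add int)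
  also have "\<dots> \<le> real r * (\<Lambda> ^ k * (1 + 1))"
    using \<Lambda> EQ by (intro mult_left_mono add_left_mono) auto
  finally show ?thesis by (simp add: \<Lambda>_def)
qed

text \<open>The cost \<open>d2 / r\<close> of the comparison cancels the dimension \<open>r\<close>
  of the dense trace, so \<open>r\<close> survives in the \<open>k\<close>-th power alone.\<close>

lemma sparse_sign_trace_moment:
  assumes q: "0 \<le> q" "q \<le> 1" and r: "r > 0" "real k + q * real d1 \<le> real r" "real k + q * real d2 \<le> real r"
  shows "measure_pmf.expectation (sparse_sign_matrix q d1 d2) (\<lambda>x. gram_trace d1 d2 (\<lambda>i j. x (i, j)) k)
    \<le> 2 * real d2 * (9216 * exp 8 * real r) ^ k"
proof -
  have "0 \<le> q * real d1" using q by simp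
  then have k: "k \<le> r" using r(2) by linarith
  have "real r * walk_total q d1 d2 k \<le> real d2 * walk_total 1 r r k"
    by (rule walk_total_compare[OF q r])
  also have "\<dots> \<le> real d2 * (2 * real r * (9216 * exp 8 * real r) ^ k)"
    by (intro mult_left_mono sign_walk_total_le r(1) k) simp
  finally have "real r * walk_total q d1 d2 k \<le> real r * (2 * real d2 * (9216 * exp 8 * real r) ^ k)"
    by (simp add: mult_ac)
  then show ?thesis using r(1) by (simp add: expectation_gram_trace[OF q])
qed

section \<open>Symmetrization and contraction\<close>

text \<open>With \<open>d = u' - u\<close>, both \<open>u'\<close> and \<open>v\<close> lie between
  \<open>u\<close> and \<open>v + d\<close>, with complementary weights. Adding the two convexity
  inequalities settles increments of equal length, and monotonicity the longer one.\<close>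

lemma convex_mono_increment_le:
  fixes F :: "real \<Rightarrow> real"
  assumes F: "convex_on UNIV F" "mono F"
    and "u \<le> u'" "v \<le> v'" "u' - u \<le> v' - v" "u \<le> v"
  shows "F u' - F u \<le> F v' - F v"
proof (cases "u' = u")
  case True
  then show ?thesis using assms by (simp add: monoD)
next
  case False
  define d where "d = u' - u"
  have d: "d > 0" using False assms by (simp add: d_def)
  have vd: "v + d \<le> v'" using assms by (simp add: d_def)
  have "F u' - F u \<le> F (v + d) - F v"
  proof (cases "u = v")
    case True
    then show ?thesis by (simp add: d_def)
  next
    case False
    then have uv: "u < v" using assms by simp
    define h where "h = v + d - u"
    have h: "h > 0" using uv d by (simp add: h_def)
    have comb: "(1 - t) * u + t * (v + d) = u + t * h" for t
      by (simp add: h_def algebra_simps)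
    have "u' = (1 - d / h) * u + (d / h) * (v + d)" "v = (1 - (h - d) / h) * u + ((h - d) / h) * (v + d)"
      unfolding comb using h by (simp_all add: d_def h_def)
    moreover have "d / h \<in> {0..1}" "(h - d) / h \<in> {0..1}"
      using h d uv by (auto simp: h_def)
    ultimately have "F u' \<le> (1 - d / h) * F u + (d / h) * F (v + d)"
      "F v \<le> (1 - (h - d) / h) * F u + ((h - d) / h) * F (v + d)"
      using F(1) convex_onD[OF F(1)] by (metis UNIV_I atLeastAtMost_iff real_scaleR_def)+
    moreover have "(h - d) / h = 1 - d / h" using h by (simp add: diff_divide_distrib)
    ultimately show ?thesis by (simp add: algebra_simps)
  qed
  also have "\<dots> \<le> F v' - F v" using F(2) vd by (simp add: monoD)
  finally show ?thesis .
qed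

text \<open>
  The case distinction of Ledoux and Talagrand: the sign pattern of \<open>x1\<close>, \<open>x2\<close> decides which of the
  two maxima on the right is evaluated at which point.
\<close>

lemma contraction_two_points:
  fixes F :: "real \<Rightarrow> real"
  assumes F: "convex_on UNIV F" "mono F"
    and opt: "c2 + \<phi>2 \<le> c1 + \<phi>1" "c1 - \<phi>1 \<le> c2 - \<phi>2"
    and lip: "\<bar>\<phi>1\<bar> \<le> \<bar>x1\<bar>" "\<bar>\<phi>2\<bar> \<le> \<bar>x2\<bar>" "\<bar>\<phi>1 - \<phi>2\<bar> \<le> \<bar>x1 - x2\<bar>"
  shows "F (c1 + \<phi>1) + F (c2 - \<phi>2) \<le> F (max (c1 + x1) (c2 + x2)) + F (max (c1 - x1) (c2 - x2))"
    (is "_ \<le> ?R")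
proof -
  have R1: "F (c1 + x1) + F (c2 - x2) \<le> ?R" and R2: "F (c1 - x1) + F (c2 + x2) \<le> ?R"
    using monoD[OF F(2), of "c1 + x1" "max (c1 + x1) (c2 + x2)"] monoD[OF F(2), of "c2 - x2" "max (c1 - x1) (c2 - x2)"]
      monoD[OF F(2), of "c2 + x2" "max (c1 + x1) (c2 + x2)"] monoD[OF F(2), of "c1 - x1" "max (c1 - x1) (c2 - x2)"]
    by auto
  \<comment> \<open>Maximality in \<open>opt\<close> places the starting point
    \<open>c2 - y2\<close> of one increment below the starting point \<open>c1 + \<phi>1\<close> of
    the other.\<close>
  have case_ge: "F (c1 + \<phi>1) + F (c2 - \<phi>2) \<le> F (c1 + y1) + F (c2 - y2)"
    if "\<bar>\<phi>1\<bar> \<le> y1" "\<bar>\<phi>2\<bar> \<le> y2" "\<bar>\<phi>1 - \<phi>2\<bar> \<le> y1 - y2" for y1 y2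
  proof -
    have "F (c2 - \<phi>2) - F (c2 - y2) \<le> F (c1 + y1) - F (c1 + \<phi>1)"
      using that opt by (intro convex_mono_increment_le[OF F]) linarith+
    then show ?thesis by linarith
  qed
  have case_le: "F (c1 + \<phi>1) + F (c2 - \<phi>2) \<le> F (c1 - y1) + F (c2 + y2)"
    if "\<bar>\<phi>1\<bar> \<le> y1" "\<bar>\<phi>2\<bar> \<le> y2" "\<bar>\<phi>1 - \<phi>2\<bar> \<le> y2 - y1" for y1 y2
  proof -
    have "F (c1 + \<phi>1) - F (c1 - y1) \<le> F (c2 + y2) - F (c2 - \<phi>2)"
      using that opt by (intro convex_mono_increment_le[OF F]) linarith+
    then show ?thesis by linarith
  qed
  \<comment> \<open>For opposite signs of \<open>x1\<close> and \<open>x2\<close> monotonicity in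
    each term is enough.\<close>
  have opp: "F (c1 + \<phi>1) + F (c2 - \<phi>2) \<le> F (c1 + \<bar>x1\<bar>) + F (c2 + \<bar>x2\<bar>)"
    using lip by (intro add_mono monoD[OF F(2)]) auto
  consider "x1 \<ge> 0" "x2 \<ge> 0" "x2 \<le> x1" | "x1 \<ge> 0" "x2 \<ge> 0" "x1 \<le> x2"
    | "x1 \<le> 0" "x2 \<le> 0" "x2 \<le> x1" | "x1 \<le> 0" "x2 \<le> 0" "x1 \<le> x2"
    | "x1 \<ge> 0" "x2 \<le> 0" | "x1 \<le> 0" "x2 \<ge> 0" by linarith
  then show ?thesis
  proof cases
    case 1 then show ?thesis using case_ge[of x1 x2] lip R1 by auto
  next
    case 2 then show ?thesis using case_le[of x1 x2] lip R2 by auto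
  next
    case 3 then show ?thesis using case_le[of "-x1" "-x2"] lip R1 by auto
  next
    case 4 then show ?thesis using case_ge[of "-x1" "-x2"] lip R2 by auto
  next
    case 5 then show ?thesis using opp R1 by auto
  next
    case 6 then show ?thesis using opp R2 by auto
  qed
qed

text \<open>The contraction principle for one random sign, whose two values give the two terms;
  \<open>c\<close> holds all other coordinates. The maximizers of the two maxima on the left reduce
  it to two points.\<close>

lemma contraction_Max:
  fixes F :: "real \<Rightarrow> real"
  assumes F: "convex_on UNIV F" "mono F" and T: "finite T" "T \<noteq> {}"
    and lip: "\<And>X. X \<in> T \<Longrightarrow> \<bar>\<phi> X\<bar> \<le> \<bar>x X\<bar>"
      "\<And>X X'. X \<in> T \<Longrightarrow> X' \<in> T \<Longrightarrow> \<bar>\<phi> X - \<phi> X'\<bar> \<le> \<bar>x X - x X'\<bar>"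
  shows "F (MAX X\<in>T. c X + \<phi> X) + F (MAX X\<in>T. c X - \<phi> X) \<le> F (MAX X\<in>T. c X + x X) + F (MAX X\<in>T. c X - x X)"
proof -
  have "(MAX X\<in>T. c X + \<phi> X) \<in> (\<lambda>X. c X + \<phi> X) ` T" using T by (intro Max_in) auto
  then obtain X1 where X1: "X1 \<in> T" "(MAX X\<in>T. c X + \<phi> X) = c X1 + \<phi> X1" by auto
  have "(MAX X\<in>T. c X - \<phi> X) \<in> (\<lambda>X. c X - \<phi> X) ` T" using T by (intro Max_in) auto
  then obtain X2 where X2: "X2 \<in> T" "(MAX X\<in>T. c X - \<phi> X) = c X2 - \<phi> X2" by auto
  have le: "g X \<le> (MAX X\<in>T. g X)" if "X \<in> T" for g :: "_ \<Rightarrow> real" and X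
    using T that by (intro Max_ge) auto
  have "F (c X1 + \<phi> X1) + F (c X2 - \<phi> X2) \<le>
    F (max (c X1 + x X1) (c X2 + x X2)) + F (max (c X1 - x X1) (c X2 - x X2))"
    using le[OF X2(1), of "\<lambda>X. c X + \<phi> X"] le[OF X1(1), of "\<lambda>X. c X - \<phi> X"]
    by (intro contraction_two_points[OF F] lip X1(1) X2(1)) (simp_all add: X1(2) X2(2))
  also have "\<dots> \<le> F (MAX X\<in>T. c X + x X) + F (MAX X\<in>T. c X - x X)"
    using le[OF X1(1)] le[OF X2(1)] by (intro add_mono monoD[OF F(2)]) auto
  finally show ?thesis by (simp only: X1(2) X2(2))
qed

text \<open>The maximum of an average is at most the average of the maxima; monotonicity and
  Jensen's inequality do the rest.\<close>

lemma convex_mono_Max_combination: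
  fixes F :: "real \<Rightarrow> real"
  assumes F: "convex_on UNIV F" "mono F" and T: "finite T" "T \<noteq> {}" and S: "finite S"
    and w: "\<And>s. s \<in> S \<Longrightarrow> w s \<ge> 0" "(\<Sum>s\<in>S. w s) = 1"
  shows "F (MAX X\<in>T. \<Sum>s\<in>S. w s * g s X) \<le> (\<Sum>s\<in>S. w s * F (MAX X\<in>T. g s X))"
proof -
  have "(MAX X\<in>T. \<Sum>s\<in>S. w s * g s X) \<le> (\<Sum>s\<in>S. w s * (MAX X\<in>T. g s X))"
  proof (rule Max.boundedI)
    fix y assume "y \<in> (\<lambda>X. \<Sum>s\<in>S. w s * g s X) ` T"
    then obtain X where X: "X \<in> T" "y = (\<Sum>s\<in>S. w s * g s X)" by auto
    show "y \<le> (\<Sum>s\<in>S. w s * (MAX X\<in>T. g s X))"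
      unfolding X(2) using X(1) T w by (intro sum_mono mult_left_mono Max_ge) auto
  qed (use T in auto)
  then have "F (MAX X\<in>T. \<Sum>s\<in>S. w s * g s X) \<le> F (\<Sum>s\<in>S. w s *\<^sub>R (MAX X\<in>T. g s X))"
    using F(2) by (simp add: monoD)
  also have "\<dots> \<le> (\<Sum>s\<in>S. w s * F (MAX X\<in>T. g s X))"
    using S w by (intro convex_on_sum[OF _ _ F(1)]) (auto intro: ccontr)
  finally show ?thesis .
qed

text \<open>Jensen's inequality replaces the mean by an independent copy \<open>s'\<close>.
  Contraction is then applied outcome by outcome, where the entry is active; idle outcomes
  contribute 0. So the mass \<open>1 - q\<close> at 0 is kept, and the result is a sparse sign
  instead of a dense one.\<close>

lemma symmetrize_contract_coordinate:
  fixes F :: "real \<Rightarrow> real" and D :: "'b pmf" and \<psi> :: "'b \<Rightarrow> 'x \<Rightarrow> real"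
  assumes F: "convex_on UNIV F" "mono F" and T: "finite T" "T \<noteq> {}"
    and D: "finite (set_pmf D)" "measure_pmf.prob D {s. act s} = q"
    and idle: "\<And>s X. s \<in> set_pmf D \<Longrightarrow> \<not> act s \<Longrightarrow> X \<in> T \<Longrightarrow> \<psi> s X = 0"
    and lip: "\<And>s X. s \<in> set_pmf D \<Longrightarrow> X \<in> T \<Longrightarrow> \<bar>\<psi> s X\<bar> \<le> \<bar>x X\<bar>"
      "\<And>s X X'. s \<in> set_pmf D \<Longrightarrow> X \<in> T \<Longrightarrow> X' \<in> T \<Longrightarrow> \<bar>\<psi> s X - \<psi> s X'\<bar> \<le> \<bar>x X - x X'\<bar>"
  shows "measure_pmf.expectation D (\<lambda>s. F (MAX X\<in>T. c X + (\<psi> s X - measure_pmf.expectation D (\<lambda>s. \<psi> s X))))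
    \<le> measure_pmf.expectation (sparse_sign_pmf q) (\<lambda>z. F (MAX X\<in>T. c X + 2 * z * x X))"
proof -
  let ?S = "set_pmf D"
  let ?w = "pmf D"
  have E: "measure_pmf.expectation D h = (\<Sum>s\<in>?S. ?w s * h s)" for h :: "'b \<Rightarrow> real"
    using D(1) by (subst integral_measure_pmf[of ?S]) auto
  have w1: "(\<Sum>s\<in>?S. ?w s) = 1" using D(1) by (simp add: sum_pmf_eq_1)
  have q: "0 \<le> q" "q \<le> 1" using D(2) by auto
  define \<Phi> where "\<Phi> g = F (MAX X\<in>T. c X + g X)" for g
  \<comment> \<open>\<open>g - h\<close> is the midpoint of \<open>2 g\<close> and
    \<open>- 2 h\<close>: the origin of the factor 2.\<close>
  have half: "\<Phi> (\<lambda>X. g X - h X) \<le> (\<Phi> (\<lambda>X. 2 * g X) + \<Phi> (\<lambda>X. - 2 * h X)) / 2" for g h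
  proof -
    have "F (MAX X\<in>T. \<Sum>s\<in>UNIV. 1 / 2 * (c X + (if s then 2 * g X else - 2 * h X))) \<le>
       (\<Sum>s\<in>(UNIV::bool set). 1 / 2 * F (MAX X\<in>T. c X + (if s then 2 * g X else - 2 * h X)))"
      by (intro convex_mono_Max_combination F T) (auto simp: UNIV_bool)
    then show ?thesis by (simp add: \<Phi>_def UNIV_bool algebra_simps)
  qed
  have "\<Phi> (\<lambda>X. \<psi> s X - (\<Sum>s'\<in>?S. ?w s' * \<psi> s' X)) \<le> (\<Sum>s'\<in>?S. ?w s' * \<Phi> (\<lambda>X. \<psi> s X - \<psi> s' X))" for s
  proof -
    have "F (MAX X\<in>T. \<Sum>s'\<in>?S. ?w s' * (c X + (\<psi> s X - \<psi> s' X))) \<le>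
      (\<Sum>s'\<in>?S. ?w s' * F (MAX X\<in>T. c X + (\<psi> s X - \<psi> s' X)))"
      by (intro convex_mono_Max_combination F T D w1) simp
    moreover have "(\<Sum>s'\<in>?S. ?w s' * (c X + (\<psi> s X - \<psi> s' X))) = c X + (\<psi> s X - (\<Sum>s'\<in>?S. ?w s' * \<psi> s' X))" for X
      by (simp add: distrib_left right_diff_distrib sum.distrib sum_subtractf w1 flip: sum_distrib_right)
    ultimately show ?thesis by (simp add: \<Phi>_def)
  qed
  then have "(\<Sum>s\<in>?S. ?w s * \<Phi> (\<lambda>X. \<psi> s X - (\<Sum>s'\<in>?S. ?w s' * \<psi> s' X)))
    \<le> (\<Sum>s\<in>?S. ?w s * (\<Sum>s'\<in>?S. ?w s' * \<Phi> (\<lambda>X. \<psi> s X - \<psi> s' X)))"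
    by (intro sum_mono mult_left_mono) auto
  also have "\<dots> \<le> (\<Sum>s\<in>?S. ?w s * (\<Sum>s'\<in>?S. ?w s' * ((\<Phi> (\<lambda>X. 2 * \<psi> s X) + \<Phi> (\<lambda>X. - 2 * \<psi> s' X)) / 2)))"
    by (intro sum_mono mult_left_mono half) auto
  \<comment> \<open>As \<open>s'\<close> has the law of \<open>s\<close>, the two one-sided terms
    can be paired at a common outcome, where they are the two values of a random sign.\<close>
  also have "\<dots> = (\<Sum>s\<in>?S. ?w s * ((\<Phi> (\<lambda>X. 2 * \<psi> s X) + \<Phi> (\<lambda>X. - 2 * \<psi> s X)) / 2))"
  proof -
    have "(\<Sum>s\<in>?S. ?w s * (\<Sum>s'\<in>?S. ?w s' * ((a s + b s') / 2))) = (\<Sum>s\<in>?S. ?w s * ((a s + b s) / 2))"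
      for a b :: "'b \<Rightarrow> real"
    proof -
      have "(\<Sum>s'\<in>?S. ?w s' * ((a s + b s') / 2)) = a s / 2 + (\<Sum>s'\<in>?S. ?w s' * b s') / 2" for s
        by (simp add: distrib_left add_divide_distrib sum.distrib w1 flip: sum_distrib_right sum_divide_distrib)
      then have "(\<Sum>s\<in>?S. ?w s * (\<Sum>s'\<in>?S. ?w s' * ((a s + b s') / 2))) =
         (\<Sum>s\<in>?S. ?w s * a s) / 2 + (\<Sum>s'\<in>?S. ?w s' * b s') / 2"
        by (simp add: distrib_left sum.distrib w1 sum_divide_distrib flip: sum_distrib_right)
      then show ?thesis
        by (simp add: distrib_left add_divide_distrib sum.distrib sum_divide_distrib)
    qed
    then show ?thesis .
  qed
  also have "\<dots> \<le> (\<Sum>s\<in>?S. ?w s * (if act s then (\<Phi> (\<lambda>X. 2 * x X) + \<Phi> (\<lambda>X. - 2 * x X)) / 2 else \<Phi> (\<lambda>X. 0)))"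
  proof (rule sum_mono, rule mult_left_mono)
    fix s assume s: "s \<in> ?S"
    show "(\<Phi> (\<lambda>X. 2 * \<psi> s X) + \<Phi> (\<lambda>X. - 2 * \<psi> s X)) / 2 \<le>
       (if act s then (\<Phi> (\<lambda>X. 2 * x X) + \<Phi> (\<lambda>X. - 2 * x X)) / 2 else \<Phi> (\<lambda>X. 0))"
    proof (cases "act s")
      case True
      have "\<bar>2 * \<psi> s X - 2 * \<psi> s X'\<bar> \<le> \<bar>2 * x X - 2 * x X'\<bar>" if "X \<in> T" "X' \<in> T" for X X'
        using lip(2)[OF s that] by linarith
      then have "\<Phi> (\<lambda>X. 2 * \<psi> s X) + \<Phi> (\<lambda>X. - 2 * \<psi> s X) \<le> \<Phi> (\<lambda>X. 2 * x X) + \<Phi> (\<lambda>X. - 2 * x X)"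
        using contraction_Max[OF F T, of "\<lambda>X. 2 * \<psi> s X" "\<lambda>X. 2 * x X" c] lip(1)[OF s]
        by (simp add: \<Phi>_def abs_mult)
      then show ?thesis using True by simp
    next
      case False
      have "\<Phi> (\<lambda>X. a * \<psi> s X) = \<Phi> (\<lambda>X. 0)" for a
        unfolding \<Phi>_def using idle[OF s False] by (simp cong: image_cong)
      from this[of 2] this[of "-2"] show ?thesis using False by simp
    qed
  qed simp
  also have "\<dots> = q * ((\<Phi> (\<lambda>X. 2 * x X) + \<Phi> (\<lambda>X. - 2 * x X)) / 2) + (1 - q) * \<Phi> (\<lambda>X. 0)"
  proof -
    have "(\<Sum>s\<in>?S. ?w s * (if act s then a else b)) = q * a + (1 - q) * b" for a b :: real
    proof -
      have "measure_pmf.expectation D (indicator {s. act s}) = q" using D(2) by simp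
      then have q1: "(\<Sum>s\<in>?S. ?w s * (if act s then 1 else 0)) = q"
        unfolding E by (simp add: indicator_def of_bool_def)
      have "(\<Sum>s\<in>?S. ?w s * (if act s then a else b)) =
         (\<Sum>s\<in>?S. ?w s * (if act s then 1 else 0)) * (a - b) + (\<Sum>s\<in>?S. ?w s) * b"
        unfolding sum_distrib_right sum.distrib[symmetric]
        by (intro sum.cong) (auto simp: algebra_simps)
      then show ?thesis unfolding q1 w1 by (simp add: algebra_simps)
    qed
    then show ?thesis .
  qed
  also have "\<dots> = measure_pmf.expectation (sparse_sign_pmf q) (\<lambda>z. \<Phi> (\<lambda>X. 2 * z * x X))"
    using q by (simp add: expectation_sparse_sign_pmf)
  finally show ?thesis by (simp add: \<Phi>_def E)
qed

lemma sum_insert_fun_upd: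
  assumes "finite A" "p \<notin> A"
  shows "(\<Sum>p'\<in>insert p A. h p' ((f(p := y)) p')) = h p y + (\<Sum>p'\<in>A. h p' (f p'))"
proof -
  have "(\<Sum>p'\<in>A. h p' ((f(p := y)) p')) = (\<Sum>p'\<in>A. h p' (f p'))"
    using assms(2) by (intro sum.cong refl) (metis fun_upd_other)
  then show ?thesis using assms by simp
qed

text \<open>Coordinates are exchanged one at a time, while the offset \<open>c\<close> carries the
  others; hence the induction for arbitrary \<open>c\<close>.\<close>

lemma symmetrize_contract:
  fixes F :: "real \<Rightarrow> real" and D :: "'i \<Rightarrow> 'b pmf" and \<psi> :: "'i \<Rightarrow> 'b \<Rightarrow> 'x \<Rightarrow> real"
  assumes F: "convex_on UNIV F" "mono F" and T: "finite T" "T \<noteq> {}" and A: "finite A"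
    and D: "\<And>p. p \<in> A \<Longrightarrow> finite (set_pmf (D p))"
      "\<And>p. p \<in> A \<Longrightarrow> measure_pmf.prob (D p) {s. act s} = q"
    and idle: "\<And>p s X. p \<in> A \<Longrightarrow> s \<in> set_pmf (D p) \<Longrightarrow> \<not> act s \<Longrightarrow> X \<in> T \<Longrightarrow> \<psi> p s X = 0"
    and lip: "\<And>p s X. p \<in> A \<Longrightarrow> s \<in> set_pmf (D p) \<Longrightarrow> X \<in> T \<Longrightarrow> \<bar>\<psi> p s X\<bar> \<le> \<bar>x p X\<bar>"
      "\<And>p s X X'. p \<in> A \<Longrightarrow> s \<in> set_pmf (D p) \<Longrightarrow> X \<in> T \<Longrightarrow> X' \<in> T \<Longrightarrow> \<bar>\<psi> p s X - \<psi> p s X'\<bar> \<le> \<bar>x p X - x p X'\<bar>"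
  shows "measure_pmf.expectation (Pi_pmf A d D)
      (\<lambda>o'. F (MAX X\<in>T. c X + (\<Sum>p\<in>A. \<psi> p (o' p) X - measure_pmf.expectation (D p) (\<lambda>s. \<psi> p s X))))
    \<le> measure_pmf.expectation (Pi_pmf A 0 (\<lambda>_. sparse_sign_pmf q))
      (\<lambda>\<xi>. F (MAX X\<in>T. c X + (\<Sum>p\<in>A. 2 * \<xi> p * x p X)))"
  using A D idle lip
proof (induction A arbitrary: c rule: finite_induct)
  case (insert p A)
  let ?Z = "\<lambda>p s X. \<psi> p s X - measure_pmf.expectation (D p) (\<lambda>s. \<psi> p s X)"
  let ?P = "Pi_pmf A d D" and ?R = "Pi_pmf A 0 (\<lambda>_. sparse_sign_pmf q)"
  have finP: "finite (set_pmf ?P)" using insert by (intro finite_set_Pi_pmf) auto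
  have finR: "finite (set_pmf ?R)" using insert by (intro finite_set_Pi_pmf) auto
  have ER: "measure_pmf.expectation ?R h = (\<Sum>\<xi>\<in>set_pmf ?R. pmf ?R \<xi> * h \<xi>)" for h :: "_ \<Rightarrow> real"
    using finR by (subst integral_measure_pmf[OF finR]) auto
  have int: "integrable (measure_pmf M) h" if "finite (set_pmf M)" for M :: "'z pmf" and h :: "'z \<Rightarrow> real"
    using that by (rule integrable_measure_pmf_finite)
  have insZ: "(\<Sum>p'\<in>insert p A. ?Z p' ((f(p := y)) p') X) = ?Z p y X + (\<Sum>p'\<in>A. ?Z p' (f p') X)" for f y X
    using insert.hyps by (rule sum_insert_fun_upd)
  have insR: "(\<Sum>p'\<in>insert p A. 2 * (f(p := y)) p' * x p' X) = 2 * y * x p X + (\<Sum>p'\<in>A. 2 * f p' * x p' X)"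
    for f :: "'i \<Rightarrow> real" and y X
    using insert.hyps by (rule sum_insert_fun_upd)
  have "measure_pmf.expectation (Pi_pmf (insert p A) d D)
      (\<lambda>o'. F (MAX X\<in>T. c X + (\<Sum>p\<in>insert p A. ?Z p (o' p) X)))
     = measure_pmf.expectation (D p) (\<lambda>s. measure_pmf.expectation ?P
         (\<lambda>o'. F (MAX X\<in>T. (c X + ?Z p s X) + (\<Sum>p\<in>A. ?Z p (o' p) X))))"
    using insert.hyps insert.prems(1)
    by (subst expectation_Pi_pmf_insert) (simp_all only: insZ add.assoc not_False_eq_True)
  \<comment> \<open>The outcome \<open>s\<close> at \<open>p\<close> is fixed while the induction
    hypothesis treats the other coordinates. After exchanging the expectations, \<open>p\<close> is
    treated with their signs \<open>\<xi>\<close> fixed.\<close>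
  also have "\<dots> \<le> measure_pmf.expectation (D p) (\<lambda>s. measure_pmf.expectation ?R
         (\<lambda>\<xi>. F (MAX X\<in>T. (c X + ?Z p s X) + (\<Sum>p\<in>A. 2 * \<xi> p * x p X))))"
    using insert.prems by (intro integral_mono int insert.IH) auto
  also have "\<dots> = measure_pmf.expectation (D p) (\<lambda>s. \<Sum>\<xi>\<in>set_pmf ?R. pmf ?R \<xi> *
         F (MAX X\<in>T. (c X + (\<Sum>p\<in>A. 2 * \<xi> p * x p X)) + ?Z p s X))"
    using finR by (subst integral_measure_pmf[OF finR]) (simp_all add: add_ac)
  also have "\<dots> = (\<Sum>\<xi>\<in>set_pmf ?R. pmf ?R \<xi> * measure_pmf.expectation (D p) (\<lambda>s.
         F (MAX X\<in>T. (c X + (\<Sum>p\<in>A. 2 * \<xi> p * x p X)) + ?Z p s X)))"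
    using insert.prems(1)[of p] by (simp add: Bochner_Integration.integral_sum int)
  also have "\<dots> \<le> (\<Sum>\<xi>\<in>set_pmf ?R. pmf ?R \<xi> * measure_pmf.expectation (sparse_sign_pmf q) (\<lambda>z.
         F (MAX X\<in>T. (c X + (\<Sum>p\<in>A. 2 * \<xi> p * x p X)) + 2 * z * x p X)))"
    using insert.prems
    by (intro sum_mono mult_left_mono symmetrize_contract_coordinate[OF F T, where act = act]) auto
  also have "\<dots> = measure_pmf.expectation (sparse_sign_pmf q) (\<lambda>z. \<Sum>\<xi>\<in>set_pmf ?R. pmf ?R \<xi> *
         F (MAX X\<in>T. (c X + (\<Sum>p\<in>A. 2 * \<xi> p * x p X)) + 2 * z * x p X))"
    by (simp add: Bochner_Integration.integral_sum int)
  also have "\<dots> = measure_pmf.expectation (sparse_sign_pmf q) (\<lambda>z. measure_pmf.expectation ?R (\<lambda>\<xi>.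
         F (MAX X\<in>T. c X + (2 * z * x p X + (\<Sum>p\<in>A. 2 * \<xi> p * x p X)))))"
    unfolding ER by (simp add: add_ac)
  also have "\<dots> = measure_pmf.expectation (Pi_pmf (insert p A) 0 (\<lambda>_. sparse_sign_pmf q))
      (\<lambda>\<xi>. F (MAX X\<in>T. c X + (\<Sum>p\<in>insert p A. 2 * \<xi> p * x p X)))"
    using insert.hyps by (subst expectation_Pi_pmf_insert) (simp_all only: insR finite_sparse_sign_pmf not_False_eq_True)
  finally show ?case .
qed simp

section \<open>The one-bit observation model\<close>

text \<open>Sampling and sign of one entry as a single variable, with 0 for a missing observation,
  so that \<open>\<Omega>\<close> becomes the support of \<open>Y\<close>.\<close>

definition cell_pmf :: "real \<Rightarrow> real \<Rightarrow> int pmf" where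
  "cell_pmf q p = bind_pmf (bernoulli_pmf q) (\<lambda>b. if b then sign_pmf p else return_pmf 0)"

lemma set_sign_pmf: "set_pmf (sign_pmf p) \<subseteq> {1, -1}"
  by (auto simp: sign_pmf_def)

lemma set_cell_pmf: "set_pmf (cell_pmf q p) \<subseteq> {0, 1, -1}"
  using set_sign_pmf[of p] by (auto simp: cell_pmf_def split: if_splits)

lemma finite_cell_pmf [simp]: "finite (set_pmf (cell_pmf q p))"
  using set_cell_pmf by (rule finite_subset) simp

lemma expectation_cell_pmf:
  fixes g :: "int \<Rightarrow> real"
  assumes "0 \<le> q" "q \<le> 1" "0 \<le> p" "p \<le> 1"
  shows "measure_pmf.expectation (cell_pmf q p) g = (1 - q) * g 0 + q * (p * g 1 + (1 - p) * g (-1))"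
proof -
  have "measure_pmf.expectation (cell_pmf q p) g = (\<Sum>b\<in>UNIV. pmf (bernoulli_pmf q) b *\<^sub>R
      measure_pmf.expectation (if b then sign_pmf p else return_pmf 0) g)"
    unfolding cell_pmf_def by (intro pmf_expectation_bind) (auto simp: sign_pmf_def)
  then show ?thesis using assms by (simp add: UNIV_bool sign_pmf_def)
qed

lemma prob_cell_pmf_active:
  assumes "0 \<le> q" "q \<le> 1" "0 \<le> p" "p \<le> 1"
  shows "measure_pmf.prob (cell_pmf q p) {s. s \<noteq> 0} = q"
proof -
  have "measure_pmf.prob (cell_pmf q p) {s. s \<noteq> 0} = measure_pmf.expectation (cell_pmf q p) (indicator {s. s \<noteq> 0})"
    by simp
  also have "\<dots> = q"
    using assms by (subst expectation_cell_pmf) (auto simp: algebra_simps)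
  finally show ?thesis .
qed

text \<open>A sign is never 0, so \<open>\<Omega>\<close> can be recovered from \<open>Y\<close>,
  and the two-stage experiment becomes a family of independent cells.\<close>

lemma one_bit_pmf_eq_cells:
  fixes M :: "real mat"
  defines "G \<equiv> {..<dim_row M} \<times> {..<dim_col M}"
  shows "one_bit_pmf f M n = map_pmf (\<lambda>Y. ({p. Y p \<noteq> 0}, Y))
     (Pi_pmf G 0 (\<lambda>p. cell_pmf (n / (real (dim_row M) * real (dim_col M))) (f (M $$ p))))"
proof -
  define q where "q = n / (real (dim_row M) * real (dim_col M))"
  have G: "finite G" by (simp add: G_def)
  let ?B = "Pi_pmf G False (\<lambda>_. bernoulli_pmf q)"
  have "Pi_pmf G 0 (\<lambda>p. cell_pmf q (f (M $$ p))) =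
     bind_pmf ?B (\<lambda>b. Pi_pmf G 0 (\<lambda>p. if b p then sign_pmf (f (M $$ p)) else return_pmf 0))"
    unfolding cell_pmf_def by (rule Pi_pmf_bind[OF G])
  also have "\<dots> = bind_pmf ?B (\<lambda>b. Pi_pmf {p \<in> G. b p} 0 (\<lambda>p. sign_pmf (f (M $$ p))))"
    by (simp add: Pi_pmf_if_set[OF G])
  finally have R: "Pi_pmf G 0 (\<lambda>p. cell_pmf q (f (M $$ p))) = \<dots>" .
  have "one_bit_pmf f M n =
     bind_pmf ?B (\<lambda>b. map_pmf (\<lambda>Y. ({p. b p}, Y)) (Pi_pmf {p. b p} 0 (\<lambda>p. sign_pmf (f (M $$ p)))))"
    unfolding one_bit_pmf_def bernoulli_sample_pmf_def G_def q_def by (simp add: bind_map_pmf)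
  also have "\<dots> = bind_pmf ?B (\<lambda>b. map_pmf (\<lambda>Y. ({p. Y p \<noteq> 0}, Y)) (Pi_pmf {p \<in> G. b p} 0 (\<lambda>p. sign_pmf (f (M $$ p)))))"
  proof (rule bind_pmf_cong[OF refl])
    fix b assume b: "b \<in> set_pmf ?B"
    have "\<forall>p. p \<notin> G \<longrightarrow> b p = False" using subsetD[OF set_Pi_pmf_subset[OF G] b] by simp
    then have eq: "{p. b p} = {p \<in> G. b p}" by auto
    have fin: "finite {p \<in> G. b p}" using G by simp
    have "map_pmf (\<lambda>Y. ({p \<in> G. b p}, Y)) (Pi_pmf {p \<in> G. b p} 0 (\<lambda>p. sign_pmf (f (M $$ p)))) =
       map_pmf (\<lambda>Y. ({p. Y p \<noteq> 0}, Y)) (Pi_pmf {p \<in> G. b p} 0 (\<lambda>p. sign_pmf (f (M $$ p))))"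
    proof (rule map_pmf_cong[OF refl])
      fix Y assume Y: "Y \<in> set_pmf (Pi_pmf {p \<in> G. b p} 0 (\<lambda>p. sign_pmf (f (M $$ p))))"
      have Yp: "(p \<in> {p \<in> G. b p} \<longrightarrow> Y p \<in> set_pmf (sign_pmf (f (M $$ p)))) \<and> (p \<notin> {p \<in> G. b p} \<longrightarrow> Y p = 0)" for p
        using Y unfolding set_Pi_pmf[OF fin] PiE_dflt_def o_def mem_Collect_eq by (rule spec)
      have "Y p \<noteq> 0" if "p \<in> G" "b p" for p
        using Yp[of p] that set_sign_pmf[of "f (M $$ p)"] by auto
      moreover have "Y p = 0" if "\<not> (p \<in> G \<and> b p)" for p
        using Yp[of p] that by simp
      ultimately have "{p \<in> G. b p} = {p. Y p \<noteq> 0}" by blast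
      then show "({p \<in> G. b p}, Y) = ({p. Y p \<noteq> 0}, Y)" by simp
    qed
    then show "map_pmf (\<lambda>Y. ({p. b p}, Y)) (Pi_pmf {p. b p} 0 (\<lambda>p. sign_pmf (f (M $$ p)))) =
       map_pmf (\<lambda>Y. ({p. Y p \<noteq> 0}, Y)) (Pi_pmf {p \<in> G. b p} 0 (\<lambda>p. sign_pmf (f (M $$ p))))"
      unfolding eq .
  qed
  also have "\<dots> = map_pmf (\<lambda>Y. ({p. Y p \<noteq> 0}, Y)) (Pi_pmf G 0 (\<lambda>p. cell_pmf q (f (M $$ p))))"
    unfolding R by (simp add: map_bind_pmf)
  finally show ?thesis unfolding q_def .
qed

text \<open>Every \<open>x\<close> takes part in the supremum as soon as
  \<open>a \<ge> |x|\<close>.\<close>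

lemma steepness_le_limit:
  assumes "(steepness f \<longlongrightarrow> L) at_top"
  shows "ereal (\<bar>deriv f x\<bar> / (f x * (1 - f x))) \<le> L"
proof (rule tendsto_lowerbound[OF assms])
  show "\<forall>\<^sub>F a in at_top. ereal (\<bar>deriv f x\<bar> / (f x * (1 - f x))) \<le> steepness f a"
    using eventually_ge_at_top[of "\<bar>x\<bar>"]
    by eventually_elim (auto simp: steepness_def intro!: SUP_upper)
qed simp

text \<open>The derivatives are \<open>f' / f\<close> and \<open>- f' / (1 - f)\<close>. The
  steepness has a further factor between 0 and 1 in its denominator and dominates both.\<close>

lemma log_likelihood_lipschitz:
  fixes f :: "real \<Rightarrow> real"
  assumes f: "\<And>x. 0 < f x" "\<And>x. f x < 1" "\<And>x. f differentiable at x"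
    and l: "\<And>x. \<bar>deriv f x\<bar> / (f x * (1 - f x)) \<le> l"
  shows "\<bar>ln (f x) - ln (f y)\<bar> \<le> l * \<bar>x - y\<bar>" "\<bar>ln (1 - f x) - ln (1 - f y)\<bar> \<le> l * \<bar>x - y\<bar>"
proof -
  have d: "(f has_field_derivative deriv f z) (at z)" for z
    using f(3) by (metis DERIV_imp_deriv real_differentiableE)
  have f1: "1 - f z > 0" for z using f(2)[of z] by simp
  have b1: "\<bar>deriv f z / f z\<bar> \<le> l" for z
  proof -
    have "\<bar>deriv f z\<bar> / f z \<le> \<bar>deriv f z\<bar> / (f z * (1 - f z))"
      using f(1)[of z] f1[of z] by (intro divide_left_mono) (auto intro: mult_left_le)
    then show ?thesis using l[of z] f(1)[of z] by (simp add: abs_divide)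
  qed
  have b2: "\<bar>- deriv f z / (1 - f z)\<bar> \<le> l" for z
  proof -
    have "f z * (1 - f z) \<le> 1 * (1 - f z)" using f(2)[of z] f1[of z] by (intro mult_right_mono) auto
    then have "\<bar>deriv f z\<bar> / (1 - f z) \<le> \<bar>deriv f z\<bar> / (f z * (1 - f z))"
      using f(1)[of z] f1[of z] by (intro divide_left_mono) auto
    then show ?thesis using l[of z] f1[of z] by (simp add: abs_divide)
  qed
  have "norm (ln (f x) - ln (f y)) \<le> l * norm (x - y)"
  proof (rule field_differentiable_bound[of UNIV])
    show "((\<lambda>z. ln (f z)) has_field_derivative deriv f z / f z) (at z within UNIV)" for z
      using d[of z] f(1)[of z] by (auto intro!: derivative_eq_intros)
  qed (use b1 in auto)
  then show "\<bar>ln (f x) - ln (f y)\<bar> \<le> l * \<bar>x - y\<bar>" by simp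
  have "norm (ln (1 - f x) - ln (1 - f y)) \<le> l * norm (x - y)"
  proof (rule field_differentiable_bound[of UNIV])
    show "((\<lambda>z. ln (1 - f z)) has_field_derivative - deriv f z / (1 - f z)) (at z within UNIV)" for z
      using d[of z] f1[of z] by (auto intro!: derivative_eq_intros)
  qed (use b2 in auto)
  then show "\<bar>ln (1 - f x) - ln (1 - f y)\<bar> \<le> l * \<bar>x - y\<bar>" by simp
qed

text \<open>\<open>ln (x / p)\<close> is twice the logarithm of \<open>u = sqrt (x / p)\<close>, and
  \<open>ln u \<le> u - 1\<close>. Weighted by \<open>p\<close> this yields the cross term of the
  Hellinger distance; the other outcome is the same with \<open>1 - x\<close> and
  \<open>1 - p\<close>.\<close>

lemma kl_ge_hellinger_sq:
  assumes "0 < x" "x < 1" "0 < p" "p < 1"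
  shows "p * (ln x - ln p) + (1 - p) * (ln (1 - x) - ln (1 - p)) \<le> - hellinger_sq x p"
proof -
  have *: "p * (ln x - ln p) \<le> 2 * sqrt x * sqrt p - 2 * p" if "0 < x" "0 < p" for x p :: real
  proof -
    have "ln x - ln p = 2 * ln (sqrt (x / p))" using that by (simp add: ln_sqrt ln_div)
    also have "\<dots> \<le> 2 * (sqrt (x / p) - 1)"
      using that by (intro mult_left_mono ln_le_minus_one) auto
    finally have "p * (ln x - ln p) \<le> p * (2 * (sqrt (x / p) - 1))"
      using that by (intro mult_left_mono) auto
    also have "\<dots> = 2 * (sqrt x * (p / sqrt p)) - 2 * p"
      by (simp add: real_sqrt_divide algebra_simps)
    finally show ?thesis using that by (simp add: real_div_sqrt)
  qed
  have "- hellinger_sq x p = (2 * sqrt x * sqrt p - 2 * p) + (2 * sqrt (1 - x) * sqrt (1 - p) - 2 * (1 - p))"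
    using assms by (simp add: hellinger_sq_def power2_diff)
  then show ?thesis using *[of x p] *[of "1 - x" "1 - p"] assms by simp
qed

text \<open>The log-likelihood ratio of \<open>X\<close> against \<open>M\<close> at one cell. It
  vanishes for the value 0 and for equal entries, as contraction to sparse signs requires.\<close>

definition cell_gain :: "(real \<Rightarrow> real) \<Rightarrow> real mat \<Rightarrow> nat \<times> nat \<Rightarrow> int \<Rightarrow> real mat \<Rightarrow> real" where
  "cell_gain f M p s X = of_bool (s = 1) * (ln (f (X $$ p)) - ln (f (M $$ p)))
     + of_bool (s = -1) * (ln (1 - f (X $$ p)) - ln (1 - f (M $$ p)))"

text \<open>Cutting at 0 makes the even power monotone, as contraction requires, and still permits
  Markov's inequality at positive thresholds.\<close>

lemma convex_mono_pos_part_power: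
  "convex_on UNIV (\<lambda>y::real. max y 0 ^ (2 * k))" "mono (\<lambda>y::real. max y 0 ^ (2 * k))"
proof -
  show "mono (\<lambda>y::real. max y 0 ^ (2 * k))"
    by (intro monoI power_mono) auto
  show "convex_on UNIV (\<lambda>y::real. max y 0 ^ (2 * k))"
  proof (rule convex_onI)
    fix t x y :: real assume t: "0 < t" "t < 1"
    have "max ((1 - t) *\<^sub>R x + t *\<^sub>R y) 0 \<le> (1 - t) * max x 0 + t * max y 0"
      using t by (simp add: add_mono mult_left_mono)
    then have "max ((1 - t) *\<^sub>R x + t *\<^sub>R y) 0 ^ (2 * k) \<le> ((1 - t) * max x 0 + t * max y 0) ^ (2 * k)"
      by (intro power_mono) auto
    also have "\<dots> \<le> (1 - t) * max x 0 ^ (2 * k) + t * max y 0 ^ (2 * k)"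
      using convex_onD[OF convex_power_even[of "2 * k"], of t "max x 0" "max y 0"] t by simp
    finally show "max ((1 - t) *\<^sub>R x + t *\<^sub>R y) 0 ^ (2 * k) \<le> (1 - t) * max x 0 ^ (2 * k) + t * max y 0 ^ (2 * k)" .
  qed simp
qed

text \<open>Markov's inequality for the \<open>2 k\<close>-th power of the positive part. In
  \<open>4 l \<tau>\<close> one factor 2 stems from symmetrization, the other from the difference of
  \<open>X\<close> and \<open>M\<close>, both of nuclear norm at most \<open>\<tau>\<close>.\<close>

lemma likelihood_deviation:
  fixes f :: "real \<Rightarrow> real" and M :: "real mat" and T :: "real mat set"
  assumes f: "\<And>x. 0 < f x" "\<And>x. f x < 1"
    and l: "l \<ge> 0" "\<And>x y. \<bar>ln (f x) - ln (f y)\<bar> \<le> l * \<bar>x - y\<bar>"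
      "\<And>x y. \<bar>ln (1 - f x) - ln (1 - f y)\<bar> \<le> l * \<bar>x - y\<bar>"
    and M: "M \<in> carrier_mat d1 d2" "nuclear_norm M \<le> \<tau>" and \<tau>: "\<tau> \<ge> 0"
    and T: "finite T" "T \<noteq> {}" "\<And>X. X \<in> T \<Longrightarrow> X \<in> carrier_mat d1 d2 \<and> nuclear_norm X \<le> \<tau>"
    and q: "0 \<le> q" "q \<le> 1" and k: "k > 0"
    and r: "r > 0" "real k + q * real d1 \<le> real r" "real k + q * real d2 \<le> real r"
    and t: "t > 0"
  defines "G \<equiv> {..<d1} \<times> {..<d2}"
  shows "measure_pmf.prob (Pi_pmf G 0 (\<lambda>p. cell_pmf q (f (M $$ p))))
      {Y. (MAX X\<in>T. \<Sum>p\<in>G. cell_gain f M p (Y p) X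
           - measure_pmf.expectation (cell_pmf q (f (M $$ p))) (\<lambda>s. cell_gain f M p s X)) > t}
    \<le> (4 * l * \<tau>) ^ (2 * k) * (2 * real d2 * (9216 * exp 8 * real r) ^ k) / t ^ (2 * k)"
proof -
  define F where "F y = max y 0 ^ (2 * k)" for y :: real
  have F: "convex_on UNIV F" "mono F"
    using convex_mono_pos_part_power[of k] by (simp_all add: F_def[abs_def])
  let ?D = "\<lambda>p. cell_pmf q (f (M $$ p))"
  let ?P = "Pi_pmf G 0 ?D"
  let ?S = "\<lambda>Y. MAX X\<in>T. \<Sum>p\<in>G. cell_gain f M p (Y p) X
           - measure_pmf.expectation (?D p) (\<lambda>s. cell_gain f M p s X)"
  have G: "finite G" by (simp add: G_def)
  have finP: "finite (set_pmf ?P)" using G by (intro finite_set_Pi_pmf) auto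
  have f': "0 \<le> f x" "f x \<le> 1" for x using f[of x] by auto
  have x1: "\<bar>cell_gain f M p s X\<bar> \<le> \<bar>l * (X $$ p - M $$ p)\<bar>" for p s X
    using l by (auto simp: cell_gain_def abs_mult)
  have x2: "\<bar>cell_gain f M p s X - cell_gain f M p s X'\<bar> \<le> \<bar>l * (X $$ p - M $$ p) - l * (X' $$ p - M $$ p)\<bar>" for p s X X'
    using l by (auto simp: cell_gain_def abs_mult right_diff_distrib[symmetric])
  have "measure_pmf.prob ?P {Y. ?S Y > t} = measure_pmf.expectation ?P (indicator {Y. ?S Y > t})"
    by simp
  also have "\<dots> \<le> measure_pmf.expectation ?P (\<lambda>Y. F (?S Y) / t ^ (2 * k))"
  proof (rule integral_mono)
    fix Y
    show "indicator {Y. ?S Y > t} Y \<le> F (?S Y) / t ^ (2 * k)"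
    proof (cases "?S Y > t")
      case True
      then have "t ^ (2 * k) \<le> F (?S Y)" unfolding F_def using t by (intro power_mono) auto
      then show ?thesis using True t by (simp add: indicator_def)
    next
      case False
      then show ?thesis using t by (simp add: F_def indicator_def)
    qed
  qed (auto intro: integrable_measure_pmf_finite[OF finP])
  also have "\<dots> = measure_pmf.expectation ?P (\<lambda>Y. F (?S Y)) / t ^ (2 * k)" by simp
  also have "measure_pmf.expectation ?P (\<lambda>Y. F (?S Y)) \<le>
     measure_pmf.expectation (Pi_pmf G 0 (\<lambda>_. sparse_sign_pmf q))
      (\<lambda>\<xi>. F (MAX X\<in>T. 0 + (\<Sum>p\<in>G. 2 * \<xi> p * (l * (X $$ p - M $$ p)))))"
    using symmetrize_contract[OF F T(1,2) G, where D = ?D and act = "\<lambda>s. s \<noteq> 0" and q = q and c = "\<lambda>_. 0"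
        and \<psi> = "cell_gain f M" and x = "\<lambda>p X. l * (X $$ p - M $$ p)" and d = 0]
      prob_cell_pmf_active[OF q f'] x1 x2 set_cell_pmf
    by (fastforce simp: cell_gain_def)
  also have "\<dots> \<le> measure_pmf.expectation (sparse_sign_matrix q d1 d2)
     (\<lambda>\<xi>. (4 * l * \<tau>) ^ (2 * k) * gram_trace d1 d2 (\<lambda>i j. \<xi> (i, j)) k)"
    unfolding sparse_sign_matrix_def G_def[symmetric]
  proof (rule integral_mono)
    fix \<xi> :: "nat \<times> nat \<Rightarrow> real"
    define s where "s = root (2 * k) (gram_trace d1 d2 (\<lambda>i j. \<xi> (i, j)) k)"
    have s: "s \<ge> 0" "s ^ (2 * k) = gram_trace d1 d2 (\<lambda>i j. \<xi> (i, j)) k"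
      using k gram_trace_nonneg by (auto simp: s_def)
    have inner: "\<bar>\<Sum>p\<in>G. \<xi> p * X $$ p\<bar> \<le> s * \<tau>" if "X \<in> carrier_mat d1 d2" "nuclear_norm X \<le> \<tau>" for X
      using inner_le_root_gram_trace[OF that(1) k that(2), of "\<lambda>i j. \<xi> (i, j)"]
      by (simp add: s_def G_def sum.cartesian_product case_prod_unfold)
    have "(MAX X\<in>T. 0 + (\<Sum>p\<in>G. 2 * \<xi> p * (l * (X $$ p - M $$ p)))) \<le> 4 * l * \<tau> * s"
    proof (rule Max.boundedI)
      fix y assume "y \<in> (\<lambda>X. 0 + (\<Sum>p\<in>G. 2 * \<xi> p * (l * (X $$ p - M $$ p)))) ` T"
      then obtain X where X: "X \<in> T" "y = (\<Sum>p\<in>G. 2 * \<xi> p * (l * (X $$ p - M $$ p)))" by auto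
      have "y = 2 * l * ((\<Sum>p\<in>G. \<xi> p * X $$ p) - (\<Sum>p\<in>G. \<xi> p * M $$ p))"
        unfolding X(2) by (simp add: sum_distrib_left algebra_simps flip: sum_subtractf)
      also have "\<dots> \<le> 2 * l * (s * \<tau> + s * \<tau>)"
      proof (rule mult_left_mono)
        have "\<bar>\<Sum>p\<in>G. \<xi> p * X $$ p\<bar> \<le> s * \<tau>" using inner T(3)[OF X(1)] by blast
        then show "(\<Sum>p\<in>G. \<xi> p * X $$ p) - (\<Sum>p\<in>G. \<xi> p * M $$ p) \<le> s * \<tau> + s * \<tau>"
          using inner[OF M] by linarith
      qed (use l(1) in simp)
      finally show "y \<le> 4 * l * \<tau> * s" by (simp add: algebra_simps)
    qed (use T in auto)
    then have "F (MAX X\<in>T. 0 + (\<Sum>p\<in>G. 2 * \<xi> p * (l * (X $$ p - M $$ p)))) \<le> F (4 * l * \<tau> * s)"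
      by (rule monoD[OF F(2)])
    also have "\<dots> = (4 * l * \<tau>) ^ (2 * k) * s ^ (2 * k)"
      using l(1) \<tau> s(1) by (simp add: F_def flip: power_mult_distrib)
    finally show "F (MAX X\<in>T. 0 + (\<Sum>p\<in>G. 2 * \<xi> p * (l * (X $$ p - M $$ p)))) \<le>
       (4 * l * \<tau>) ^ (2 * k) * gram_trace d1 d2 (\<lambda>i j. \<xi> (i, j)) k"
      unfolding s(2) .
  qed (use G in \<open>auto intro!: integrable_measure_pmf_finite finite_set_Pi_pmf\<close>)
  also have "\<dots> = (4 * l * \<tau>) ^ (2 * k) * measure_pmf.expectation (sparse_sign_matrix q d1 d2)
     (\<lambda>\<xi>. gram_trace d1 d2 (\<lambda>i j. \<xi> (i, j)) k)" by simp
  also have "\<dots> \<le> (4 * l * \<tau>) ^ (2 * k) * (2 * real d2 * (9216 * exp 8 * real r) ^ k)"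
    using l(1) \<tau> by (intro mult_left_mono sparse_sign_trace_moment q r) auto
  finally show ?thesis using t by (simp add: divide_right_mono)
qed

text \<open>Optimality makes the total gain nonnegative, so the centered gain is at least minus its
  mean. At each cell this is \<open>q\<close> times a Kullback-Leibler divergence.\<close>

lemma hellinger_le_deviation:
  fixes f :: "real \<Rightarrow> real" and M X :: "real mat"
  assumes f: "\<And>x. 0 < f x" "\<And>x. f x < 1"
    and M: "M \<in> carrier_mat d1 d2" and X: "X \<in> carrier_mat d1 d2"
    and d: "d1 > 0" "d2 > 0" and q: "0 \<le> q" "q \<le> 1"
    and Y: "\<And>p. p \<notin> {..<d1} \<times> {..<d2} \<Longrightarrow> Y p = 0"
    and opt: "log_likelihood f {p. Y p \<noteq> 0} Y M \<le> log_likelihood f {p. Y p \<noteq> 0} Y X"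
  defines "G \<equiv> {..<d1} \<times> {..<d2}"
  shows "q * (real d1 * real d2) * hellinger_sq_mat (map_mat f X) (map_mat f M)
    \<le> (\<Sum>p\<in>G. cell_gain f M p (Y p) X
         - measure_pmf.expectation (cell_pmf q (f (M $$ p))) (\<lambda>s. cell_gain f M p s X))"
proof -
  have f': "0 \<le> f x" "f x \<le> 1" for x using f[of x] by auto
  have "(\<Sum>p\<in>G. cell_gain f M p (Y p) X) = (\<Sum>p\<in>{p. Y p \<noteq> 0}. cell_gain f M p (Y p) X)"
    using Y by (intro sum.mono_neutral_right) (auto simp: G_def cell_gain_def)
  also have "\<dots> = log_likelihood f {p. Y p \<noteq> 0} Y X - log_likelihood f {p. Y p \<noteq> 0} Y M"
    unfolding log_likelihood_def sum_subtractf[symmetric]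
    by (intro sum.cong refl) (simp add: cell_gain_def algebra_simps)
  finally have gain: "(\<Sum>p\<in>G. cell_gain f M p (Y p) X) \<ge> 0" using opt by simp
  have "hellinger_sq_mat (map_mat f X) (map_mat f M) =
     (\<Sum>i<d1. \<Sum>j<d2. hellinger_sq (f (X $$ (i, j))) (f (M $$ (i, j)))) / (real d1 * real d2)"
    using M X by (simp add: hellinger_sq_mat_def)
  then have "q * (real d1 * real d2) * hellinger_sq_mat (map_mat f X) (map_mat f M) =
     (\<Sum>p\<in>G. q * hellinger_sq (f (X $$ p)) (f (M $$ p)))"
    using d by (simp add: G_def sum.cartesian_product case_prod_unfold flip: sum_distrib_left)
  also have "\<dots> \<le> (\<Sum>p\<in>G. - measure_pmf.expectation (cell_pmf q (f (M $$ p))) (\<lambda>s. cell_gain f M p s X))"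
  proof (rule sum_mono)
    fix p
    have "q * hellinger_sq (f (X $$ p)) (f (M $$ p)) \<le>
      q * (- (f (M $$ p) * (ln (f (X $$ p)) - ln (f (M $$ p))) + (1 - f (M $$ p)) * (ln (1 - f (X $$ p)) - ln (1 - f (M $$ p)))))"
      using kl_ge_hellinger_sq[OF f(1)[of "X $$ p"] f(2)[of "X $$ p"] f(1)[of "M $$ p"] f(2)[of "M $$ p"]] q
      by (intro mult_left_mono) auto
    also have "\<dots> = - measure_pmf.expectation (cell_pmf q (f (M $$ p))) (\<lambda>s. cell_gain f M p s X)"
      by (simp add: expectation_cell_pmf[OF q f'] cell_gain_def algebra_simps)
    finally show "q * hellinger_sq (f (X $$ p)) (f (M $$ p)) \<le>
       - measure_pmf.expectation (cell_pmf q (f (M $$ p))) (\<lambda>s. cell_gain f M p s X)" .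
  qed
  also have "\<dots> \<le> (\<Sum>p\<in>G. cell_gain f M p (Y p) X
         - measure_pmf.expectation (cell_pmf q (f (M $$ p))) (\<lambda>s. cell_gain f M p s X))"
    using gain by (simp add: sum_subtractf sum_negf)
  finally show ?thesis .
qed

section \<open>The recovery bound\<close>

text \<open>Rests on \<open>d1 + d2 - 1 \<le> d1 d2\<close>. Small dimensions must be excluded, as
  the right side is 0 for \<open>d1 = d2 = 1\<close>. The summand 2 accounts for the two ceilings in
  the choice of \<open>k\<close> and \<open>r\<close>.\<close>

lemma ln_le_4_ln_product:
  assumes "d1 > 0" "d2 > 0" "d1 + d2 \<ge> 5"
  shows "ln (real (d1 + d2)) + 2 \<le> 4 * ln (real d1 * real d2)"
proof -
  define x where "x = real (d1 + d2) - 1"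
  have x: "x \<ge> 4" using assms by (simp add: x_def)
  have "0 \<le> (real d1 - 1) * (real d2 - 1)" using assms by (intro mult_nonneg_nonneg) auto
  then have prod: "x \<le> real d1 * real d2" by (simp add: x_def algebra_simps)
  have "4 * x \<le> x * x" using x by (intro mult_right_mono) auto
  moreover have "real (d1 + d2) = x + 1" by (simp add: x_def)
  ultimately have "real (d1 + d2) \<le> x * x" using x by linarith
  then have "ln (real (d1 + d2)) \<le> ln (x * x)" using assms x by (subst ln_le_cancel_iff) auto
  then have 1: "ln (real (d1 + d2)) \<le> 2 * ln x" using x by (simp add: ln_mult)
  have "exp 1 \<le> x" using exp_le x by linarith
  then have 2: "1 \<le> ln x" using x by (subst ln_ge_iff) auto
  have "ln x \<le> ln (real d1 * real d2)" using prod x by (subst ln_le_cancel_iff) auto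
  then show ?thesis using 1 2 by linarith
qed

text \<open>With \<open>P = d1 d2\<close> and \<open>D = d1 + d2\<close>, the inequality
  \<open>P \<le> D^2\<close> gives \<open>P r \<le> 4 (n D + D^2 ln P)\<close>; the bracket is
  \<open>n^2\<close> times the product of \<open>D / n\<close> and
  \<open>1 + D ln P / n\<close>.\<close>

lemma rate_bound:
  fixes n :: real
  assumes d: "d1 > 0" "d2 > 0" "d1 + d2 \<ge> 5" and n: "0 < n" "n \<le> real d1 * real d2"
    and r: "r \<le> ln (real (d1 + d2)) + 2 + n / (real d1 * real d2) * real (max d1 d2)" and K: "K \<ge> 0"
    and pos: "\<alpha> > 0" "l > 0" "\<rho> > 0"
    and h: "n * h \<le> 4 * l * (\<alpha> * sqrt (real d1 * real d2 * \<rho>)) * (exp 1 * sqrt (K * r))"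
  shows "h \<le> 8 * exp 1 * sqrt K * \<alpha> * l *
    (sqrt (\<rho> * real (d1 + d2) / n) * sqrt (1 + real (d1 + d2) * ln (real d1 * real d2) / n))"
proof -
  define D where "D = real (d1 + d2)"
  define P where "P = real d1 * real d2"
  have P: "P > 0" using d by (simp add: P_def)
  have D: "D \<ge> 5" using d by (simp add: D_def)
  have lnP: "ln D + 2 \<le> 4 * ln P" unfolding D_def P_def by (rule ln_le_4_ln_product[OF d])
  have lnD: "ln D \<ge> 0" using D by simp
  have "real d1 * real d2 \<le> D * D" using d by (intro mult_mono) (auto simp: D_def)
  then have PD: "P \<le> D * D" by (simp add: P_def)
  have "P * r \<le> P * (4 * ln P + n / P * D)"
  proof (rule mult_left_mono)
    have "n / P * real (max d1 d2) \<le> n / P * D" using n P by (intro mult_left_mono) (auto simp: D_def)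
    then show "r \<le> 4 * ln P + n / P * D" using r lnP unfolding D_def P_def by linarith
  qed (use P in simp)
  also have "\<dots> = P * (4 * ln P) + n * D" using P by (simp add: field_simps)
  also have "\<dots> \<le> (D * D) * (4 * ln P) + n * D"
    using lnP lnD by (intro add_right_mono mult_right_mono PD) auto
  also have "\<dots> \<le> 4 * (n * D + D * D * ln P)" using n D by simp
  finally have Pr: "P * r \<le> 4 * (n * D + D * D * ln P)" .
  have eq: "\<rho> * D / n * (1 + D * ln P / n) = \<rho> * (n * D + D * D * ln P) / (n * n)"
    using n by (simp add: field_simps)
  have "sqrt (P * \<rho>) * sqrt (K * r) = sqrt (K * \<rho> * (P * r))"
    by (simp add: real_sqrt_mult mult_ac)
  also have "\<dots> \<le> sqrt (K * \<rho> * (4 * (n * D + D * D * ln P)))"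
    using Pr K pos by (intro real_sqrt_le_mono mult_left_mono) auto
  also have "\<dots> = 2 * sqrt K * sqrt (\<rho> * (n * D + D * D * ln P))"
  proof -
    have "K * \<rho> * (4 * z) = 4 * (K * (\<rho> * z))" for z by simp
    then show ?thesis by (simp only: real_sqrt_mult real_sqrt_four mult.assoc)
  qed
  also have "sqrt (\<rho> * (n * D + D * D * ln P)) = n * (sqrt (\<rho> * D / n) * sqrt (1 + D * ln P / n))"
    unfolding real_sqrt_mult[symmetric] eq using n by (simp add: real_sqrt_divide)
  finally have key: "sqrt (P * \<rho>) * sqrt (K * r) \<le> 2 * sqrt K * (n * (sqrt (\<rho> * D / n) * sqrt (1 + D * ln P / n)))" .
  have "n * h \<le> 4 * l * \<alpha> * exp 1 * (sqrt (P * \<rho>) * sqrt (K * r))"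
    using h by (simp add: P_def mult_ac)
  also have "\<dots> \<le> 4 * l * \<alpha> * exp 1 * (2 * sqrt K * (n * (sqrt (\<rho> * D / n) * sqrt (1 + D * ln P / n))))"
    using pos by (intro mult_left_mono key) auto
  also have "\<dots> = n * (8 * exp 1 * sqrt K * \<alpha> * l * (sqrt (\<rho> * D / n) * sqrt (1 + D * ln P / n)))"
    by simp
  finally show ?thesis using n(1) unfolding D_def P_def by simp
qed

lemma one_bit_hellinger_bound:
  fixes f :: "real \<Rightarrow> real" and M :: "real mat"
    and Mhat :: "(nat \<times> nat) set \<Rightarrow> (nat \<times> nat \<Rightarrow> int) \<Rightarrow> real mat"
  assumes d: "d1 > 0" "d2 > 0" "d1 + d2 \<ge> 5" and pos: "\<alpha> > 0" "\<rho> > 0" "l > 0"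
    and n: "0 < n" "n \<le> real d1 * real d2"
    and f: "\<And>x. 0 < f x" "\<And>x. f x < 1"
    and l: "\<And>x y. \<bar>ln (f x) - ln (f y)\<bar> \<le> l * \<bar>x - y\<bar>"
      "\<And>x y. \<bar>ln (1 - f x) - ln (1 - f y)\<bar> \<le> l * \<bar>x - y\<bar>"
    and M: "M \<in> carrier_mat d1 d2" "nuclear_norm M \<le> \<alpha> * sqrt (real d1 * real d2 * \<rho>)"
    and opt: "\<And>\<Omega> Y. (\<Omega>, Y) \<in> set_pmf (one_bit_pmf f M n) \<Longrightarrow>
       is_arg_max (log_likelihood f \<Omega> Y)
         (\<lambda>X. X \<in> carrier_mat d1 d2 \<and> nuclear_norm X \<le> \<alpha> * sqrt (real d1 * real d2 * \<rho>)) (Mhat \<Omega> Y)"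
  shows "measure_pmf.prob (one_bit_pmf f M n)
     {(\<Omega>, Y). hellinger_sq_mat (map_mat f (Mhat \<Omega> Y)) (map_mat f M)
        \<le> 8 * exp 1 * sqrt (9216 * exp 8) * \<alpha> * l * (sqrt (\<rho> * real (d1 + d2) / n) *
             sqrt (1 + real (d1 + d2) * ln (real d1 * real d2) / n))} \<ge> 1 - 4 / real (d1 + d2)"
proof -
  define G where "G = {..<d1} \<times> {..<d2}"
  define q where "q = n / (real d1 * real d2)"
  define D where "D = Pi_pmf G 0 (\<lambda>p. cell_pmf q (f (M $$ p)))"
  define \<tau> where "\<tau> = \<alpha> * sqrt (real d1 * real d2 * \<rho>)"
  define obs where "obs Y = ({p. Y p \<noteq> 0}, Y)" for Y :: "nat \<times> nat \<Rightarrow> int"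
  define est where "est Y = Mhat {p. Y p \<noteq> 0} Y" for Y
  have G: "finite G" by (simp add: G_def)
  have finD: "finite (set_pmf D)" using G unfolding D_def by (intro finite_set_Pi_pmf) auto
  have law: "one_bit_pmf f M n = map_pmf obs D"
    using one_bit_pmf_eq_cells[of f M n] M(1) by (simp add: G_def q_def D_def obs_def[abs_def])
  have q: "0 \<le> q" "q \<le> 1" "q * (real d1 * real d2) = n" using n d by (auto simp: q_def)
  have \<tau>: "\<tau> > 0" using pos d by (simp add: \<tau>_def)
  have est: "est Y \<in> carrier_mat d1 d2" "nuclear_norm (est Y) \<le> \<tau>"
      "log_likelihood f {p. Y p \<noteq> 0} Y M \<le> log_likelihood f {p. Y p \<noteq> 0} Y (est Y)" if "Y \<in> set_pmf D" for Y
  proof -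
    have "({p. Y p \<noteq> 0}, Y) \<in> set_pmf (one_bit_pmf f M n)" using that by (auto simp: law obs_def)
    from opt[OF this]
    show "est Y \<in> carrier_mat d1 d2" "nuclear_norm (est Y) \<le> \<tau>"
      "log_likelihood f {p. Y p \<noteq> 0} Y M \<le> log_likelihood f {p. Y p \<noteq> 0} Y (est Y)"
      using M by (auto simp: is_arg_max_def est_def \<tau>_def not_less)
  qed
  \<comment> \<open>All values the estimator can take: a finite set fixed before the data are drawn,
    so the deviation bound applies to the maximum over it.\<close>
  define T where "T = est ` set_pmf D"
  have T: "finite T" "T \<noteq> {}" "\<And>X. X \<in> T \<Longrightarrow> X \<in> carrier_mat d1 d2 \<and> nuclear_norm X \<le> \<tau>"
    using finD est set_pmf_not_empty[of D] by (auto simp: T_def)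
  \<comment> \<open>This gives \<open>exp (2 k) \<ge> (d1 + d2)^2\<close>, which outweighs the
    factor \<open>d2\<close> of the trace moment, while \<open>k\<close> adds no more than a
    logarithm to \<open>r\<close>.\<close>
  define k where "k = nat \<lceil>ln (real (d1 + d2))\<rceil>"
  define r where "r = k + nat \<lceil>q * real (max d1 d2)\<rceil>"
  have ln: "ln (real (d1 + d2)) > 0" using d by simp
  have k: "k > 0" "ln (real (d1 + d2)) \<le> real k" "real k \<le> ln (real (d1 + d2)) + 1"
    using ln by (auto simp: k_def)
  have qm: "0 \<le> q * real (max d1 d2)" using q by simp
  have m: "q * real (max d1 d2) \<le> real (nat \<lceil>q * real (max d1 d2)\<rceil>)"
    "real (nat \<lceil>q * real (max d1 d2)\<rceil>) \<le> q * real (max d1 d2) + 1"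
    using qm by linarith+
  have qd: "q * real d1 \<le> q * real (max d1 d2)" "q * real d2 \<le> q * real (max d1 d2)"
    using q by (auto intro!: mult_left_mono)
  have r: "r > 0" "real k + q * real d1 \<le> real r" "real k + q * real d2 \<le> real r"
    "real r \<le> ln (real (d1 + d2)) + 2 + n / (real d1 * real d2) * real (max d1 d2)"
    using k m qd unfolding r_def q_def[symmetric] by auto
  define \<Lambda> where "\<Lambda> = 9216 * exp 8 * real r"
  have \<Lambda>: "\<Lambda> > 0" using r by (simp add: \<Lambda>_def)
  \<comment> \<open>The scale of the moment bound times \<open>exp 1\<close>, so that Markov's
    inequality leaves \<open>2 d2 exp (-2 k)\<close>.\<close>
  define t where "t = 4 * l * \<tau> * (exp 1 * sqrt \<Lambda>)"
  have t: "t > 0" using pos \<tau> \<Lambda> by (simp add: t_def)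
  let ?S = "\<lambda>X Y. \<Sum>p\<in>G. cell_gain f M p (Y p) X
      - measure_pmf.expectation (cell_pmf q (f (M $$ p))) (\<lambda>s. cell_gain f M p s X)"
  have "measure_pmf.prob D {Y. (MAX X\<in>T. ?S X Y) > t} \<le>
     (4 * l * \<tau>) ^ (2 * k) * (2 * real d2 * \<Lambda> ^ k) / t ^ (2 * k)"
    unfolding D_def G_def \<Lambda>_def
    using pos \<tau> M T q k(1) r t by (intro likelihood_deviation f l) (auto simp: \<tau>_def)
  also have "t ^ (2 * k) = (4 * l * \<tau>) ^ (2 * k) * (exp 1 ^ (2 * k) * \<Lambda> ^ k)"
    using \<Lambda> unfolding t_def power_mult_distrib by (simp add: power_mult)
  also have "(4 * l * \<tau>) ^ (2 * k) * (2 * real d2 * \<Lambda> ^ k) / ((4 * l * \<tau>) ^ (2 * k) * (exp 1 ^ (2 * k) * \<Lambda> ^ k))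
      = 2 * real d2 / exp 1 ^ (2 * k)"
    using \<Lambda> pos \<tau> by simp
  also have "\<dots> \<le> 2 * real d2 / (real (d1 + d2))\<^sup>2"
  proof -
    have "real (d1 + d2) = exp (ln (real (d1 + d2)))" using d by simp
    also have "\<dots> \<le> exp (real k)" using k by simp
    also have "\<dots> = exp 1 ^ k" using exp_of_nat_mult[of k "1::real"] by simp
    finally have "(real (d1 + d2))\<^sup>2 \<le> (exp 1 ^ k)\<^sup>2" by (intro power_mono) auto
    then show ?thesis using d by (intro divide_left_mono) (auto simp: mult.commute simp flip: power_mult)
  qed
  also have "\<dots> \<le> 4 / real (d1 + d2)"
  proof -
    have "2 * real d2 * real (d1 + d2) \<le> 4 * (real (d1 + d2))\<^sup>2"
      unfolding power2_eq_square mult.assoc[symmetric] by (intro mult_right_mono) auto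
    then show ?thesis using d by (simp add: divide_simps power2_eq_square)
  qed
  finally have small: "measure_pmf.prob D {Y. (MAX X\<in>T. ?S X Y) > t} \<le> 4 / real (d1 + d2)" .
  let ?good = "{(\<Omega>, Y). hellinger_sq_mat (map_mat f (Mhat \<Omega> Y)) (map_mat f M)
        \<le> 8 * exp 1 * sqrt (9216 * exp 8) * \<alpha> * l * (sqrt (\<rho> * real (d1 + d2) / n) *
             sqrt (1 + real (d1 + d2) * ln (real d1 * real d2) / n))}"
  have good: "obs Y \<in> ?good" if Y: "Y \<in> set_pmf D" and S: "(MAX X\<in>T. ?S X Y) \<le> t" for Y
  proof -
    have "\<forall>p. p \<notin> G \<longrightarrow> Y p = 0"
      using subsetD[OF set_Pi_pmf_subset[OF G] Y[unfolded D_def]] unfolding mem_Collect_eq .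
    then have Y0: "Y p = 0" if "p \<notin> {..<d1} \<times> {..<d2}" for p
      using that unfolding G_def by blast
    have "n * hellinger_sq_mat (map_mat f (est Y)) (map_mat f M) \<le> ?S (est Y) Y"
      using hellinger_le_deviation[OF f M(1) est(1)[OF Y] d(1,2) q(1,2) Y0 est(3)[OF Y]]
      unfolding q(3) G_def .
    also have "\<dots> \<le> (MAX X\<in>T. ?S X Y)"
      using T(1) Y by (intro Max_ge) (auto simp: T_def)
    also have "\<dots> \<le> t" by (rule S)
    finally have "n * hellinger_sq_mat (map_mat f (est Y)) (map_mat f M) \<le>
       4 * l * (\<alpha> * sqrt (real d1 * real d2 * \<rho>)) * (exp 1 * sqrt (9216 * exp 8 * real r))"
      by (simp only: t_def \<tau>_def \<Lambda>_def)
    from rate_bound[OF d n r(4) _ pos(1) pos(3) pos(2) this]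
    show ?thesis by (simp add: obs_def est_def)
  qed
  have "1 - 4 / real (d1 + d2) \<le> 1 - measure_pmf.prob D {Y. (MAX X\<in>T. ?S X Y) > t}"
    using small by simp
  also have "\<dots> = measure_pmf.prob D (UNIV - {Y. (MAX X\<in>T. ?S X Y) > t})"
    using measure_pmf.prob_compl[of "{Y. (MAX X\<in>T. ?S X Y) > t}" D] by simp
  also have "\<dots> \<le> measure_pmf.prob D (obs -` ?good)"
  \<comment> \<open>Optimality of the estimator is known on the support of the data, so the events
    are compared almost surely.\<close>
  proof (rule measure_pmf.finite_measure_mono_AE)
    show "AE Y in measure_pmf D. Y \<in> UNIV - {Y. (MAX X\<in>T. ?S X Y) > t} \<longrightarrow> Y \<in> obs -` ?good"
      using good by (auto simp: AE_measure_pmf_iff not_less)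
  qed simp
  also have "\<dots> = measure_pmf.prob (one_bit_pmf f M n) ?good"
    by (simp only: law measure_map_pmf)
  finally show ?thesis .
qed

theorem theorem2:
  "\<exists>C1 C2 :: real. C1 > 0 \<and> C2 > 0 \<and>
    (\<forall>(d1::nat) (d2::nat) (\<alpha>::real) (r::real) (n::real) (f :: real \<Rightarrow> real) (L::ereal) (M :: real mat)
        (Mhat :: (nat \<times> nat) set \<Rightarrow> (nat \<times> nat \<Rightarrow> int) \<Rightarrow> real mat).
      d1 > 0 \<longrightarrow> d2 > 0 \<longrightarrow> \<alpha> > 0 \<longrightarrow> r > 0 \<longrightarrow> 0 < n \<longrightarrow> n \<le> real d1 * real d2 \<longrightarrow>
      (\<forall>x. 0 \<le> f x \<and> f x \<le> 1) \<longrightarrow>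
      (\<forall>x. f differentiable at x) \<longrightarrow>
      (\<forall>a>0. steepness_defined f a) \<longrightarrow>
      (steepness f \<longlongrightarrow> L) at_top \<longrightarrow>
      M \<in> carrier_mat d1 d2 \<longrightarrow>
      nuclear_norm M \<le> \<alpha> * sqrt (real d1 * real d2 * r) \<longrightarrow>
      (\<forall>(\<Omega>, Y) \<in> set_pmf (one_bit_pmf f M n).
         is_arg_max (log_likelihood f \<Omega> Y)
           (\<lambda>X. X \<in> carrier_mat d1 d2 \<and> nuclear_norm X \<le> \<alpha> * sqrt (r * real d1 * real d2))
           (Mhat \<Omega> Y)) \<longrightarrow>
      measure_pmf.prob (one_bit_pmf f M n)
        {(\<Omega>, Y).
           ereal (hellinger_sq_mat (map_mat f (Mhat \<Omega> Y)) (map_mat f M))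
             \<le> ereal (C2 * \<alpha>) * L *
               ereal (sqrt (r * real (d1 + d2) / n) *
                      sqrt (1 + real (d1 + d2) * ln (real d1 * real d2) / n))
           \<and> (n \<ge> real (d1 + d2) * ln (real d1 * real d2) \<longrightarrow>
              ereal (hellinger_sq_mat (map_mat f (Mhat \<Omega> Y)) (map_mat f M))
                \<le> ereal (sqrt 2 * C2 * \<alpha>) * L * ereal (sqrt (r * real (d1 + d2) / n)))}
        \<ge> 1 - C1 / real (d1 + d2))"
proof -
  \<comment> \<open>The factor 8 is 4 from the deviation bound times \<open>sqrt 4\<close> from the
    rate, \<open>exp 1\<close> comes from the threshold \<open>t\<close>, and
    \<open>9216 exp 8\<close> from the dense sign matrix.\<close>
  define C2 :: real where "C2 = 8 * exp 1 * sqrt (9216 * exp 8)"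
  have C2: "C2 > 0" by (simp add: C2_def)
  show ?thesis
  \<comment> \<open>The choice 4 makes the claim empty for \<open>d1 + d2 \<le> 4\<close>.\<close>
  proof (rule exI[of _ 4], rule exI[of _ C2], intro conjI allI impI)
    fix d1 d2 :: nat and \<alpha> r n :: real and f :: "real \<Rightarrow> real" and L :: ereal and M :: "real mat"
      and Mhat :: "(nat \<times> nat) set \<Rightarrow> (nat \<times> nat \<Rightarrow> int) \<Rightarrow> real mat"
    assume d: "d1 > 0" "d2 > 0" and pos: "\<alpha> > 0" "r > 0" and n: "0 < n" "n \<le> real d1 * real d2"
      and diff: "\<forall>x. f differentiable at x" and def: "\<forall>a>0. steepness_defined f a"
      and lim: "(steepness f \<longlongrightarrow> L) at_top"
      and M: "M \<in> carrier_mat d1 d2" "nuclear_norm M \<le> \<alpha> * sqrt (real d1 * real d2 * r)"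
      and opt: "\<forall>(\<Omega>, Y) \<in> set_pmf (one_bit_pmf f M n).
         is_arg_max (log_likelihood f \<Omega> Y)
           (\<lambda>X. X \<in> carrier_mat d1 d2 \<and> nuclear_norm X \<le> \<alpha> * sqrt (r * real d1 * real d2))
           (Mhat \<Omega> Y)"
    let ?H = "\<lambda>\<Omega> Y. hellinger_sq_mat (map_mat f (Mhat \<Omega> Y)) (map_mat f M)"
    let ?A = "sqrt (r * real (d1 + d2) / n)"
    let ?B = "sqrt (1 + real (d1 + d2) * ln (real d1 * real d2) / n)"
    let ?good = "{(\<Omega>, Y). ereal (?H \<Omega> Y) \<le> ereal (C2 * \<alpha>) * L * ereal (?A * ?B)
       \<and> (n \<ge> real (d1 + d2) * ln (real d1 * real d2) \<longrightarrow>
            ereal (?H \<Omega> Y) \<le> ereal (sqrt 2 * C2 * \<alpha>) * L * ereal ?A)}"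
    let ?P = "measure_pmf.prob (one_bit_pmf f M n)"
    have f: "0 < f x" "f x < 1" for x
    proof -
      have "steepness_defined f (\<bar>x\<bar> + 1)" using def by simp
      then show "0 < f x" "f x < 1" by (simp_all add: steepness_defined_def)
    qed
    have L: "ereal (\<bar>deriv f x\<bar> / (f x * (1 - f x))) \<le> L" for x by (rule steepness_le_limit[OF lim])
    have "real 1 \<le> real d1 * real d2" using d by (metis One_nat_def Suc_leI nat_0_less_mult_iff of_nat_le_iff of_nat_mult)
    then have ln0: "ln (real d1 * real d2) \<ge> 0" by simp
    have A: "?A > 0" using pos d n by simp
    have "1 \<le> 1 + real (d1 + d2) * ln (real d1 * real d2) / n" using ln0 n by simp
    then have B: "?B > 0" by simp
    have opt': "is_arg_max (log_likelihood f \<Omega> Y)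
         (\<lambda>X. X \<in> carrier_mat d1 d2 \<and> nuclear_norm X \<le> \<alpha> * sqrt (real d1 * real d2 * r)) (Mhat \<Omega> Y)"
      if "(\<Omega>, Y) \<in> set_pmf (one_bit_pmf f M n)" for \<Omega> Y
    proof -
      have "r * real d1 * real d2 = real d1 * real d2 * r" by simp
      then show ?thesis using bspec[OF opt that] by (simp only: prod.case)
    qed
    have one: "?P ?good \<ge> 1 - 4 / real (d1 + d2)" if all: "\<And>\<Omega> Y. (\<Omega>, Y) \<in> set_pmf (one_bit_pmf f M n) \<Longrightarrow> (\<Omega>, Y) \<in> ?good"
    proof -
      have "?P ?good = 1"
        by (subst measure_pmf.prob_eq_1) (use all in \<open>auto simp: AE_measure_pmf_iff\<close>)
      then show ?thesis by simp
    qed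
    show "?P ?good \<ge> 1 - 4 / real (d1 + d2)"
    proof (cases "d1 + d2 \<ge> 5")
      case False
      then have "1 - 4 / real (d1 + d2) \<le> 0" using d by (simp add: field_simps)
      also have "0 \<le> ?P ?good" by simp
      finally show ?thesis .
    next
      case d5: True
      show ?thesis
      proof (cases L)
        case MInf
        then show ?thesis using L[of 0] by simp
      next
        case PInf
        have inf: "ereal x \<le> ereal u * L * ereal v" if "u > 0" "v > 0" for x u v
          using that by (simp add: PInf)
        have u: "C2 * \<alpha> > 0" "sqrt 2 * C2 * \<alpha> > 0" using C2 pos by simp_all
        have "?A * ?B > 0" using A B by (rule mult_pos_pos)
        then have "(\<Omega>, Y) \<in> ?good" for \<Omega> Y
          unfolding mem_Collect_eq prod.case using inf u A by blast
        then show ?thesis by (intro one)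
      next
        case (real l)
        have er: "ereal u * L * ereal v = ereal (u * l * v)" for u v by (simp add: real)
        have l: "\<bar>deriv f x\<bar> / (f x * (1 - f x)) \<le> l" for x using L[of x] real by simp
        have lip1: "\<bar>ln (f x) - ln (f y)\<bar> \<le> l * \<bar>x - y\<bar>" for x y
          by (rule log_likelihood_lipschitz(1)[where f = f]) (use f diff l in blast)+
        have lip2: "\<bar>ln (1 - f x) - ln (1 - f y)\<bar> \<le> l * \<bar>x - y\<bar>" for x y
          by (rule log_likelihood_lipschitz(2)[where f = f]) (use f diff l in blast)+
        have "0 \<le> \<bar>deriv f 0\<bar> / (f 0 * (1 - f 0))" using f[of 0] by simp
        then have l0: "l \<ge> 0" using l[of 0] by linarith
        show ?thesis
        proof (cases "l = 0")
          \<comment> \<open>Here \<open>f\<close> is constant and the distance is 0. The case is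
            separate because the threshold in Markov's inequality would be 0.\<close>
          case True
          have "ln (f x) = ln (f y)" for x y
            using lip1[of x y] True by simp
          then have const: "f x = f y" for x y using f(1) ln_inj_iff by blast
          have "(\<Omega>, Y) \<in> ?good" if "(\<Omega>, Y) \<in> set_pmf (one_bit_pmf f M n)" for \<Omega> Y
          proof -
            have "Mhat \<Omega> Y \<in> carrier_mat d1 d2" using opt'[OF that] by (simp add: is_arg_max_def)
            moreover have "hellinger_sq (f x) (f y) = 0" for x y
              unfolding const[of x y] by (simp add: hellinger_sq_def)
            ultimately have "?H \<Omega> Y = 0"
              using M(1) by (simp add: hellinger_sq_mat_def)
            then show ?thesis unfolding mem_Collect_eq prod.case er True by simp
          qed
          then show ?thesis by (intro one)
        next
          case False
          then have lpos: "l > 0" using l0 by simp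
          have "1 - 4 / real (d1 + d2) \<le> ?P {(\<Omega>, Y). ?H \<Omega> Y \<le> C2 * \<alpha> * l * (?A * ?B)}"
            unfolding C2_def
            by (rule one_bit_hellinger_bound[OF d d5 pos lpos n f lip1 lip2 M opt'])
          also have "\<dots> \<le> ?P ?good"
          proof (rule measure_pmf.finite_measure_mono)
            show "{(\<Omega>, Y). ?H \<Omega> Y \<le> C2 * \<alpha> * l * (?A * ?B)} \<subseteq> ?good"
            proof safe
              fix \<Omega> Y assume H: "?H \<Omega> Y \<le> C2 * \<alpha> * l * (?A * ?B)"
              then show "ereal (?H \<Omega> Y) \<le> ereal (C2 * \<alpha>) * L * ereal (?A * ?B)" by (simp only: er ereal_less_eq)
              assume "n \<ge> real (d1 + d2) * ln (real d1 * real d2)"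
              \<comment> \<open>The second summand under the root is at most 1.\<close>
              then have "?B \<le> sqrt 2" using n by (intro real_sqrt_le_mono) simp
              then have "C2 * \<alpha> * l * (?A * ?B) \<le> C2 * \<alpha> * l * (?A * sqrt 2)"
                using C2 pos l0 A by (intro mult_left_mono) auto
              then have "?H \<Omega> Y \<le> sqrt 2 * C2 * \<alpha> * l * ?A" using H by (simp add: mult_ac)
              then show "ereal (?H \<Omega> Y) \<le> ereal (sqrt 2 * C2 * \<alpha>) * L * ereal ?A" by (simp only: er ereal_less_eq)
            qed
          qed simp
          finally show ?thesis .
        qed
      qed
    qed
  qed (use C2 in simp_all)
qed

end
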